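(* A full order $\mathcal R$ of $\mathbb A=\mathbb M_2(K)$ is a ghost intersection of maximal orders if and only if its Gorenstein closure $\mathrm{Gor}(\mathcal R)$ is a Bass order.
   Context: $K$ is a non-archimedean local field with ring of integers $\mathcal O_K$ and uniformizer $\pi_K$; $\mathbb A=\mathbb M_2(K)$ with identity $\mathbf 1$. An order of $\mathbb A$ is a subring containing $\mathbf 1$ which is a finitely generated $\mathcal O_K$-submodule; it is full if it spans $\mathbb A$ over $K$. For a finite extension $L/K$, the analogous notions apply to $\mathcal O_L$-orders in $\mathbb M_2(L)\supseteq\mathbb A$. A full order $\mathcal R$ is Gorenstein if its codifferent $\{a\in\mathbb A:\mathrm{tr}(a\mathcal R)\subseteq\mathcal O_K\}$ is invertible as a two-sided fractional $\mathcal R$-ideal; equivalently, $\mathcal R$ admits no expression $\mathcal R=\mathcal O_K\mathbf 1+I\mathcal R'$ with $\mathcal R'$ an order and $I\subsetneq\mathcal O_K$ a nonzero ideal. Every full order $\mathcal R$ can be written uniquely as $\mathcal R=\mathcal O_K\mathbf 1+I\tilde{\mathcal R}$ with $\tilde{\mathcal R}$ a Gorenstein order and $I$ a nonzero ideal of $\mathcal O_K$; $\tilde{\mathcal R}=\mathrm{Gor}(\mathcal R)$ is the Gorenstein closure of $\mathcal R$. A full order is Bass if every order containing it is Gorenstein. A ghost intersection of maximal orders is a full order of the form $\mathcal R=\mathbb A\cap\bigcap_{i=1}^n\mathcal D_i$, where $L/K$ is some finite field extension and $\mathcal D_1,\dots,\mathcal D_n$ are maximal $\mathcal O_L$-orders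 in $\mathbb M_2(L)$. *)

theory Defs
  imports "HOL-Analysis.Analysis" "HOL-Computational_Algebra.Polynomial"
begin

text \<open>Everything lives in a field type 'a containing K; 2x2 matrices are 'a^2^2.\<close>

definition subfield :: "'a::field set \<Rightarrow> bool" where
  "subfield F \<longleftrightarrow> 0 \<in> F \<and> 1 \<in> F \<and>
     (\<forall>x\<in>F. \<forall>y\<in>F. x + y \<in> F \<and> x - y \<in> F \<and> x * y \<in> F) \<and>
     (\<forall>x\<in>F. inverse x \<in> F)"

definition nonarch_local_field :: "'a::field set \<Rightarrow> ('a \<Rightarrow> real) \<Rightarrow> bool" where
  "nonarch_local_field K absv \<longleftrightarrow> subfield K \<and>
     (\<forall>x\<in>K. absv x \<ge> 0 \<and> (absv x = 0 \<longleftrightarrow> x = 0)) \<and>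
     (\<forall>x\<in>K. \<forall>y\<in>K. absv (x * y) = absv x * absv y) \<and>
     (\<forall>x\<in>K. \<forall>y\<in>K. absv (x + y) \<le> max (absv x) (absv y)) \<and>
     (\<exists>pi\<in>K. 0 < absv pi \<and> absv pi < 1 \<and>
        (\<forall>x\<in>K. x \<noteq> 0 \<longrightarrow> (\<exists>n::int. absv x = absv pi powi n))) \<and>
     (\<forall>s::nat \<Rightarrow> 'a. (\<forall>n. s n \<in> K) \<longrightarrow>
        (\<forall>e>0. \<exists>N. \<forall>m\<ge>N. \<forall>n\<ge>N. absv (s m - s n) < e) \<longrightarrow>
        (\<exists>l\<in>K. \<forall>e>0. \<exists>N. \<forall>n\<ge>N. absv (s n - l) < e)) \<and>
     (\<exists>T. finite T \<and> T \<subseteq> {x\<in>K. absv x \<le> 1} \<and>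
        (\<forall>x\<in>K. absv x \<le> 1 \<longrightarrow> (\<exists>t\<in>T. absv (x - t) < 1)))"

definition ring_of_integers :: "'a::field set \<Rightarrow> ('a \<Rightarrow> real) \<Rightarrow> 'a set" where
  "ring_of_integers K absv = {x\<in>K. absv x \<le> 1}"

definition ext_integers :: "'a::field set \<Rightarrow> ('a \<Rightarrow> real) \<Rightarrow> 'a set \<Rightarrow> 'a set" where
  "ext_integers K absv L = {x\<in>L. \<exists>p::'a poly. lead_coeff p = 1 \<and>
      (\<forall>i. coeff p i \<in> ring_of_integers K absv) \<and> poly p x = 0}"

definition mscale :: "'a::semiring_1 \<Rightarrow> 'a^2^2 \<Rightarrow> 'a^2^2" where
  "mscale c A = (\<chi> i j. c * A$i$j)"

definition mtrace :: "'a::semiring_1^2^2 \<Rightarrow> 'a" where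
  "mtrace A = (\<Sum>i\<in>UNIV. A$i$i)"

definition mats :: "'a::semiring_1 set \<Rightarrow> ('a^2^2) set" where
  "mats F = {A. \<forall>i j. A$i$j \<in> F}"

definition lspan :: "'a::semiring_1 set \<Rightarrow> ('a^2^2) set \<Rightarrow> ('a^2^2) set" where
  "lspan S X = {(\<Sum>x\<in>G. mscale (c x) x) | G c. finite G \<and> G \<subseteq> X \<and> (\<forall>x\<in>G. c x \<in> S)}"

definition fin_gen :: "'a::semiring_1 set \<Rightarrow> ('a^2^2) set \<Rightarrow> bool" where
  "fin_gen S M \<longleftrightarrow> (\<exists>G. finite G \<and> G \<subseteq> M \<and> M = lspan S G)"

definition lprod :: "'a::semiring_1 set \<Rightarrow> ('a^2^2) set \<Rightarrow> ('a^2^2) set \<Rightarrow> ('a^2^2) set" where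
  "lprod S X Y = lspan S {x ** y | x y. x \<in> X \<and> y \<in> Y}"

definition is_order :: "'a::field set \<Rightarrow> 'a set \<Rightarrow> ('a^2^2) set \<Rightarrow> bool" where
  "is_order Ok F R \<longleftrightarrow> R \<subseteq> mats F \<and> mat 1 \<in> R \<and>
     (\<forall>x\<in>R. \<forall>y\<in>R. x + y \<in> R \<and> x - y \<in> R \<and> x ** y \<in> R) \<and> fin_gen Ok R"

definition full_order_over :: "'a::field set \<Rightarrow> 'a set \<Rightarrow> ('a^2^2) set \<Rightarrow> bool" where
  "full_order_over Ok F R \<longleftrightarrow> is_order Ok F R \<and> lspan F R = mats F"

definition maximal_order_over :: "'a::field set \<Rightarrow> 'a set \<Rightarrow> ('a^2^2) set \<Rightarrow> bool" where
  "maximal_order_over Ok F D \<longleftrightarrow> is_order Ok F D \<and>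
     (\<forall>D'. is_order Ok F D' \<and> D \<subseteq> D' \<longrightarrow> D' = D)"

definition full_order :: "'a::field set \<Rightarrow> ('a \<Rightarrow> real) \<Rightarrow> ('a^2^2) set \<Rightarrow> bool" where
  "full_order K absv R = full_order_over (ring_of_integers K absv) K R"

definition codifferent :: "'a::field set \<Rightarrow> ('a \<Rightarrow> real) \<Rightarrow> ('a^2^2) set \<Rightarrow> ('a^2^2) set" where
  "codifferent K absv R =
     {a\<in>mats K. \<forall>r\<in>R. mtrace (a ** r) \<in> ring_of_integers K absv}"

definition frac_ideal :: "'a::field set \<Rightarrow> ('a \<Rightarrow> real) \<Rightarrow> ('a^2^2) set \<Rightarrow> ('a^2^2) set \<Rightarrow> bool" where
  "frac_ideal K absv R J \<longleftrightarrow> J \<subseteq> mats K \<and> fin_gen (ring_of_integers K absv) J \<and>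
     lspan K J = mats K \<and> (\<forall>r\<in>R. \<forall>j\<in>J. r ** j \<in> J \<and> j ** r \<in> J)"

definition invertible_frac_ideal :: "'a::field set \<Rightarrow> ('a \<Rightarrow> real) \<Rightarrow> ('a^2^2) set \<Rightarrow> ('a^2^2) set \<Rightarrow> bool" where
  "invertible_frac_ideal K absv R J \<longleftrightarrow> frac_ideal K absv R J \<and>
     (\<exists>J'. frac_ideal K absv R J' \<and>
        lprod (ring_of_integers K absv) J J' = R \<and> lprod (ring_of_integers K absv) J' J = R)"

definition gorenstein :: "'a::field set \<Rightarrow> ('a \<Rightarrow> real) \<Rightarrow> ('a^2^2) set \<Rightarrow> bool" where
  "gorenstein K absv R \<longleftrightarrow> full_order K absv R \<and>
     invertible_frac_ideal K absv R (codifferent K absv R)"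

definition nonzero_ideal :: "'a::field set \<Rightarrow> 'a set \<Rightarrow> bool" where
  "nonzero_ideal Ok I \<longleftrightarrow> I \<subseteq> Ok \<and> 0 \<in> I \<and> I \<noteq> {0} \<and>
     (\<forall>x\<in>I. \<forall>y\<in>I. x + y \<in> I) \<and> (\<forall>a\<in>Ok. \<forall>x\<in>I. a * x \<in> I)"

definition scalar_plus_ideal :: "'a::field set \<Rightarrow> 'a set \<Rightarrow> ('a^2^2) set \<Rightarrow> ('a^2^2) set" where
  "scalar_plus_ideal Ok I R' =
     {mscale a (mat 1) + m | a m. a \<in> Ok \<and> m \<in> lspan Ok {mscale b r | b r. b \<in> I \<and> r \<in> R'}}"

definition gor_closure :: "'a::field set \<Rightarrow> ('a \<Rightarrow> real) \<Rightarrow> ('a^2^2) set \<Rightarrow> ('a^2^2) set" where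
  "gor_closure K absv R = (THE R'. gorenstein K absv R' \<and>
     (\<exists>I. nonzero_ideal (ring_of_integers K absv) I \<and>
          R = scalar_plus_ideal (ring_of_integers K absv) I R'))"

definition bass_order :: "'a::field set \<Rightarrow> ('a \<Rightarrow> real) \<Rightarrow> ('a^2^2) set \<Rightarrow> bool" where
  "bass_order K absv R \<longleftrightarrow> full_order K absv R \<and>
     (\<forall>R'. is_order (ring_of_integers K absv) K R' \<and> R \<subseteq> R' \<longrightarrow> gorenstein K absv R')"

definition finite_extension :: "'a::field set \<Rightarrow> 'a set \<Rightarrow> bool" where
  "finite_extension K L \<longleftrightarrow> subfield L \<and> K \<subseteq> L \<and>
     (\<exists>B. finite B \<and> B \<subseteq> L \<and>
        L = {(\<Sum>b\<in>B. c b * b) | c. \<forall>b\<in>B. c b \<in> K})"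

definition ghost_intersection :: "'a::field set \<Rightarrow> ('a \<Rightarrow> real) \<Rightarrow> ('a^2^2) set \<Rightarrow> bool" where
  "ghost_intersection K absv R \<longleftrightarrow> full_order K absv R \<and>
     (\<exists>L Ds. finite_extension K L \<and> finite Ds \<and> Ds \<noteq> {} \<and>
        (\<forall>D\<in>Ds. maximal_order_over (ext_integers K absv L) L D) \<and>
        R = mats K \<inter> \<Inter>Ds)"

end

theory Submission
  imports Defs
begin

text \<open>Write a full order as \<open>R = O + p\<^sup>k G\<close> with \<open>G\<close> Gorenstein. In \<open>M\<^sub>2(L)\<close> any two lattices have adapted bases,
  in which lying in a maximal order only bounds the off-diagonal entries of an integral matrix. Hence if a ghost
  intersection \<open>R\<close> lies in \<open>O + p\<^sup>k\<^sup>+\<^sup>1 X\<close> with \<open>X\<close> a maximal order, the elements \<open>x\<close> of \<open>X\<close> with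
  \<open>p\<^sup>k\<^sup>+\<^sup>1 x \<in> R\<close> form an order \<open>R\<^sub>1\<close>, and \<open>G = O + p R\<^sub>1\<close> is not Gorenstein. So no order above \<open>G\<close> has the form
  \<open>O + p R''\<close>, which means that \<open>G\<close> is Bass.

  Conversely, a Bass order \<open>G\<close> lies in no \<open>O + p X\<close>, and this forces it to contain an element \<open>\<alpha>\<close> generating
  the maximal order of a quadratic algebra. If \<open>\<alpha>\<close> splits over \<open>K\<close>, then \<open>G\<close> contains a nontrivial idempotent and
  is an Eichler order. Otherwise, with \<open>e\<close> an eigenvector of \<open>\<alpha>\<close> over \<open>L = K(\<alpha>)\<close>, the order \<open>G\<close> consists of the
  integral matrices \<open>a\<close> for which \<open>det(e, a e)\<close> lies in an ideal of \<open>O\<^sub>L\<close>, a condition imposed by a single maximal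
  order over \<open>L\<close>. Passing from \<open>G\<close> to \<open>R\<close> moves this vertex by \<open>p\<^sup>k\<close> and adds vertices defined over \<open>K\<close>.

  That Gorenstein means not of the form \<open>O + p R'\<close> is read off a basis \<open>1, i, j, k\<close> with \<open>D = tr(i [j,k])\<close>:
  the trace-zero part of the codifferent is spanned by \<open>[j,k]/D\<close>, \<open>[k,i]/D\<close>, \<open>[i,j]/D\<close>, and \<open>G\<close> is Gorenstein iff
  \<open>det [a,b]/D\<close> is a unit for some \<open>a, b \<in> G\<close>.\<close>

section \<open>Two-by-two matrices\<close>

text \<open>Two obstacles shape the proof. First, \<open>ext_integers\<close> is only an integral
  closure, while the argument over L needs a valuation ring: of any two elements one must divide the
  other. No norm or absolute value is extended to L. Instead, an order S of L is compact, so a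
  product of two elements of S not divisible by p is divisible only by a bounded power of p;
  comparing the powers of x and of 1/x in this light shows that one of the two is integral. The
  lattice arguments over L then use comparability alone: one picks an entry, a determinant or a
  value of \<open>tri\<close> of largest size among finitely many and applies Cramer's rule. Hence
  the locale \<open>valring\<close> serves K and L alike.

  Second, the characteristic of K or of its residue field may be 2, so nothing is divided by 2 and
  no form is diagonalized: a double root t is expressed by comparing traces with 2t and determinants
  with t^2, discriminants occur as (c - s)^2, and bilinear forms as differences of values of a
  quadratic form. In K(r) the conjugate of r is simply T - r, which may equal r, so inseparable
  extensions are included.\<close>

definition mk :: "'a \<Rightarrow> 'a \<Rightarrow> 'a \<Rightarrow> 'a \<Rightarrow> 'a^2^2" where
  "mk x y z w = (\<chi> i j. if i = 1 then (if j = 1 then x else y) else (if j = 1 then z else w))"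

lemma mk_nth [simp]: "mk x y z w $ 1 $ 1 = x" "mk x y z w $ 1 $ 2 = y"
  "mk x y z w $ 2 $ 1 = z" "mk x y z w $ 2 $ 2 = w"
  by (simp_all add: mk_def)

lemma mk_eta: "mk (A$1$1) (A$1$2) (A$2$1) (A$2$2) = A"
  by (simp add: vec_eq_iff forall_2)

text \<open>Writing each matrix as \<open>mk x y z w\<close> turns matrix identities into polynomial
  identities in the entries, which \<open>algebra_simps\<close> settles.\<close>

lemma mk_cases: obtains x y z w where "A = mk x y z w"
  using mk_eta by metis

lemma mk_eq [simp]: "mk x y z w = mk x' y' z' w' \<longleftrightarrow> x = x' \<and> y = y' \<and> z = z' \<and> w = w'"
  by (auto simp add: vec_eq_iff forall_2)

lemma mk_mult [simp]: "mk x y z w ** mk x' y' z' w' =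
    mk (x*x' + y*z') (x*y' + y*w') (z*x' + w*z') (z*y' + w*(w'::'a::semiring_1))"
  by (simp add: vec_eq_iff forall_2 matrix_matrix_mult_def sum_2)

lemma mk_add [simp]: "mk x y z w + mk x' y' z' w' = mk (x+x') (y+y') (z+z') (w+(w'::'a::semiring_1))"
  by (simp add: vec_eq_iff forall_2)

lemma mk_diff [simp]: "mk x y z w - mk x' y' z' w' = mk (x-x') (y-y') (z-z') (w-(w'::'a::ring_1))"
  by (simp add: vec_eq_iff forall_2)

lemma mk_uminus [simp]: "- mk x y z w = mk (-x) (-y) (-z) (-(w::'a::ring_1))"
  by (simp add: vec_eq_iff forall_2)

lemma mk_scale [simp]: "mscale c (mk x y z w) = mk (c*x) (c*y) (c*z) (c*w)"
  by (simp add: vec_eq_iff forall_2 mscale_def)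

lemma mk_one: "mat 1 = mk 1 0 0 (1::'a::semiring_1)"
  by (simp add: vec_eq_iff forall_2 mat_def)

lemma mk_zero: "0 = mk 0 0 0 (0::'a::semiring_1)"
  by (simp add: vec_eq_iff forall_2)

lemma mk_trace [simp]: "mtrace (mk x y z w) = x + w"
  by (simp add: mtrace_def sum_2)

lemma mk_mats [simp]: "mk x y z w \<in> mats F \<longleftrightarrow> x \<in> F \<and> y \<in> F \<and> z \<in> F \<and> w \<in> F"
  by (auto simp: mats_def forall_2)

definition dt :: "'a::ring_1^2^2 \<Rightarrow> 'a" where
  "dt A = A$1$1 * A$2$2 - A$1$2 * A$2$1"

lemma mk_dt [simp]: "dt (mk x y z w) = x * w - y * z"
  by (simp add: dt_def)

definition comm :: "'a::ring_1^2^2 \<Rightarrow> 'a^2^2 \<Rightarrow> 'a^2^2" where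
  "comm a b = a ** b - b ** a"

definition tri :: "'a::ring_1^2^2 \<Rightarrow> 'a^2^2 \<Rightarrow> 'a^2^2 \<Rightarrow> 'a" where
  "tri a b c = mtrace (a ** comm b c)"

lemma dt_mult: "dt (A ** B) = dt A * dt (B::'a::comm_ring_1^2^2)"
  by (cases A rule: mk_cases; cases B rule: mk_cases) (simp add: algebra_simps)

lemma mtrace_mult_commute: "mtrace (A ** B) = mtrace (B ** (A::'a::comm_ring_1^2^2))"
  by (cases A rule: mk_cases; cases B rule: mk_cases) (simp add: algebra_simps)

lemma mtrace_add: "mtrace (A + B) = mtrace A + mtrace (B::'a::semiring_1^2^2)"
  by (cases A rule: mk_cases; cases B rule: mk_cases) (simp add: algebra_simps)

lemma mtrace_diff: "mtrace (A - B) = mtrace A - mtrace (B::'a::ring_1^2^2)"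
  by (cases A rule: mk_cases; cases B rule: mk_cases) (simp add: algebra_simps)

lemma mtrace_scale: "mtrace (mscale c A) = c * mtrace (A::'a::semiring_1^2^2)"
  by (cases A rule: mk_cases) (simp add: algebra_simps)

lemma mscale_mult_left: "mscale c A ** B = mscale c (A ** (B::'a::comm_semiring_1^2^2))"
  by (cases A rule: mk_cases; cases B rule: mk_cases) (simp add: algebra_simps)

lemma mscale_mult_right: "A ** mscale c B = mscale c (A ** (B::'a::comm_semiring_1^2^2))"
  by (cases A rule: mk_cases; cases B rule: mk_cases) (simp add: algebra_simps)

lemma mscale_mscale: "mscale c (mscale d A) = mscale (c * d) (A::'a::semiring_1^2^2)"
  by (cases A rule: mk_cases) (simp add: algebra_simps)

lemma mscale_add: "mscale c (A + B) = mscale c A + mscale c (B::'a::semiring_1^2^2)"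
  by (cases A rule: mk_cases; cases B rule: mk_cases) (simp add: algebra_simps)

lemma mscale_diff: "mscale c (A - B) = mscale c A - mscale c (B::'a::ring_1^2^2)"
  by (cases A rule: mk_cases; cases B rule: mk_cases) (simp add: algebra_simps)

lemma mscale_add_left: "mscale (c + d) A = mscale c A + mscale d (A::'a::semiring_1^2^2)"
  by (cases A rule: mk_cases) (simp add: algebra_simps)

lemma mscale_one [simp]: "mscale 1 A = (A::'a::semiring_1^2^2)"
  by (cases A rule: mk_cases) simp

lemma mscale_zero [simp]: "mscale 0 A = (0::'a::semiring_1^2^2)" "mscale c 0 = (0::'a::semiring_1^2^2)"
  by (simp_all add: vec_eq_iff mscale_def)

lemma mat_mult_diff: "A ** (B - C) = A ** B - A ** (C::'a::ring_1^2^2)"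
  "(B - C) ** A = B ** A - C ** (A::'a::ring_1^2^2)"
  by (cases A rule: mk_cases; cases B rule: mk_cases; cases C rule: mk_cases, simp add: algebra_simps)+

lemma mat_mult_add: "A ** (B + C) = A ** B + A ** (C::'a::semiring_1^2^2)"
  "(B + C) ** A = B ** A + C ** (A::'a::semiring_1^2^2)"
  by (cases A rule: mk_cases; cases B rule: mk_cases; cases C rule: mk_cases, simp add: algebra_simps)+

lemmas mat_lin = mat_mult_add mat_mult_diff mscale_mult_left mscale_mult_right mscale_add mscale_diff
  mscale_mscale mtrace_add mtrace_diff mtrace_scale

lemma mtrace_conj:
  assumes "P ** Q = mat 1"
  shows "mtrace (Q ** x ** P) = mtrace (x::'a::comm_ring_1^2^2)"
  using mtrace_mult_commute[of "Q ** x" P] assms by (simp add: matrix_mul_assoc)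

lemma dt_one [simp]: "dt (mat 1) = (1::'a::comm_ring_1)"
  by (simp add: mk_one)

lemma dt_conj:
  assumes "P ** Q = mat 1"
  shows "dt (Q ** x ** P) = dt (x::'a::comm_ring_1^2^2)"
proof -
  have "dt P * dt Q = 1" using assms by (metis dt_mult dt_one)
  then show ?thesis by (simp add: dt_mult mult.commute[of "dt Q"] mult.assoc)
qed

lemma conj_cancel:
  assumes "Q ** P = mat 1"
  shows "Q ** (P ** e ** Q) ** P = (e::'a::comm_ring_1^2^2)"
proof -
  have "Q ** (P ** e ** Q) ** P = (Q ** P) ** e ** (Q ** P)" by (simp only: matrix_mul_assoc)
  then show ?thesis by (simp add: assms)
qed

definition is_mod :: "'a::semiring_1 set \<Rightarrow> ('a^2^2) set \<Rightarrow> bool" where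
  "is_mod S M \<longleftrightarrow> 0 \<in> M \<and> (\<forall>x\<in>M. \<forall>y\<in>M. x + y \<in> M) \<and> (\<forall>c\<in>S. \<forall>x\<in>M. mscale c x \<in> M)"

lemma is_mod_sum:
  assumes "is_mod S M" "finite G" "\<And>x. x \<in> G \<Longrightarrow> f x \<in> M"
  shows "sum f G \<in> M"
  using assms(2,3,1) by (induction) (auto simp: is_mod_def)

text \<open>This acts as the induction principle for spans: a property whose extension is
  \<open>is_mod\<close> passes from the generators to all elements. Multilinear statements are
  extended in this way one argument at a time.\<close>

lemma lspan_least:
  assumes "is_mod S M" "X \<subseteq> M"
  shows "lspan S X \<subseteq> M"
proof
  fix x assume "x \<in> lspan S X"
  then obtain G c where "x = (\<Sum>x\<in>G. mscale (c x) x)" "finite G" "G \<subseteq> X" "\<forall>x\<in>G. c x \<in> S"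
    unfolding lspan_def by blast
  then show "x \<in> M" using assms is_mod_sum[OF assms(1), of G "\<lambda>x. mscale (c x) x"]
    unfolding is_mod_def by blast
qed

lemma lspan_base: "1 \<in> S \<Longrightarrow> x \<in> X \<Longrightarrow> x \<in> lspan S X"
  unfolding lspan_def by (auto intro!: exI[of _ "{x}"] exI[of _ "\<lambda>_. 1"])

lemma lspan_mono: "S \<subseteq> S' \<Longrightarrow> X \<subseteq> Y \<Longrightarrow> lspan S X \<subseteq> lspan S' Y"
  unfolding lspan_def by blast

locale subring_of =
  fixes S :: "'a::comm_ring_1 set"
  assumes S0 [simp]: "0 \<in> S" and S1 [simp]: "1 \<in> S"
    and Sadd [simp]: "x \<in> S \<Longrightarrow> y \<in> S \<Longrightarrow> x + y \<in> S"
    and Sdiff [simp]: "x \<in> S \<Longrightarrow> y \<in> S \<Longrightarrow> x - y \<in> S"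
    and Smult [simp]: "x \<in> S \<Longrightarrow> y \<in> S \<Longrightarrow> x * y \<in> S"
begin

lemma Suminus [simp]: "x \<in> S \<Longrightarrow> - x \<in> S"
  using Sdiff[of 0 x] by simp

lemma Spower [simp]: "x \<in> S \<Longrightarrow> x ^ n \<in> S"
  by (induction n) auto

lemma Snumeral [simp]: "numeral n \<in> S"
  by (induction n) (simp_all only: numeral.simps S1 Sadd)

lemma lspan_is_mod: "is_mod S (lspan S X)"
  unfolding is_mod_def
proof (intro conjI ballI)
  show "0 \<in> lspan S X" unfolding lspan_def by (auto intro!: exI[of _ "{}"])
next
  fix x y assume "x \<in> lspan S X" "y \<in> lspan S X"
  then obtain G c H d where x: "x = (\<Sum>x\<in>G. mscale (c x) x)" "finite G" "G \<subseteq> X" "\<forall>x\<in>G. c x \<in> S"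
    and y: "y = (\<Sum>x\<in>H. mscale (d x) x)" "finite H" "H \<subseteq> X" "\<forall>x\<in>H. d x \<in> S"
    unfolding lspan_def by blast
  define e where "e x = (if x \<in> G then c x else 0) + (if x \<in> H then d x else 0)" for x
  have "(\<Sum>x\<in>G \<union> H. mscale (e x) x) = (\<Sum>x\<in>G \<union> H. mscale (if x \<in> G then c x else 0) x)
      + (\<Sum>x\<in>G \<union> H. mscale (if x \<in> H then d x else 0) x)"
    by (simp add: e_def mscale_add_left sum.distrib)
  also have "(\<Sum>x\<in>G \<union> H. mscale (if x \<in> G then c x else 0) x) = x"
    unfolding x using x y by (intro sum.mono_neutral_cong_right) auto
  also have "(\<Sum>x\<in>G \<union> H. mscale (if x \<in> H then d x else 0) x) = y"
    unfolding y using x y by (intro sum.mono_neutral_cong_right) auto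
  finally have "x + y = (\<Sum>x\<in>G \<union> H. mscale (e x) x)" ..
  moreover have "\<forall>x\<in>G \<union> H. e x \<in> S" using x y by (auto simp: e_def)
  ultimately show "x + y \<in> lspan S X" unfolding lspan_def using x y
    by (intro CollectI exI[of _ "G \<union> H"] exI[of _ e]) auto
next
  fix a x assume a: "a \<in> S" and "x \<in> lspan S X"
  then obtain G c where x: "x = (\<Sum>x\<in>G. mscale (c x) x)" "finite G" "G \<subseteq> X" "\<forall>x\<in>G. c x \<in> S"
    unfolding lspan_def by blast
  have "mscale a x = (\<Sum>x\<in>G. mscale (a * c x) x)"
  proof -
    have "mscale a (sum f G) = (\<Sum>x\<in>G. mscale a (f x))" for f :: "'a^2^2 \<Rightarrow> 'a^2^2"
      using x(2) by induction (simp_all add: mscale_add)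
    then show ?thesis by (simp add: x(1) mscale_mscale)
  qed
  then show "mscale a x \<in> lspan S X" unfolding lspan_def using x a
    by (intro CollectI exI[of _ G] exI[of _ "\<lambda>x. a * c x"]) auto
qed

lemma mats_mult [simp]: "x \<in> mats S \<Longrightarrow> y \<in> mats S \<Longrightarrow> x ** y \<in> mats S"
  by (cases x rule: mk_cases; cases y rule: mk_cases) simp

lemma mats_add [simp]: "x \<in> mats S \<Longrightarrow> y \<in> mats S \<Longrightarrow> x + y \<in> mats S"
  by (cases x rule: mk_cases; cases y rule: mk_cases) simp

lemma mats_diff [simp]: "x \<in> mats S \<Longrightarrow> y \<in> mats S \<Longrightarrow> x - y \<in> mats S"
  by (cases x rule: mk_cases; cases y rule: mk_cases) simp

lemma mats_scale [simp]: "c \<in> S \<Longrightarrow> x \<in> mats S \<Longrightarrow> mscale c x \<in> mats S"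
  by (cases x rule: mk_cases) simp

lemma mats_one [simp]: "mat 1 \<in> mats S" by (simp add: mk_one)

lemma mats_zero [simp]: "0 \<in> mats S" by (simp add: mk_zero)

lemma mats_trace [simp]: "x \<in> mats S \<Longrightarrow> mtrace x \<in> S"
  by (cases x rule: mk_cases) simp

lemma mats_dt [simp]: "x \<in> mats S \<Longrightarrow> dt x \<in> S"
  by (cases x rule: mk_cases) simp

lemma mats_comm [simp]: "x \<in> mats S \<Longrightarrow> y \<in> mats S \<Longrightarrow> comm x y \<in> mats S"
  by (simp add: comm_def)

lemma mats_tri [simp]: "x \<in> mats S \<Longrightarrow> y \<in> mats S \<Longrightarrow> z \<in> mats S \<Longrightarrow> tri x y z \<in> S"
  by (simp add: tri_def)

lemma mats_is_mod: "is_mod S (mats S)"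
  by (simp add: is_mod_def)

lemma fin_genI:
  assumes "is_mod S M" "finite G" "G \<subseteq> M" "M \<subseteq> lspan S G"
  shows "fin_gen S M"
  unfolding fin_gen_def using lspan_least[OF assms(1,3)] assms by blast

lemma fin_gen_is_mod: "fin_gen S M \<Longrightarrow> is_mod S M"
  unfolding fin_gen_def using lspan_is_mod by blast

end

section \<open>Valuation rings and maximal orders of 2x2 matrices\<close>

locale valring = V: subring_of V for V :: "'a::field set" +
  fixes F :: "'a set"
  assumes subF: "subfield F" and VF: "V \<subseteq> F"
    and val: "x \<in> F \<Longrightarrow> x \<in> V \<or> inverse x \<in> V"
begin

sublocale F: subring_of F
  using subF unfolding subfield_def by unfold_locales auto

lemma Finv [simp]: "x \<in> F \<Longrightarrow> inverse x \<in> F"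
  using subF unfolding subfield_def by auto

lemma Fdiv [simp]: "x \<in> F \<Longrightarrow> y \<in> F \<Longrightarrow> x / y \<in> F"
  by (simp add: divide_inverse)

lemma VFD [simp]: "x \<in> V \<Longrightarrow> x \<in> F" using VF by auto

lemma matsVF: "x \<in> mats V \<Longrightarrow> x \<in> mats F" using VF by (auto simp: mats_def)

lemma mod_VF: "is_mod F M \<Longrightarrow> is_mod V M" using VF by (auto simp: is_mod_def)

text \<open>Read as |x| <= |y|. Over L no valuation is constructed; its ordering, which is
  divisibility in \<open>V\<close>, is all that is used.\<close>

definition vle :: "'a \<Rightarrow> 'a \<Rightarrow> bool" where
  "vle x y \<longleftrightarrow> (\<exists>v\<in>V. x = v * y)"

lemma vle_refl: "vle x x"
  unfolding vle_def by (rule bexI[of _ 1]) simp_all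

lemma vle_trans: "vle x y \<Longrightarrow> vle y z \<Longrightarrow> vle x z"
  unfolding vle_def by (metis V.Smult mult.assoc)

lemma vle_div: "y \<noteq> 0 \<Longrightarrow> vle x y \<longleftrightarrow> x / y \<in> V"
  unfolding vle_def by (metis nonzero_mult_div_cancel_right nonzero_divide_eq_eq)

lemma vle_0 [simp]: "vle 0 z"
  unfolding vle_def by (rule bexI[of _ 0]) simp_all

lemma vle_total:
  assumes "x \<in> F" "y \<in> F"
  shows "vle x y \<or> vle y x"
proof (cases "x = 0 \<or> y = 0")
  case True
  then show ?thesis using vle_0 by metis
next
  case False
  then show ?thesis using val[of "x / y"] assms by (simp add: vle_div)
qed

text \<open>A largest element divides all the others, so it generates the ideal spanned by
  \<open>S\<close>. Bases of lattices are found with it: choose generators with the largest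
  determinant and apply Cramer's rule.\<close>

lemma ex_max:
  assumes "finite S" "S \<noteq> {}" "S \<subseteq> F"
  shows "\<exists>m\<in>S. \<forall>x\<in>S. vle x m"
  using assms
proof (induction rule: finite_ne_induct)
  case (singleton x)
  show ?case by (simp add: vle_refl)
next
  case (insert y S)
  have "S \<subseteq> F" using insert.prems by simp
  from insert.IH[OF this] obtain m where m: "m \<in> S" "\<forall>x\<in>S. vle x m" ..
  have "vle m y \<or> vle y m" using vle_total insert.prems m(1) by blast
  then show ?case
  proof
    assume "vle m y"
    then have "\<forall>x\<in>insert y S. vle x y" using m(2) vle_trans vle_refl by blast
    then show ?thesis by blast
  next
    assume "vle y m"
    then have "\<forall>x\<in>insert y S. vle x m" using m(2) by blast
    then show ?thesis using m(1) by blast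
  qed
qed

lemma order_mod: "is_order V F D \<Longrightarrow> is_mod V D"
  unfolding is_order_def using V.fin_gen_is_mod by blast

text \<open>The columns \<open>W\<close> of the generators of \<open>D\<close> span a lattice stable
  under \<open>D\<close>. Two columns \<open>u\<close>, \<open>v\<close> with the largest
  determinant form a basis of it, since by Cramer's rule every other column has coefficients in
  \<open>V\<close>. With these as the columns of \<open>P\<close>, the matrix of \<open>x\<close> in
  that basis is \<open>Q ** x ** P\<close>.\<close>

lemma order_in_conj:
  assumes D: "is_order V F D"
  shows "\<exists>P Q. P \<in> mats F \<and> Q \<in> mats F \<and> P ** Q = mat 1 \<and> Q ** P = mat 1 \<and> (\<forall>x\<in>D. Q ** x ** P \<in> mats V)"
proof -
  obtain G where G: "finite G" "G \<subseteq> D" "D = lspan V G" using D unfolding is_order_def fin_gen_def by blast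
  have GF: "g \<in> G \<Longrightarrow> g \<in> mats F" for g using D G unfolding is_order_def by blast
  define W where "W = (\<lambda>(g,j). (g$1$j, g$2$j)) ` (G \<times> (UNIV :: 2 set))"
  define dp :: "'a \<times> 'a \<Rightarrow> 'a \<times> 'a \<Rightarrow> 'a" where "dp u v = fst u * snd v - snd u * fst v" for u v
  have finW: "finite W" unfolding W_def using G(1) by auto
  have WF: "w \<in> W \<Longrightarrow> fst w \<in> F \<and> snd w \<in> F" for w unfolding W_def using GF by (auto simp: mats_def)
  have one: "mat 1 \<in> D" using D unfolding is_order_def by blast
  have WI: "g \<in> G \<Longrightarrow> (g$1$j, g$2$j) \<in> W" for g j unfolding W_def by force
  have Wne: "W \<noteq> {}"
  proof
    assume "W = {}"
    then have "G = {}" using WI by blast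
    then have "D \<subseteq> {0}" using lspan_least[of V "{0}" G] G by (simp add: is_mod_def)
    then show False using one by (auto simp: mk_one mk_zero)
  qed
  let ?X = "(\<lambda>(u,v). dp u v) ` (W \<times> W)"
  have "\<exists>m\<in>?X. \<forall>x\<in>?X. vle x m"
    using finW Wne WF by (intro ex_max) (auto simp: dp_def)
  then obtain m where m: "m \<in> ?X" "\<And>x. x \<in> ?X \<Longrightarrow> vle x m" by blast
  then obtain u v where uv: "u \<in> W" "v \<in> W" and m': "m = dp u v" by auto
  have mx: "vle (dp u' v') (dp u v)" if "u' \<in> W" "v' \<in> W" for u' v'
    using m(2)[of "dp u' v'"] that m' by (metis (no_types, lifting) SigmaI case_prod_conv image_eqI)
  define d where "d = dp u v"
  \<comment> \<open>If all determinants vanish, pairing with a column \<open>w\<close> is zero on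
    the generators, hence on \<open>mat 1\<close>, whose two columns detect both entries of
    \<open>w\<close>.\<close>
  have d0: "d \<noteq> 0"
  proof
    assume "d = 0"
    then have z: "\<And>u' v'. u' \<in> W \<Longrightarrow> v' \<in> W \<Longrightarrow> dp u' v' = 0" using mx d_def by (metis mult_zero_right vle_def)
    have wz: "w = (0,0)" if "w \<in> W" for w
    proof -
      let ?M = "{x::'a^2^2. \<forall>j. dp (x$1$j, x$2$j) w = 0}"
      have "dp (a + a', b + b') w = dp (a, b) w + dp (a', b') w"
        "dp (c * a, c * b) w = c * dp (a, b) w" for a b a' b' c
        by (simp_all add: dp_def algebra_simps)
      then have "is_mod V ?M" unfolding is_mod_def by (simp add: mscale_def) (simp add: dp_def)
      moreover have "G \<subseteq> ?M" using z WI that by blast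
      ultimately have "mat 1 \<in> ?M" using lspan_least[of V ?M G] G one by blast
      then have "dp (1,0) w = 0" "dp (0,1) w = 0" by (auto simp: mk_one forall_2)
      then show ?thesis by (simp add: dp_def prod_eq_iff)
    qed
    have "g = 0" if "g \<in> G" for g
      using wz WI[OF that] by (auto simp: vec_eq_iff forall_2)
    then have "G \<subseteq> {0}" by auto
    then have "D \<subseteq> {0}" using lspan_least[of V "{0}" G] G by (simp add: is_mod_def)
    then show False using one by (auto simp: mk_one mk_zero)
  qed
  define P where "P = mk (fst u) (fst v) (snd u) (snd v)"
  define Q where "Q = mscale (inverse d) (mk (snd v) (- fst v) (- snd u) (fst u))"
  have uF: "fst u \<in> F" "snd u \<in> F" "fst v \<in> F" "snd v \<in> F" using WF uv by auto
  have dF: "d \<in> F" using uF by (simp add: d_def dp_def)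
  have PF: "P \<in> mats F" "Q \<in> mats F" using uF dF by (auto simp: P_def Q_def)
  have inv: "P ** Q = mat 1" "Q ** P = mat 1" using d0
    by (simp_all add: P_def Q_def mk_one field_simps) (simp_all add: d_def dp_def algebra_simps)
  have QD: "Q ** x \<in> mats V" if "x \<in> D" for x
  proof -
    let ?M = "{x. Q ** x \<in> mats V}"
    have "is_mod V ?M" unfolding is_mod_def
      by (simp add: mat_lin)
    moreover have "G \<subseteq> ?M"
    proof
      fix g assume g: "g \<in> G"
      have e: "vle (dp (g$1$j, g$2$j) v) d" "vle (dp u (g$1$j, g$2$j)) d" for j
        using mx WI[OF g] uv by (auto simp: d_def)
      have e': "dp (g$1$j, g$2$j) v / d \<in> V \<and> dp u (g$1$j, g$2$j) / d \<in> V" for j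
        using e[of j] d0 by (simp add: vle_div)
      have "Q ** g = mk (dp (g$1$1, g$2$1) v / d) (dp (g$1$2, g$2$2) v / d)
         (dp u (g$1$1, g$2$1) / d) (dp u (g$1$2, g$2$2) / d)"
        using d0 by (cases g rule: mk_cases) (simp add: Q_def dp_def field_simps)
      then show "g \<in> ?M" using e' by simp
    qed
    ultimately show ?thesis using lspan_least[of V ?M G] G that by blast
  qed
  have "Q ** x ** P \<in> mats V" if x: "x \<in> D" for x
  proof -
    obtain g j g' j' where g: "g \<in> G" "g' \<in> G" "u = (g$1$j, g$2$j)" "v = (g'$1$j', g'$2$j')"
      using uv unfolding W_def by auto
    have "x ** g \<in> D" "x ** g' \<in> D" using D G g x unfolding is_order_def by blast+
    then have V1: "Q ** (x ** g) \<in> mats V" "Q ** (x ** g') \<in> mats V" using QD by blast+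
    have "Q ** x ** P = mk ((Q ** (x ** g))$1$j) ((Q ** (x ** g'))$1$j') ((Q ** (x ** g))$2$j) ((Q ** (x ** g'))$2$j')"
      unfolding matrix_mul_assoc P_def g
      by (cases "Q ** x" rule: mk_cases) (simp add: matrix_matrix_mult_def sum_2 vec_eq_iff forall_2)
    moreover have "(Q ** (x ** g)) $ i $ j \<in> V" "(Q ** (x ** g')) $ i $ j' \<in> V" for i
      using V1 unfolding mats_def by blast+
    ultimately show ?thesis by simp
  qed
  then show ?thesis using PF inv by blast
qed

lemma order_integral:
  assumes "is_order V F D" "x \<in> D"
  shows "mtrace x \<in> V" "dt x \<in> V"
proof -
  obtain P Q where PQ: "P ** Q = mat 1" "Q ** x ** P \<in> mats V" using order_in_conj[OF assms(1)] assms(2) by blast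
  show "mtrace x \<in> V" "dt x \<in> V"
    using V.mats_trace[OF PQ(2)] V.mats_dt[OF PQ(2)] by (simp_all only: mtrace_conj[OF PQ(1)] dt_conj[OF PQ(1)])
qed

text \<open>For \<open>Q\<close> inverse to \<open>P\<close> this is \<open>P\<close> M_2(V)
  \<open>Q\<close>, the endomorphism ring of the lattice spanned by the columns of
  \<open>P\<close>.\<close>

definition cmats :: "'a^2^2 \<Rightarrow> 'a^2^2 \<Rightarrow> ('a^2^2) set" where
  "cmats P Q = {x. x \<in> mats F \<and> Q ** x ** P \<in> mats V}"

definition inv_pair :: "'a^2^2 \<Rightarrow> 'a^2^2 \<Rightarrow> bool" where
  "inv_pair P Q \<longleftrightarrow> P \<in> mats F \<and> Q \<in> mats F \<and> P ** Q = mat 1 \<and> Q ** P = mat 1"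

lemma conj_mult: "P ** Q = mat 1 \<Longrightarrow> Q ** (x ** y) ** P = (Q ** x ** P) ** (Q ** y ** P)"
proof -
  assume "P ** Q = mat 1"
  then have "(Q ** x) ** (P ** Q) ** (y ** P) = (Q ** x) ** (y ** P)" by simp
  then show ?thesis by (simp add: matrix_mul_assoc)
qed

lemma cmats_order:
  assumes PQ: "inv_pair P Q"
  shows "is_order V F (cmats P Q)"
proof -
  note [simp] = PQ[unfolded inv_pair_def]
  have M: "is_mod V (cmats P Q)"
    unfolding is_mod_def cmats_def by (auto simp: mat_lin mk_zero[symmetric])
  let ?E = "{mk 1 0 0 0, mk 0 1 0 0, mk 0 0 1 0, mk 0 0 0 (1::'a)}"
  let ?G = "(\<lambda>e. P ** e ** Q) ` ?E"
  have QP: "Q ** (P ** e ** Q) ** P = e" for e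
    by (rule conj_cancel) simp
  have PQ': "P ** (Q ** e ** P) ** Q = e" for e
    by (rule conj_cancel) simp
  have sub: "?G \<subseteq> cmats P Q" unfolding cmats_def using PQ unfolding inv_pair_def
    by (auto simp: QP)
  have "cmats P Q \<subseteq> lspan V ?G"
  proof
    fix x assume x: "x \<in> cmats P Q"
    obtain a b c d where abcd: "Q ** x ** P = mk a b c d" by (rule mk_cases)
    then have V: "a \<in> V" "b \<in> V" "c \<in> V" "d \<in> V" using x by (auto simp: cmats_def)
    have "x = P ** mk a b c d ** Q" using PQ' abcd by metis
    also have "mk a b c d = mscale a (mk 1 0 0 0) + mscale b (mk 0 1 0 0) + mscale c (mk 0 0 1 0) + mscale d (mk 0 0 0 1)"
      by simp
    also have "P ** \<dots> ** Q = mscale a (P ** mk 1 0 0 0 ** Q) + mscale b (P ** mk 0 1 0 0 ** Q)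
      + mscale c (P ** mk 0 0 1 0 ** Q) + mscale d (P ** mk 0 0 0 1 ** Q)"
      by (simp only: mat_lin)
    also have "\<dots> \<in> lspan V ?G"
    proof -
      have "g \<in> ?G \<Longrightarrow> r \<in> V \<Longrightarrow> mscale r g \<in> lspan V ?G" for r g
        using V.lspan_is_mod[of ?G] lspan_base[of V g ?G] by (auto simp: is_mod_def)
      moreover have "x \<in> lspan V ?G \<Longrightarrow> y \<in> lspan V ?G \<Longrightarrow> x + y \<in> lspan V ?G" for x y
        using V.lspan_is_mod[of ?G] by (auto simp: is_mod_def)
      ultimately show ?thesis using V by simp
    qed
    finally show "x \<in> lspan V ?G" .
  qed
  then have "fin_gen V (cmats P Q)" using M sub by (intro V.fin_genI[where G = ?G]) auto
  then show ?thesis unfolding is_order_def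
    by (auto simp: cmats_def mat_lin conj_mult)
qed

text \<open>A larger order lies in another such ring, given by \<open>P'\<close>, \<open>Q'\<close>.
  With \<open>A = Q' ** P\<close> and its inverse \<open>B = Q ** P'\<close>, matrix units show that
  every product of an entry of \<open>A\<close> and an entry of \<open>B\<close> is in
  \<open>V\<close>. This condition is symmetric in \<open>A\<close> and \<open>B\<close>, so the
  opposite inclusion follows.\<close>

lemma cmats_maximal:
  assumes PQ: "inv_pair P Q"
  shows "maximal_order_over V F (cmats P Q)"
  unfolding maximal_order_over_def
proof (intro conjI allI impI cmats_order PQ)
  fix D assume D: "is_order V F D \<and> cmats P Q \<subseteq> D"
  obtain P' Q' where PQ': "inv_pair P' Q'" and DV: "\<forall>x\<in>D. Q' ** x ** P' \<in> mats V"
    using order_in_conj D unfolding inv_pair_def by blast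
  note i = PQ[unfolded inv_pair_def] PQ'[unfolded inv_pair_def]
  define A where "A = Q' ** P"
  define B where "B = Q ** P'"
  have AB: "A ** e ** B \<in> mats V" if "e \<in> mats V" for e
  proof -
    have "Q ** (P ** e ** Q) ** P = e" using i by (intro conj_cancel) auto
    then have "P ** e ** Q \<in> cmats P Q" unfolding cmats_def using that i matsVF[OF that] by simp
    then have "P ** e ** Q \<in> D" using D by (elim conjE subsetD)
    then have "Q' ** (P ** e ** Q) ** P' \<in> mats V" by (rule bspec[OF DV])
    then show ?thesis by (simp add: A_def B_def matrix_mul_assoc)
  qed
  have prod: "A$k$i * B$j$l \<in> V" for k i j l
  proof -
    define e :: "'a^2^2" where "e = (\<chi> a b. if a = i \<and> b = j then 1 else 0)"
    have "(A ** e ** B)$k$l = A$k$i * B$j$l"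
      using exhaust_2[of i] exhaust_2[of j] by (elim disjE) (simp_all add: e_def matrix_matrix_mult_def sum_2)
    moreover have "e \<in> mats V" by (simp add: mats_def e_def)
    ultimately show ?thesis using AB[of e] unfolding mats_def mem_Collect_eq by metis
  qed
  have BA: "B ** e ** A \<in> mats V" if "e \<in> mats V" for e
  proof -
    have t: "B$i$k * e$k$l * A$l$j \<in> V" for i j k l
    proof -
      have "e$k$l \<in> V" using that unfolding mats_def mem_Collect_eq by (elim allE)
      then have "e$k$l * (A$l$j * B$i$k) \<in> V" by (rule V.Smult[OF _ prod])
      then show ?thesis by (simp only: mult.assoc mult.commute mult.left_commute)
    qed
    have "(B ** e ** A)$i$j = B$i$1 * e$1$1 * A$1$j + B$i$2 * e$2$1 * A$1$j + B$i$1 * e$1$2 * A$2$j + B$i$2 * e$2$2 * A$2$j" for i j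
      by (simp add: matrix_matrix_mult_def sum_2 algebra_simps)
    then show ?thesis using t by (simp add: mats_def)
  qed
  have "x \<in> cmats P Q" if x: "x \<in> D" for x
  proof -
    have "B ** (Q' ** x ** P') ** A \<in> mats V" using BA DV x by blast
    moreover have "B ** (Q' ** x ** P') ** A = Q ** (P' ** (Q' ** x ** P') ** Q') ** P" unfolding A_def B_def
      by (simp only: matrix_mul_assoc)
    then have "B ** (Q' ** x ** P') ** A = Q ** x ** P" using conj_cancel[of P' Q' x] i by simp
    ultimately show ?thesis unfolding cmats_def using D x unfolding is_order_def by (simp add: subset_iff)
  qed
  then show "D = cmats P Q" using D by blast
qed

lemma maximal_is_cmats:
  assumes "maximal_order_over V F D"
  shows "\<exists>P Q. inv_pair P Q \<and> D = cmats P Q"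
proof -
  have D: "is_order V F D" using assms unfolding maximal_order_over_def by blast
  obtain P Q where PQ: "inv_pair P Q" "\<forall>x\<in>D. Q ** x ** P \<in> mats V"
    using order_in_conj[OF D] unfolding inv_pair_def by blast
  have "D \<subseteq> cmats P Q" using PQ D unfolding cmats_def is_order_def by blast
  then show ?thesis using assms cmats_order[OF PQ(1)] PQ(1) unfolding maximal_order_over_def by blast
qed

lemma scalar_in_order:
  assumes "is_order V F D" "mscale c (mat 1) \<in> D" "c \<in> F"
  shows "c \<in> V"
proof (rule ccontr)
  assume c: "c \<notin> V"
  then have "inverse c \<in> V" using val assms(3) by blast
  moreover have "c * c \<in> V" using order_integral(2)[OF assms(1,2)] by (simp add: mk_one)
  ultimately have "inverse c * (c * c) \<in> V" by (rule V.Smult)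
  moreover have "c \<noteq> 0" using c by auto
  ultimately show False using c by (simp add: mult.assoc[symmetric])
qed

end

section \<open>Bases of orders from the volume form \<open>tri\<close>\<close>

lemma tri_add: "tri (a + a') b c = tri a b c + tri a' b (c::'a::comm_ring_1^2^2)"
  "tri a (b + b') c = tri a b c + tri a b' (c::'a::comm_ring_1^2^2)"
  "tri a b (c + c') = tri a b c + tri a b (c'::'a::comm_ring_1^2^2)"
  unfolding tri_def comm_def by (simp_all add: mat_lin)

lemma tri_scale: "tri (mscale r a) b c = r * tri a b (c::'a::comm_ring_1^2^2)"
  "tri a (mscale r b) c = r * tri a b (c::'a::comm_ring_1^2^2)"
  "tri a b (mscale r c) = r * tri a b (c::'a::comm_ring_1^2^2)"
  unfolding tri_def comm_def by (simp_all add: mat_lin right_diff_distrib)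

lemma tri_zero: "tri 0 b c = 0" "tri a 0 c = 0" "tri a b 0 = (0::'a::comm_ring_1)"
  by (cases a rule: mk_cases; cases b rule: mk_cases; cases c rule: mk_cases, simp add: tri_def comm_def mk_zero)+

text \<open>Cramer's rule in the three-dimensional quotient of the matrix algebra by the scalars, on which
  \<open>tri\<close> is a volume form.\<close>

lemma tri_cramer:
  fixes x i j k :: "'a::comm_ring_1^2^2"
  shows "\<exists>s. mscale (tri i j k) x = mscale s (mat 1) + mscale (tri x j k) i + mscale (tri i x k) j + mscale (tri i j x) k"
proof -
  obtain x1 x2 x3 x4 where x: "x = mk x1 x2 x3 x4" by (rule mk_cases)
  obtain i1 i2 i3 i4 where i: "i = mk i1 i2 i3 i4" by (rule mk_cases)
  obtain j1 j2 j3 j4 where j: "j = mk j1 j2 j3 j4" by (rule mk_cases)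
  obtain k1 k2 k3 k4 where k: "k = mk k1 k2 k3 k4" by (rule mk_cases)
  show ?thesis
    unfolding x i j k tri_def comm_def
    by (rule exI[of _ "tri (mk i1 i2 i3 i4) (mk j1 j2 j3 j4) (mk k1 k2 k3 k4) * x1
       - tri (mk x1 x2 x3 x4) (mk j1 j2 j3 j4) (mk k1 k2 k3 k4) * i1
       - tri (mk i1 i2 i3 i4) (mk x1 x2 x3 x4) (mk k1 k2 k3 k4) * j1
       - tri (mk i1 i2 i3 i4) (mk j1 j2 j3 j4) (mk x1 x2 x3 x4) * k1"])
      (simp add: tri_def comm_def mk_one algebra_simps)
qed

definition lin :: "'a::semiring_1^2^2 \<Rightarrow> 'a^2^2 \<Rightarrow> 'a^2^2 \<Rightarrow> 'a \<Rightarrow> 'a \<Rightarrow> 'a \<Rightarrow> 'a \<Rightarrow> 'a^2^2" where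
  "lin i j k a b c d = mscale a (mat 1) + mscale b i + mscale c j + mscale d k"

context valring
begin

text \<open>Among the generators choose \<open>i\<close>, \<open>j\<close>, \<open>k\<close> with
  the largest \<open>tri\<close>; Cramer's rule then gives their coefficients in \<open>V\<close>.
  What remains is a scalar lying in the order, and \<open>scalar_in_order\<close> makes it integral,
  so \<open>mat 1\<close> completes the basis.\<close>

lemma full_order_basis:
  assumes R: "full_order_over V F R"
  shows "\<exists>i\<in>R. \<exists>j\<in>R. \<exists>k\<in>R. tri i j k \<noteq> 0 \<and> (\<forall>x\<in>R. \<exists>a\<in>V. \<exists>b\<in>V. \<exists>c\<in>V. \<exists>d\<in>V. x = lin i j k a b c d)"
proof -
  have RO: "is_order V F R" and span: "lspan F R = mats F" using R unfolding full_order_over_def by auto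
  obtain G where G: "finite G" "G \<subseteq> R" "R = lspan V G" using RO unfolding is_order_def fin_gen_def by blast
  have RF: "x \<in> R \<Longrightarrow> x \<in> mats F" for x using RO unfolding is_order_def by blast
  have one: "mat 1 \<in> R" using RO unfolding is_order_def by blast
  have Gne: "G \<noteq> {}"
  proof
    assume "G = {}"
    then have "R \<subseteq> {0}" using lspan_least[of V "{0}" G] G by (simp add: is_mod_def)
    then show False using one by (auto simp: mk_one mk_zero)
  qed
  let ?X = "(\<lambda>(u,v,w). tri u v w) ` (G \<times> G \<times> G)"
  have GF: "x \<in> G \<Longrightarrow> x \<in> mats F" for x using G(2) RF by blast
  have "\<exists>m\<in>?X. \<forall>x\<in>?X. vle x m"
    using G(1) GF Gne F.mats_tri by (intro ex_max) auto
  then obtain m where m: "m \<in> ?X" "\<And>x. x \<in> ?X \<Longrightarrow> vle x m" by blast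
  then obtain i j k where ijk: "i \<in> G" "j \<in> G" "k \<in> G" and m': "m = tri i j k" by auto
  have mx: "vle (tri u v w) (tri i j k)" if "u \<in> G" "v \<in> G" "w \<in> G" for u v w
    using m(2)[of "tri u v w"] that m' by (metis (no_types, lifting) SigmaI case_prod_conv image_eqI)
  \<comment> \<open>A trilinear form that vanishes on the generators vanishes on all matrices over
    F, but at three matrix units \<open>tri\<close> takes the value 1.\<close>
  have D0: "tri i j k \<noteq> 0"
  proof
    assume D: "tri i j k = 0"
    have z: "tri u v w = 0" if "u \<in> G" "v \<in> G" "w \<in> G" for u v w
      using mx[OF that] D by (auto simp: vle_def)
    have RG: "P x" if "x \<in> mats F" "\<And>g. g \<in> G \<Longrightarrow> P g" "is_mod F {x. P x}" for P x
    proof -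
      have "R \<subseteq> {x. P x}" using lspan_least[of V "{x. P x}" G] that G mod_VF by auto
      then have "mats F \<subseteq> {x. P x}" using lspan_least[of F "{x. P x}" R] that span by auto
      then show ?thesis using that by auto
    qed
    have M1: "is_mod F {x. tri x v w = 0}" "is_mod F {x. tri v x w = 0}" "is_mod F {x. tri v w x = 0}" for v w
      unfolding is_mod_def by (auto simp: tri_add tri_scale tri_zero)
    have "tri x v w = 0" if "x \<in> mats F" "v \<in> G" "w \<in> G" for x v w
      using RG[of x "\<lambda>x. tri x v w = 0"] z M1 that by blast
    then have "tri x y w = 0" if "x \<in> mats F" "y \<in> mats F" "w \<in> G" for x y w
      using RG[of y "\<lambda>y. tri x y w = 0"] M1 that by blast
    then have "tri x y w = 0" if "x \<in> mats F" "y \<in> mats F" "w \<in> mats F" for x y w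
      using RG[of w "\<lambda>w. tri x y w = 0"] M1 that by blast
    then have "tri (mk 0 1 0 0) (mk 0 0 1 0) (mk 1 0 0 (0::'a)) = 0" by simp
    then show False by (simp add: tri_def comm_def)
  qed
  define D where "D = tri i j k"
  have RG: "P x" if "x \<in> R" "\<And>g. g \<in> G \<Longrightarrow> P g" "is_mod V {x. P x}" for P x
    using lspan_least[of V "{x. P x}" G] that G by auto
  have co: "tri x j k / D \<in> V \<and> tri i x k / D \<in> V \<and> tri i j x / D \<in> V" if x: "x \<in> R" for x
  proof (rule RG[OF x])
    show "tri g j k / D \<in> V \<and> tri i g k / D \<in> V \<and> tri i j g / D \<in> V" if "g \<in> G" for g
      using mx that ijk D0 unfolding D_def by (simp add: vle_div)
    show "is_mod V {x. tri x j k / D \<in> V \<and> tri i x k / D \<in> V \<and> tri i j x / D \<in> V}"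
      unfolding is_mod_def
      by (simp add: tri_add tri_scale tri_zero add_divide_distrib times_divide_eq_right[symmetric] del: times_divide_eq_right)
  qed
  have main: "\<exists>a\<in>V. \<exists>b\<in>V. \<exists>c\<in>V. \<exists>d\<in>V. x = lin i j k a b c d" if x: "x \<in> R" for x
  proof -
    obtain s where s: "mscale D x = mscale s (mat 1) + mscale (tri x j k) i + mscale (tri i x k) j + mscale (tri i j x) k"
      using tri_cramer D_def by blast
    have "x = mscale (inverse D) (mscale D x)" using D0 by (simp add: mscale_mscale D_def)
    also have "\<dots> = lin i j k (s / D) (tri x j k / D) (tri i x k / D) (tri i j x / D)"
      unfolding s lin_def by (simp add: mscale_add mscale_mscale divide_inverse mult.commute)
    finally have xe: "x = lin i j k (s / D) (tri x j k / D) (tri i x k / D) (tri i j x / D)" .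
    have md: "is_mod V R" using order_mod[OF RO] .
    have "mscale (tri x j k / D) i + mscale (tri i x k / D) j + mscale (tri i j x / D) k \<in> R"
      using co[OF x] md ijk G(2) unfolding is_mod_def by (meson subsetD)
    moreover have "mscale (s / D) (mat 1) = x - (mscale (tri x j k / D) i + mscale (tri i x k / D) j + mscale (tri i j x / D) k)"
      by (subst (1) xe) (simp add: lin_def algebra_simps)
    ultimately have sR: "mscale (s / D) (mat 1) \<in> R" using x RO unfolding is_order_def by metis
    then have "mscale (s / D) (mat 1) \<in> mats F" using RF by blast
    then have "s / D \<in> F" by (simp add: mk_one)
    then have "s / D \<in> V" using scalar_in_order[OF RO sR] by blast
    then show ?thesis using xe co[OF x] by blast
  qed
  show ?thesis using ijk G(2) D0 main by blast
qed

end

section \<open>The ring of integers of a finite extension\<close>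

locale local_field =
  fixes K :: "'a::field set" and absv :: "'a \<Rightarrow> real" and p :: 'a
  assumes nl: "nonarch_local_field K absv"
    and pK: "p \<in> K" and p0: "0 < absv p" and p1: "absv p < 1"
    and gen: "\<And>x. x \<in> K \<Longrightarrow> x \<noteq> 0 \<Longrightarrow> \<exists>n::int. absv x = absv p powi n"
begin

abbreviation "Ok \<equiv> ring_of_integers K absv"

lemma subK: "subfield K" using nl unfolding nonarch_local_field_def by blast

lemma K0 [simp]: "0 \<in> K" and K1 [simp]: "1 \<in> K"
  and Kadd: "x \<in> K \<Longrightarrow> y \<in> K \<Longrightarrow> x + y \<in> K" and Kdiff: "x \<in> K \<Longrightarrow> y \<in> K \<Longrightarrow> x - y \<in> K"
  and Kmult: "x \<in> K \<Longrightarrow> y \<in> K \<Longrightarrow> x * y \<in> K" and Kinv: "x \<in> K \<Longrightarrow> inverse x \<in> K"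
  using subK unfolding subfield_def by blast+

lemma Kpow: "x \<in> K \<Longrightarrow> x ^ n \<in> K"
  by (induction n) (simp_all add: Kmult)

lemma Ksum: "(\<And>i. i \<in> I \<Longrightarrow> f i \<in> K) \<Longrightarrow> sum f I \<in> K"
  by (induction I rule: infinite_finite_induct) (simp_all add: Kadd)

lemma abs_facts:
  "\<forall>x\<in>K. absv x \<ge> 0 \<and> (absv x = 0 \<longleftrightarrow> x = 0)"
  "\<forall>x\<in>K. \<forall>y\<in>K. absv (x * y) = absv x * absv y"
  "\<forall>x\<in>K. \<forall>y\<in>K. absv (x + y) \<le> max (absv x) (absv y)"
  "\<forall>s::nat \<Rightarrow> 'a. (\<forall>n. s n \<in> K) \<longrightarrow>
        (\<forall>e>0. \<exists>N. \<forall>m\<ge>N. \<forall>n\<ge>N. absv (s m - s n) < e) \<longrightarrow>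
        (\<exists>l\<in>K. \<forall>e>0. \<exists>N. \<forall>n\<ge>N. absv (s n - l) < e)"
  "\<exists>T. finite T \<and> T \<subseteq> {x\<in>K. absv x \<le> 1} \<and> (\<forall>x\<in>K. absv x \<le> 1 \<longrightarrow> (\<exists>t\<in>T. absv (x - t) < 1))"
  using nl unfolding nonarch_local_field_def by - (elim conjE, assumption)+

lemma abs_nonneg: "x \<in> K \<Longrightarrow> absv x \<ge> 0" and abs_eq0: "x \<in> K \<Longrightarrow> absv x = 0 \<longleftrightarrow> x = 0"
  using abs_facts(1) by blast+

lemma abs_mult: "x \<in> K \<Longrightarrow> y \<in> K \<Longrightarrow> absv (x * y) = absv x * absv y"
  using abs_facts(2) by blast

lemma abs_add: "x \<in> K \<Longrightarrow> y \<in> K \<Longrightarrow> absv (x + y) \<le> max (absv x) (absv y)"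
  using abs_facts(3) by blast

lemma abs_one [simp]: "absv 1 = 1"
  using abs_mult[of 1 1] abs_eq0[of 1] by simp

lemma abs_minus_one: "absv (- 1) = 1"
proof -
  have "(-1) \<in> K" using Kdiff[of 0 1] by simp
  then have "absv (-1) * absv (-1) = 1" "absv (-1) \<ge> 0" using abs_mult[of "-1" "-1"] abs_nonneg by auto
  then show ?thesis by (metis abs_of_nonneg real_sqrt_abs2 real_sqrt_one)
qed

lemma abs_diff: assumes "x \<in> K" "y \<in> K" shows "absv (x - y) \<le> max (absv x) (absv y)"
proof -
  have m: "(-1) \<in> K" using Kdiff[of 0 1] by simp
  have "absv ((-1) * y) = absv y" using abs_mult[OF m assms(2)] abs_minus_one by simp
  then show ?thesis using abs_add[OF assms(1) Kmult[OF m assms(2)]] by simp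
qed

lemma abs_inv: "x \<in> K \<Longrightarrow> x \<noteq> 0 \<Longrightarrow> absv (inverse x) = inverse (absv x)"
  using abs_mult[of x "inverse x"] Kinv[of x] abs_eq0[of x]
  by (metis abs_one right_inverse inverse_unique)

lemma abs_pow: "x \<in> K \<Longrightarrow> absv (x ^ n) = absv x ^ n"
  by (induction n) (simp_all add: abs_mult Kpow)

lemma p_nz [simp]: "p \<noteq> 0" using p0 abs_eq0[of 0] by auto

lemma Ok_iff: "x \<in> Ok \<longleftrightarrow> x \<in> K \<and> absv x \<le> 1"
  by (simp add: ring_of_integers_def)

lemma valring_Ok: "valring Ok K"
proof unfold_locales
  show "0 \<in> Ok" "1 \<in> Ok" using abs_eq0[of 0] by (simp_all add: Ok_iff)
  show "x + y \<in> Ok" if "x \<in> Ok" "y \<in> Ok" for x y using that abs_add[of x y] order_trans[of "absv (x + y)" "max (absv x) (absv y)" 1] by (simp add: Ok_iff Kadd)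
  show "x - y \<in> Ok" if "x \<in> Ok" "y \<in> Ok" for x y using that abs_diff[of x y] order_trans[of "absv (x - y)" "max (absv x) (absv y)" 1] by (simp add: Ok_iff Kdiff)
  show "x * y \<in> Ok" if "x \<in> Ok" "y \<in> Ok" for x y
    using that abs_nonneg by (simp add: Ok_iff Kmult abs_mult mult_le_one)
  show "subfield K" by (rule subK)
  show "Ok \<subseteq> K" by (auto simp: Ok_iff)
  show "x \<in> Ok \<or> inverse x \<in> Ok" if "x \<in> K" for x
  proof (cases "absv x \<le> 1")
    case False
    then have "x \<noteq> 0" using abs_eq0[OF that] by auto
    then have "absv (inverse x) = inverse (absv x)" using abs_inv that by blast
    then show ?thesis using False that by (simp add: Ok_iff Kinv inverse_le_1_iff)
  qed (simp add: Ok_iff that)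
qed

end

sublocale local_field \<subseteq> O: valring "ring_of_integers K absv" K
  by (rule valring_Ok)

context local_field
begin

lemma pO [simp]: "p \<in> Ok" using pK p1 by (simp add: Ok_iff)

lemma vle_p_pow_iff: "x \<in> K \<Longrightarrow> O.vle x (p ^ n) \<longleftrightarrow> absv x \<le> absv p ^ n"
proof -
  assume x: "x \<in> K"
  have "absv (x / p ^ n) = absv x / absv p ^ n"
    using x pK by (simp add: divide_inverse abs_mult abs_inv abs_pow)
  then have "x / p ^ n \<in> Ok \<longleftrightarrow> absv x \<le> absv p ^ n"
    using x pK p0 by (simp add: Ok_iff divide_le_eq)
  then show ?thesis by (simp add: O.vle_div)
qed

lemma vle_p_iff: "x \<in> K \<Longrightarrow> O.vle x p \<longleftrightarrow> absv x < 1"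
proof
  assume x: "x \<in> K" "O.vle x p"
  then show "absv x < 1" using vle_p_pow_iff[of x 1] p1 by simp
next
  assume x: "x \<in> K" "absv x < 1"
  show "O.vle x p"
  proof (cases "x = 0")
    case True then show ?thesis by simp
  next
    case False
    then obtain n :: int where n: "absv x = absv p powi n" using gen x by blast
    have "n \<ge> 1"
    proof (rule ccontr)
      assume "\<not> n \<ge> 1"
      then have "absv p powi (- n) = absv p ^ nat (- n)" by (simp add: power_int_def)
      moreover have "absv p ^ nat (-n) \<le> 1" using p0 p1 by (intro power_le_one) auto
      ultimately have "inverse (absv x) \<le> 1" using n by (simp add: power_int_minus)
      moreover have "absv x > 0" using abs_nonneg[OF x(1)] abs_eq0[OF x(1)] False by simp
      ultimately show False using x(2) by (simp add: field_simps)
    qed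
    then have "absv x = absv p ^ nat n" using n by (simp add: power_int_def)
    also have "\<dots> \<le> absv p ^ 1" using \<open>n \<ge> 1\<close> p0 p1 by (intro power_decreasing) auto
    finally show ?thesis using vle_p_pow_iff[of x 1] x(1) by simp
  qed
qed

lemma inv_p_notin: "inverse p \<notin> Ok"
  using p0 p1 pK by (simp add: Ok_iff abs_inv inverse_le_1_iff)

lemma one_not_vle_p: "\<not> O.vle 1 p" using vle_p_iff[of 1] by simp

lemma unit_iff: "x \<in> Ok \<Longrightarrow> \<not> O.vle x p \<longleftrightarrow> x \<noteq> 0 \<and> inverse x \<in> Ok"
proof -
  assume x: "x \<in> Ok"
  then have xK: "x \<in> K" "absv x \<le> 1" by (auto simp: Ok_iff)
  show ?thesis
  proof (cases "x = 0")
    case True then show ?thesis by simp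
  next
    case False
    then have "absv x > 0" using abs_nonneg[OF xK(1)] abs_eq0[OF xK(1)] by simp
    then show ?thesis using xK False by (auto simp: vle_p_iff Ok_iff Kinv abs_inv inverse_le_1_iff)
  qed
qed

lemma decomp:
  assumes "x \<in> Ok" "x \<noteq> 0"
  shows "\<exists>n u. u \<in> Ok \<and> \<not> O.vle u p \<and> x = p ^ n * u"
proof -
  have xK: "x \<in> K" "absv x \<le> 1" using assms by (auto simp: Ok_iff)
  obtain n :: int where n: "absv x = absv p powi n" using gen xK(1) assms(2) by blast
  define m where "m = nat n"
  have ax: "absv x = absv p ^ m"
  proof (cases "n \<ge> 0")
    case True then show ?thesis using n by (simp add: power_int_def m_def)
  next
    case False
    have "absv x > 1" using False n p0 p1
      by (simp add: power_int_def one_less_inverse_iff power_inverse) (simp add: power_less_one_iff)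
    then show ?thesis using xK(2) by simp
  qed
  have u: "absv (x / p ^ m) = 1" "x / p ^ m \<in> K"
    using xK(1) pK ax p0 by (simp_all add: divide_inverse abs_mult abs_inv abs_pow)
  have "\<not> O.vle (x / p ^ m) p" using vle_p_iff[OF u(2)] u(1) by simp
  moreover have "x / p ^ m \<in> Ok" using u by (simp add: Ok_iff)
  moreover have "x = p ^ m * (x / p ^ m)" by simp
  ultimately show ?thesis by blast
qed

lemma decomp_K:
  assumes "x \<in> K"
  shows "\<exists>n. p ^ n * x \<in> Ok"
proof -
  have "\<exists>n. absv p ^ n * absv x \<le> 1"
  proof (cases "absv x = 0")
    case False
    then have "absv x > 0" using abs_nonneg[OF assms] by simp
    obtain n where "absv p ^ n < inverse (absv x)"
      using real_arch_pow_inv[of "inverse (absv x)" "absv p"] \<open>absv x > 0\<close> p1 by auto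
    then show ?thesis using \<open>absv x > 0\<close> by (intro exI[of _ n]) (simp add: field_simps)
  qed auto
  then show ?thesis using assms pK by (simp add: Ok_iff Kmult Kpow abs_mult abs_pow)
qed

text \<open>Discreteness replaces the finiteness assumed in \<open>ex_max\<close>: the smallest
  exponent of \<open>p\<close> among the nonzero elements is attained. In particular every ideal of
  \<open>Ok\<close> is principal.\<close>

lemma ex_max_Ok:
  assumes "I \<subseteq> Ok" "I \<noteq> {}"
  shows "\<exists>d\<in>I. \<forall>c\<in>I. O.vle c d"
proof (cases "I \<subseteq> {0}")
  case True
  then show ?thesis using assms O.vle_refl by blast
next
  case False
  then obtain x where x: "x \<in> I" "x \<noteq> 0" by blast
  let ?P = "\<lambda>n. \<exists>c\<in>I. \<exists>u\<in>Ok. \<not> O.vle u p \<and> c = p ^ n * u"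
  have "\<exists>n. ?P n" using decomp[of x] x assms(1) by blast
  then have "?P (LEAST n. ?P n)" by (rule LeastI_ex)
  then obtain n d u where n: "n = (LEAST n. ?P n)" and d: "d \<in> I" "u \<in> Ok" "\<not> O.vle u p" "d = p ^ n * u" by blast
  have u: "u \<noteq> 0" "inverse u \<in> Ok" using unit_iff d by blast+
  have "O.vle c d" if c: "c \<in> I" for c
  proof (cases "c = 0")
    case True then show ?thesis by simp
  next
    case False
    then obtain m v where v: "v \<in> Ok" "\<not> O.vle v p" "c = p ^ m * v" using decomp[of c] c assms by blast
    then have "?P m" using c by blast
    then have "n \<le> m" unfolding n by (rule Least_le)
    then have "c = (p ^ (m - n) * v * inverse u) * d" using v d u by (simp add: power_add[symmetric] field_simps)
    moreover have "p ^ (m - n) * v * inverse u \<in> Ok" using v u by simp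
    ultimately show ?thesis unfolding O.vle_def by blast
  qed
  then show ?thesis using d by blast
qed

lemma residue: "\<exists>T. finite T \<and> T \<subseteq> Ok \<and> (\<forall>x\<in>Ok. \<exists>t\<in>T. \<exists>y\<in>Ok. x = t + p * y)"
proof -
  obtain T where T: "finite T" "T \<subseteq> Ok" "\<forall>x\<in>Ok. \<exists>t\<in>T. absv (x - t) < 1"
    using abs_facts(5) unfolding ring_of_integers_def by blast
  have "\<exists>t\<in>T. \<exists>y\<in>Ok. x = t + p * y" if x: "x \<in> Ok" for x
  proof -
    obtain t where t: "t \<in> T" "absv (x - t) < 1" using T x by blast
    have "x - t \<in> K" using x t T by (auto simp: Ok_iff intro: Kdiff)
    then have "O.vle (x - t) p" using vle_p_iff t by blast
    then obtain y where "y \<in> Ok" "x - t = y * p" unfolding O.vle_def by blast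
    then show ?thesis using t by (intro bexI[of _ t] bexI[of _ y]) (auto simp: algebra_simps)
  qed
  then show ?thesis using T by blast
qed

text \<open>Completeness restated as convergence of series in powers of \<open>p\<close> with
  integral remainders. In this form it mentions no absolute value and passes to finitely generated
  \<open>Ok\<close>-modules in L.\<close>

lemma complete:
  assumes "\<And>n. a n \<in> Ok"
  shows "\<exists>l\<in>Ok. \<forall>n. \<exists>y\<in>Ok. l = (\<Sum>i<n. p ^ i * a i) + p ^ n * y"
proof -
  define s where "s n = (\<Sum>i<n. p ^ i * a i)" for n
  have aK: "a n \<in> K" for n using assms by (simp add: Ok_iff)
  have sK: "s n \<in> K" for n unfolding s_def using aK pK by (intro Ksum Kmult Kpow)
  have le: "absv (s (n + d) - s n) \<le> absv p ^ n" for n d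
  proof (induction d)
    case 0 show ?case using abs_eq0[of 0] p0 by simp
  next
    case (Suc d)
    have e: "s (n + Suc d) - s n = (s (n + d) - s n) + p ^ (n + d) * a (n + d)" by (simp add: s_def)
    have "absv (p ^ (n + d) * a (n + d)) \<le> absv p ^ n"
    proof -
      have "absv (p ^ (n + d) * a (n + d)) = absv p ^ (n + d) * absv (a (n + d))"
        using aK pK by (simp add: abs_mult Kpow abs_pow)
      also have "\<dots> \<le> absv p ^ n * 1"
        using assms[of "n + d"] p0 p1 abs_nonneg[OF aK] by (intro mult_mono power_decreasing) (auto simp: Ok_iff)
      finally show ?thesis by simp
    qed
    then show ?case unfolding e
      using abs_add[OF Kdiff[OF sK sK] Kmult[OF Kpow[OF pK] aK], of "n + d" n "n + d" "n + d"] Suc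
      by (meson max.bounded_iff order_trans)
  qed
  have le': "absv (s m - s n) \<le> absv p ^ N" if "N \<le> n" "N \<le> m" for m n N
  proof -
    have "absv (s n - s N) \<le> absv p ^ N" "absv (s m - s N) \<le> absv p ^ N"
      using le[of N "n - N"] le[of N "m - N"] that by simp_all
    then show ?thesis using abs_diff[OF Kdiff[OF sK sK] Kdiff[OF sK sK], of m N n N]
      by (simp add: max_def split: if_splits)
  qed
  have "\<forall>e>0. \<exists>N. \<forall>m\<ge>N. \<forall>n\<ge>N. absv (s m - s n) < e"
  proof (intro allI impI)
    fix e :: real assume "e > 0"
    then obtain N where "absv p ^ N < e" using real_arch_pow_inv p1 by blast
    then show "\<exists>N. \<forall>m\<ge>N. \<forall>n\<ge>N. absv (s m - s n) < e" using le' by (meson le_less_trans)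
  qed
  then obtain l where l: "l \<in> K" "\<forall>e>0. \<exists>N. \<forall>n\<ge>N. absv (s n - l) < e"
    using abs_facts(4) sK by blast
  have main: "\<exists>y\<in>Ok. l = s n + p ^ n * y" for n
  proof -
    have "absv p ^ n > 0" using p0 by simp
    then obtain N where N: "\<forall>m\<ge>N. absv (s m - l) < absv p ^ n" using l(2) by blast
    define m where "m = max n N"
    have "absv (s m - l) \<le> absv p ^ n" "absv (s m - s n) \<le> absv p ^ n"
      using N le'[of n n m] by (auto simp: m_def less_imp_le)
    moreover have "l - s n = (s m - s n) - (s m - l)" by simp
    ultimately have "absv (l - s n) \<le> absv p ^ n"
      using abs_diff[OF Kdiff[OF sK sK] Kdiff[OF sK l(1)], of m n m]
      by (metis max.bounded_iff order_trans)
    then have "O.vle (l - s n) (p ^ n)" using vle_p_pow_iff Kdiff[OF l(1) sK] by blast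
    then obtain y where "y \<in> Ok" "l - s n = y * p ^ n" unfolding O.vle_def by blast
    then show ?thesis by (intro bexI[of _ y]) (auto simp: algebra_simps)
  qed
  obtain y where "y \<in> Ok" "l = s 0 + p ^ 0 * y" using main by blast
  then have "l \<in> Ok" by (simp add: s_def)
  then show ?thesis using main unfolding s_def by blast
qed

end

section \<open>Finitely generated modules in the field and integral elements\<close>

inductive_set mspan :: "'a::comm_ring_1 set \<Rightarrow> 'a set \<Rightarrow> 'a set" for S V where
  mspan_zero: "0 \<in> mspan S V"
| mspan_step: "c \<in> S \<Longrightarrow> v \<in> V \<Longrightarrow> m \<in> mspan S V \<Longrightarrow> c * v + m \<in> mspan S V"

context subring_of
begin

lemma mspan_base: "v \<in> V \<Longrightarrow> v \<in> mspan S V"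
  using mspan_step[of 1 S v V 0] by (simp add: mspan_zero)

lemma mspan_add: "x \<in> mspan S V \<Longrightarrow> y \<in> mspan S V \<Longrightarrow> x + y \<in> mspan S V"
  by (induction rule: mspan.induct) (simp_all add: add.assoc mspan_step)

lemma mspan_scale: "c \<in> S \<Longrightarrow> x \<in> mspan S V \<Longrightarrow> c * x \<in> mspan S V"
proof -
  assume c: "c \<in> S" and x: "x \<in> mspan S V"
  from x show ?thesis
  proof (induction x rule: mspan.induct)
    case mspan_zero show ?case by (simp add: mspan.mspan_zero)
  next
    case (mspan_step d v m)
    have "(c * d) * v + c * m \<in> mspan S V" using mspan_step c by (intro mspan.mspan_step) simp_all
    then show ?case by (simp add: distrib_left mult.assoc)
  qed
qed

lemma mspan_diff: "x \<in> mspan S V \<Longrightarrow> y \<in> mspan S V \<Longrightarrow> x - y \<in> mspan S V"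
  using mspan_add[of x V "(-1) * y"] mspan_scale[of "-1" y V] by simp

lemma mspan_sum: "(\<And>i. i \<in> I \<Longrightarrow> f i \<in> mspan S V) \<Longrightarrow> sum f I \<in> mspan S V"
  by (induction I rule: infinite_finite_induct) (simp_all add: mspan_add mspan_zero)

lemma mspan_least:
  assumes "x \<in> mspan S V" "0 \<in> M" "\<And>x y. x \<in> M \<Longrightarrow> y \<in> M \<Longrightarrow> x + y \<in> M"
    "\<And>c v. c \<in> S \<Longrightarrow> v \<in> V \<Longrightarrow> c * v \<in> M"
  shows "x \<in> M"
  using assms(1) by (induction rule: mspan.induct) (simp_all add: assms(2-))

lemma mspan_trans:
  assumes "x \<in> mspan S V" "V \<subseteq> mspan S W"
  shows "x \<in> mspan S W"
  using assms(1) by (rule mspan_least) (use assms(2) in \<open>auto simp: mspan_zero mspan_add mspan_scale\<close>)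

lemma mspan_mono: "x \<in> mspan S V \<Longrightarrow> V \<subseteq> W \<Longrightarrow> x \<in> mspan S W"
  using mspan_trans mspan_base by blast

lemma mspan_mult:
  assumes "x \<in> mspan S V" "\<And>v. v \<in> V \<Longrightarrow> z * v \<in> mspan S W"
  shows "z * x \<in> mspan S W"
proof -
  have "x \<in> {x. z * x \<in> mspan S W}"
    using assms(1)
  proof (rule mspan_least)
    show "c * v \<in> {x. z * x \<in> mspan S W}" if "c \<in> S" "v \<in> V" for c v
      using mspan_scale[OF that(1) assms(2)[OF that(2)]] by (simp add: mult.left_commute)
  qed (auto simp: mspan_zero distrib_left mspan_add)
  then show ?thesis by simp
qed

lemma mspan_mult2:
  assumes "x \<in> mspan S V" "y \<in> mspan S W" "\<And>v w. v \<in> V \<Longrightarrow> w \<in> W \<Longrightarrow> v * w \<in> mspan S U"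
  shows "x * y \<in> mspan S U"
proof (rule mspan_mult[OF assms(2)])
  fix w assume w: "w \<in> W"
  have "w * x \<in> mspan S U" using assms(3) w by (intro mspan_mult[OF assms(1)]) (simp add: mult.commute)
  then show "x * w \<in> mspan S U" by (simp add: mult.commute)
qed

lemma mspan_insert:
  assumes "x \<in> mspan S (insert v V)"
  shows "\<exists>c\<in>S. \<exists>m\<in>mspan S V. x = c * v + m"
  using assms
proof (induction rule: mspan.induct)
  case mspan_zero
  show ?case by (intro bexI[of _ 0]) (simp_all add: mspan.mspan_zero)
next
  case (mspan_step d w m)
  then obtain c m' where m': "c \<in> S" "m' \<in> mspan S V" "m = c * v + m'" by blast
  show ?case
  proof (cases "w = v")
    case True
    then show ?thesis using m' mspan_step
      by (intro bexI[of _ "c + d"] bexI[of _ m']) (simp_all add: algebra_simps)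
  next
    case False
    then have "d * w + m' \<in> mspan S V" using m' mspan_step by (intro mspan.mspan_step) auto
    then show ?thesis using m' by (intro bexI[of _ c] bexI[of _ "d * w + m'"]) (simp_all add: algebra_simps)
  qed
qed

lemma mspan_poly:
  assumes "x \<in> mspan S ((\<lambda>i. z ^ i) ` {..<b})"
  shows "\<exists>q. (\<forall>i. coeff q i \<in> S) \<and> (\<forall>i\<ge>b. coeff q i = 0) \<and> poly q z = x"
  using assms
proof (induction rule: mspan.induct)
  case mspan_zero show ?case by (intro exI[of _ 0]) simp
next
  case (mspan_step c v m)
  then obtain i where i: "i < b" "v = z ^ i" by auto
  obtain q where "(\<forall>i. coeff q i \<in> S) \<and> (\<forall>i\<ge>b. coeff q i = 0) \<and> poly q z = m" using mspan_step by blast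
  then show ?case using i mspan_step
    by (intro exI[of _ "monom c i + q"]) (auto simp: poly_monom)
qed

definition integral :: "'a \<Rightarrow> bool" where
  "integral z \<longleftrightarrow> (\<exists>q. lead_coeff q = 1 \<and> (\<forall>i. coeff q i \<in> S) \<and> poly q z = 0)"

lemma integral_powers:
  assumes "integral z"
  shows "\<exists>n. \<forall>k. z ^ k \<in> mspan S ((\<lambda>i. z ^ i) ` {..<n})"
proof -
  obtain q where q: "lead_coeff q = 1" "\<forall>i. coeff q i \<in> S" "poly q z = 0"
    using assms unfolding integral_def by blast
  define n where "n = degree q"
  let ?M = "mspan S ((\<lambda>i. z ^ i) ` {..<n})"
  have b: "z ^ i \<in> ?M" if "i < n" for i using that by (intro mspan_base) auto
  have "(\<Sum>i<n. coeff q i * z ^ i) + z ^ n = 0"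
    using q unfolding poly_altdef n_def by (simp add: lessThan_Suc_atMost[symmetric])
  then have "z ^ n = 0 - (\<Sum>i<n. coeff q i * z ^ i)" by (simp add: eq_neg_iff_add_eq_0 add.commute)
  also have "\<dots> \<in> ?M" using q b by (intro mspan_diff mspan_sum mspan_scale) (auto simp: mspan_zero)
  finally have zn: "z ^ n \<in> ?M" .
  have "z * x \<in> ?M" if "x \<in> ?M" for x
  proof (rule mspan_mult[OF that])
    fix v assume "v \<in> (\<lambda>i. z ^ i) ` {..<n}"
    then obtain i where "i < n" "v = z ^ i" by auto
    then show "z * v \<in> ?M" using b[of "Suc i"] zn by (cases "Suc i = n") auto
  qed
  then have "z ^ (k + n) \<in> ?M" for k
    using zn by (induction k) (simp_all add: mult.assoc)
  then have "z ^ k \<in> ?M" for k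
    using b by (cases "k < n") (simp_all, metis le_add_diff_inverse2 not_less)
  then show ?thesis by blast
qed

end

context local_field
begin

abbreviation "msp \<equiv> mspan Ok"
abbreviation "isint \<equiv> O.V.integral"

lemma ext_integers_eq: "ext_integers K absv L = {x\<in>L. isint x}"
  unfolding ext_integers_def O.V.integral_def by simp

text \<open>Noetherianity by induction on the generators. The coefficients at \<open>v\<close> of
  elements of \<open>N\<close> have a common divisor \<open>d\<close> that is itself attained, and
  subtracting multiples of an element with coefficient \<open>d\<close> leads into the span of the
  remaining generators.\<close>

lemma submodule_fin_gen:
  assumes "finite V" "N \<subseteq> msp V" "0 \<in> N" "\<And>x y. x \<in> N \<Longrightarrow> y \<in> N \<Longrightarrow> x + y \<in> N"
    "\<And>c x. c \<in> Ok \<Longrightarrow> x \<in> N \<Longrightarrow> c * x \<in> N"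
  shows "\<exists>W. finite W \<and> W \<subseteq> N \<and> N \<subseteq> msp W"
  using assms
proof (induction V arbitrary: N)
  case empty
  have "msp {} \<subseteq> {0}"
  proof
    fix x assume "x \<in> msp {}"
    then show "x \<in> {0}" by (rule O.V.mspan_least) auto
  qed
  then show ?case using empty by (intro exI[of _ "{}"]) (auto simp: mspan_zero)
next
  case (insert v V)
  define I where "I = {c\<in>Ok. \<exists>m\<in>msp V. c * v + m \<in> N}"
  have "0 \<in> I" unfolding I_def using insert.prems mspan_zero[of Ok V] by auto
  then obtain d where d: "d \<in> I" "\<forall>c\<in>I. O.vle c d" using ex_max_Ok[of I] unfolding I_def by blast
  then obtain m0 where m0: "d \<in> Ok" "m0 \<in> msp V" "d * v + m0 \<in> N" unfolding I_def by blast
  have "\<exists>W. finite W \<and> W \<subseteq> N \<inter> msp V \<and> N \<inter> msp V \<subseteq> msp W"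
    using insert.prems by (intro insert.IH) (auto simp: mspan_zero O.V.mspan_add O.V.mspan_scale)
  then obtain W where W: "finite W" "W \<subseteq> N \<inter> msp V" "N \<inter> msp V \<subseteq> msp W" by blast
  have "x \<in> msp (insert (d * v + m0) W)" if x: "x \<in> N" for x
  proof -
    have "x \<in> msp (insert v V)" using x insert.prems(1) by blast
    then obtain c m where c: "c \<in> Ok" "m \<in> msp V" "x = c * v + m" using O.V.mspan_insert by blast
    then have "c \<in> I" unfolding I_def using x by blast
    then obtain e where e: "e \<in> Ok" "c = e * d" using d(2) unfolding O.vle_def by blast
    have "x + (-e) * (d * v + m0) \<in> N"
      by (rule insert.prems(3)[OF x insert.prems(4)[OF _ m0(3)]]) (simp add: e)
    moreover have eq: "x + (-e) * (d * v + m0) = m - e * m0" using c e by (simp add: algebra_simps)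
    moreover have "m - e * m0 \<in> msp V" using c e m0 by (simp add: O.V.mspan_diff O.V.mspan_scale)
    ultimately have "m - e * m0 \<in> msp W" using W by auto
    then have "e * (d * v + m0) + (m - e * m0) \<in> msp (insert (d * v + m0) W)"
      using e by (intro mspan_step) (auto intro: O.V.mspan_mono)
    moreover have "e * (d * v + m0) + (m - e * m0) = x" using c e by (simp add: algebra_simps)
    ultimately show ?thesis by simp
  qed
  then show ?case using W m0 by (intro exI[of _ "insert (d * v + m0) W"]) auto
qed

text \<open>Noetherianity takes the place of a determinant argument: the module generated by all
  powers of \<open>z\<close> is finitely generated, hence spanned by the powers below some
  \<open>b\<close>, and expressing \<open>z ^ b\<close> by them is a monic equation.\<close>

lemma isint_if_powers:
  assumes "finite V" "\<And>k. z ^ k \<in> msp V"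
  shows "isint z"
proof -
  let ?N = "msp (range (\<lambda>k. z ^ k))"
  have "?N \<subseteq> msp V"
  proof
    fix x assume "x \<in> ?N"
    then show "x \<in> msp V" by (rule O.V.mspan_trans) (use assms in auto)
  qed
  then obtain W where W: "finite W" "W \<subseteq> ?N" "?N \<subseteq> msp W"
    using submodule_fin_gen[OF assms(1), of ?N] O.V.mspan_add O.V.mspan_scale mspan_zero by metis
  let ?P = "\<lambda>b. (\<lambda>k. z ^ k) ` {..<b::nat}"
  have ex: "\<exists>b. x \<in> msp (?P b)" if "x \<in> ?N" for x
    using that
  proof (induction rule: mspan.induct)
    case mspan_zero show ?case using mspan.mspan_zero by blast
  next
    case (mspan_step c v m)
    then obtain b k where bk: "m \<in> msp (?P b)" "v = z ^ k" by auto
    have "c * v + m \<in> msp (?P (max b (Suc k)))"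
      using mspan_step bk by (intro mspan.mspan_step) (auto intro: O.V.mspan_mono)
    then show ?case by blast
  qed
  have "\<exists>b. W \<subseteq> msp (?P b)"
    using W(1,2)
  proof (induction W)
    case (insert w W)
    then obtain b b' where "W \<subseteq> msp (?P b)" "w \<in> msp (?P b')" using ex by blast
    then have "insert w W \<subseteq> msp (?P (max b b'))"
      using O.V.mspan_mono[of _ "?P b" "?P (max b b')"] O.V.mspan_mono[of w "?P b'" "?P (max b b')"] by force
    then show ?case by blast
  qed simp
  then obtain b where b: "W \<subseteq> msp (?P b)" by blast
  have "z ^ b \<in> ?N" by (intro O.V.mspan_base) simp
  then have "z ^ b \<in> msp (?P b)" using W(3) b O.V.mspan_trans by blast
  then obtain q where q: "\<forall>i. coeff q i \<in> Ok" "\<forall>i\<ge>b. coeff q i = 0" "poly q z = z ^ b"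
    using O.V.mspan_poly by blast
  let ?q = "monom 1 b - q"
  have c: "coeff ?q b = 1" "\<forall>i>b. coeff ?q i = 0" using q by auto
  have "degree ?q = b" using c by (metis coeff_0 degree_le le_antisym le_degree zero_neq_one)
  then have "lead_coeff ?q = 1" using c by simp
  moreover have "\<forall>i. coeff ?q i \<in> Ok" using q by simp
  moreover have "poly ?q z = 0" using q by (simp add: poly_monom)
  ultimately show ?thesis unfolding O.V.integral_def by blast
qed

lemma isint_if_stable:
  assumes "finite V" "1 \<in> msp V" "\<And>v. v \<in> V \<Longrightarrow> z * v \<in> msp V"
  shows "isint z"
proof (rule isint_if_powers[OF assms(1)])
  show "z ^ k \<in> msp V" for k
    by (induction k) (simp_all add: assms O.V.mspan_mult)
qed

text \<open>The products of a power of \<open>x\<close> and a power of \<open>y\<close> span a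
  module stable under both, hence stable under their sum, difference and product.\<close>

lemma isint_common_module:
  assumes "isint x" "isint y"
  shows "\<exists>V. finite V \<and> 1 \<in> msp V \<and> (\<forall>v\<in>V. x * v \<in> msp V) \<and> (\<forall>v\<in>V. y * v \<in> msp V)"
proof -
  obtain n m where n: "\<And>k. x ^ k \<in> msp ((\<lambda>i. x ^ i) ` {..<n})" and m: "\<And>k. y ^ k \<in> msp ((\<lambda>i. y ^ i) ` {..<m})"
    using O.V.integral_powers assms by metis
  let ?X = "(\<lambda>i. x ^ i) ` {..<n}" and ?Y = "(\<lambda>i. y ^ i) ` {..<m}"
  let ?V = "(\<lambda>(a,b). a * b) ` (?X \<times> ?Y)"
  have prod: "a * b \<in> msp ?V" if "a \<in> msp ?X" "b \<in> msp ?Y" for a b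
    by (rule O.V.mspan_mult2[OF that], rule O.V.mspan_base) auto
  have XY: "a \<in> ?X \<Longrightarrow> a \<in> msp ?X" "b \<in> ?Y \<Longrightarrow> b \<in> msp ?Y" for a b by (intro O.V.mspan_base, assumption)+
  have x: "x * a \<in> msp ?X" if a: "a \<in> ?X" for a
  proof -
    obtain i where "a = x ^ i" using a by blast
    then show ?thesis using n[of "Suc i"] by simp
  qed
  have y: "y * a \<in> msp ?Y" if a: "a \<in> ?Y" for a
  proof -
    obtain i where "a = y ^ i" using a by blast
    then show ?thesis using m[of "Suc i"] by simp
  qed
  have "1 \<in> msp ?V" using prod[of 1 1] n[of 0] m[of 0] by simp
  moreover have "x * v \<in> msp ?V \<and> y * v \<in> msp ?V" if v: "v \<in> ?V" for v
  proof -
    obtain c where "c \<in> ?X \<times> ?Y" "v = (\<lambda>(a,b). a * b) c" using v by (rule imageE)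
    then have "fst c \<in> ?X" "snd c \<in> ?Y" "v = fst c * snd c" by (auto simp: case_prod_beta)
    then obtain a b where ab: "a \<in> ?X" "b \<in> ?Y" "v = a * b" by (elim that)
    have "(x * a) * b \<in> msp ?V" "a * (y * b) \<in> msp ?V"
      using prod[OF x[OF ab(1)] XY(2)[OF ab(2)]] prod[OF XY(1)[OF ab(1)] y[OF ab(2)]] by blast+
    then show ?thesis unfolding ab(3) by (simp add: mult.assoc mult.left_commute)
  qed
  moreover have "finite ?V" by simp
  ultimately show ?thesis by blast
qed

lemma isint_ring:
  assumes "isint x" "isint y"
  shows "isint (x + y)" "isint (x - y)" "isint (x * y)"
proof -
  obtain V where V: "finite V" "1 \<in> msp V" "\<And>v. v \<in> V \<Longrightarrow> x * v \<in> msp V" "\<And>v. v \<in> V \<Longrightarrow> y * v \<in> msp V"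
    using isint_common_module[OF assms] by blast
  show "isint (x + y)"
    by (rule isint_if_stable[OF V(1,2)]) (simp add: distrib_right O.V.mspan_add V)
  show "isint (x - y)"
    by (rule isint_if_stable[OF V(1,2)]) (simp add: left_diff_distrib O.V.mspan_diff V)
  show "isint (x * y)"
    by (rule isint_if_stable[OF V(1,2)]) (simp add: mult.assoc O.V.mspan_mult[OF V(4) V(3)] O.V.mspan_mult[OF _ V(3)] V)
qed

lemma isint_Ok: "x \<in> Ok \<Longrightarrow> isint x"
  by (rule isint_if_stable[of "{1}"]) (auto intro: O.V.mspan_base O.V.mspan_scale[of x 1, simplified])

text \<open>A valuation ring is integrally closed: if \<open>z\<close> were not integral its inverse
  would be, and multiplying an expression of \<open>z ^ n\<close> by lower powers with
  \<open>inverse z ^ (n - 1)\<close> would put \<open>z\<close> itself into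
  \<open>Ok\<close>.\<close>

lemma isint_K:
  assumes "isint z" "z \<in> K"
  shows "z \<in> Ok"
proof (rule ccontr)
  assume z: "z \<notin> Ok"
  then have w: "inverse z \<in> Ok" using O.val assms by blast
  have z0: "z \<noteq> 0" using z by auto
  obtain n where n: "\<And>k. z ^ k \<in> msp ((\<lambda>i. z ^ i) ` {..<n})" using O.V.integral_powers assms by blast
  have "n \<noteq> 0"
  proof
    assume "n = 0"
    then have "1 \<in> msp {}" using n[of 0] by simp
    then have "1 \<in> {0::'a}" by (rule O.V.mspan_least) auto
    then show False by simp
  qed
  have "inverse z ^ (n - 1) * m \<in> Ok" if "m \<in> msp ((\<lambda>i. z ^ i) ` {..<n})" for m
  proof -
    have "m \<in> {m. inverse z ^ (n - 1) * m \<in> Ok}"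
      using that
    proof (rule O.V.mspan_least)
      fix c v assume c: "c \<in> Ok" and "v \<in> (\<lambda>i. z ^ i) ` {..<n}"
      then obtain i where i: "i < n" "v = z ^ i" by auto
      have "n - 1 = (n - 1 - i) + i" using i by simp
      then have "inverse z ^ (n - 1) = inverse z ^ (n - 1 - i) * inverse z ^ i" by (metis power_add)
      then have E: "inverse z ^ (n - 1) * (c * v) = c * inverse z ^ (n - 1 - i)"
        using i z0 by (simp only: power_inverse) (simp add: field_simps)
      show "c * v \<in> {m. inverse z ^ (n - 1) * m \<in> Ok}" unfolding mem_Collect_eq E using c w by simp
    qed (simp_all add: distrib_left)
    then show ?thesis by simp
  qed
  from this[OF n[of n]] have "inverse z ^ (n - 1) * z ^ n \<in> Ok" .
  moreover have "inverse z ^ (n - 1) * z ^ n = z" using \<open>n \<noteq> 0\<close> z0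
    by (cases n) (simp_all add: power_inverse)
  ultimately show False using z by simp
qed

lemma uniform_exponent:
  assumes "finite X" "\<And>x. x \<in> X \<Longrightarrow> \<exists>n. P n x" "\<And>n m x. P n x \<Longrightarrow> n \<le> m \<Longrightarrow> P m x"
  shows "\<exists>n::nat. \<forall>x\<in>X. P n x"
  using assms(1,2)
proof (induction X)
  case (insert x X)
  then obtain n m where "\<forall>x\<in>X. P n x" "P m x" by blast
  then have "\<forall>y\<in>insert x X. P (max n m) y" using assms(3) by (metis insert_iff max.cobounded1 max.cobounded2)
  then show ?case by blast
qed simp

lemma p_pow_scale_mono: "p ^ n * x \<in> msp V \<Longrightarrow> n \<le> m \<Longrightarrow> p ^ m * x \<in> msp V"
  using O.V.mspan_scale[of "p ^ (m - n)" "p ^ n * x" V]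
  by (simp add: mult.assoc[symmetric] power_add[symmetric])

text \<open>An order of L: scaling a K-basis by a power \<open>p ^ N\<close> that clears the
  denominators of its multiplication table makes the table integral, because the product of two
  scaled vectors still carries a spare factor \<open>p ^ N\<close>. Then 1 is adjoined.\<close>

lemma ex_order_ring:
  assumes L: "finite_extension K L"
  shows "\<exists>V. finite V \<and> V \<subseteq> L \<and> 1 \<in> V \<and> (\<forall>u\<in>V. \<forall>v\<in>V. u * v \<in> msp V) \<and> (\<forall>x\<in>L. \<exists>n. p ^ n * x \<in> msp V)"
proof -
  obtain B where B: "finite B" "B \<subseteq> L" "L = {(\<Sum>b\<in>B. c b * b) | c. \<forall>b\<in>B. c b \<in> K}"
    and sL: "subfield L" "K \<subseteq> L"
    using L unfolding finite_extension_def by blast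
  have Lm: "x \<in> L \<Longrightarrow> y \<in> L \<Longrightarrow> x * y \<in> L" for x y using sL(1) unfolding subfield_def by blast
  have L1: "1 \<in> L" using sL(1) unfolding subfield_def by blast
  have pL: "p ^ n \<in> L" for n using sL(2) Kpow[OF pK] by blast
  have ex: "\<exists>n. p ^ n * x \<in> msp B" if x: "x \<in> L" for x
  proof -
    obtain c where c: "\<forall>b\<in>B. c b \<in> K" "x = (\<Sum>b\<in>B. c b * b)" using x B(3) by blast
    have "\<exists>n. \<forall>b\<in>B. p ^ n * c b \<in> Ok"
    proof (rule uniform_exponent[OF B(1)])
      show "\<exists>n. p ^ n * c b \<in> Ok" if "b \<in> B" for b using decomp_K c that by blast
      show "p ^ m * c b \<in> Ok" if "p ^ n * c b \<in> Ok" "n \<le> m" for n m b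
      proof -
        have "p ^ (m - n) * (p ^ n * c b) \<in> Ok" by (rule O.V.Smult[OF _ that(1)]) simp
        then show ?thesis using that(2) by (simp add: mult.assoc[symmetric] power_add[symmetric])
      qed
    qed
    then obtain n where n: "\<forall>b\<in>B. p ^ n * c b \<in> Ok" by blast
    have "p ^ n * x = (\<Sum>b\<in>B. (p ^ n * c b) * b)" unfolding c(2) by (simp add: sum_distrib_left mult.assoc)
    also have "\<dots> \<in> msp B" using n by (intro O.V.mspan_sum O.V.mspan_scale O.V.mspan_base) auto
    finally show ?thesis by blast
  qed
  have "\<exists>N. \<forall>q\<in>B \<times> B. p ^ N * (fst q * snd q) \<in> msp B"
  proof (rule uniform_exponent)
    show "finite (B \<times> B)" using B by simp
    show "\<exists>n. p ^ n * (fst q * snd q) \<in> msp B" if "q \<in> B \<times> B" for q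
      using that B(2) by (intro ex Lm) auto
  qed (rule p_pow_scale_mono)
  then obtain N where N: "\<And>u v. u \<in> B \<Longrightarrow> v \<in> B \<Longrightarrow> p ^ N * (u * v) \<in> msp B" by fastforce
  define V where "V = insert 1 ((\<lambda>b. p ^ N * b) ` B)"
  have BV: "p ^ N * x \<in> msp V" if "x \<in> msp B" for x
    using that by (rule O.V.mspan_mult) (auto simp: V_def intro: O.V.mspan_base)
  have "u * v \<in> msp V" if "u \<in> V" "v \<in> V" for u v
  proof (cases "u = 1 \<or> v = 1")
    case True then show ?thesis using that by (auto intro: O.V.mspan_base)
  next
    case False
    then have "u \<in> (\<lambda>b. p ^ N * b) ` B" "v \<in> (\<lambda>b. p ^ N * b) ` B" using that unfolding V_def by blast+
    then obtain a b where ab: "a \<in> B" "b \<in> B" "u = p ^ N * a" "v = p ^ N * b" by (elim imageE)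
    have uv: "u * v = p ^ N * (p ^ N * (a * b))" by (simp add: ab)
    show ?thesis unfolding uv by (rule BV[OF N[OF ab(1,2)]])
  qed
  moreover have "\<exists>n. p ^ n * x \<in> msp V" if x: "x \<in> L" for x
  proof -
    obtain n where "p ^ n * x \<in> msp B" using ex[OF x] by blast
    then have "p ^ (N + n) * x \<in> msp V" using BV[of "p ^ n * x"] by (simp add: power_add mult.assoc)
    then show ?thesis by blast
  qed
  moreover have "finite V" "V \<subseteq> L" "1 \<in> V" using B(1,2) L1 Lm pL by (auto simp: V_def)
  ultimately show ?thesis by blast
qed

lemma mspan_residue:
  assumes "finite V"
  shows "\<exists>T. finite T \<and> T \<subseteq> msp V \<and> (\<forall>x\<in>msp V. \<exists>t\<in>T. \<exists>y\<in>msp V. x = t + p * y)"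
  using assms
proof (induction V)
  case empty
  have "x = 0" if "x \<in> msp {}" for x
  proof -
    have "x \<in> {0}" using that by (rule O.V.mspan_least) auto
    then show ?thesis by simp
  qed
  then have "msp {} = {0}" using mspan_zero by blast
  then show ?case by (intro exI[of _ "{0}"]) simp
next
  case (insert v V)
  then obtain T where T: "finite T" "T \<subseteq> msp V" "\<forall>x\<in>msp V. \<exists>t\<in>T. \<exists>y\<in>msp V. x = t + p * y" by blast
  obtain U where U: "finite U" "U \<subseteq> Ok" "\<forall>x\<in>Ok. \<exists>t\<in>U. \<exists>y\<in>Ok. x = t + p * y" using residue by blast
  let ?T = "(\<lambda>(u,t). u * v + t) ` (U \<times> T)"
  have sub: "m \<in> msp V \<Longrightarrow> m \<in> msp (insert v V)" for m by (rule O.V.mspan_mono) auto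
  have "\<exists>t\<in>?T. \<exists>y\<in>msp (insert v V). x = t + p * y" if x: "x \<in> msp (insert v V)" for x
  proof -
    obtain c m where c: "c \<in> Ok" "m \<in> msp V" "x = c * v + m" using x O.V.mspan_insert by blast
    obtain u y where u: "u \<in> U" "y \<in> Ok" "c = u + p * y" using U(3) c(1) by blast
    obtain t z where t: "t \<in> T" "z \<in> msp V" "m = t + p * z" using T(3) c(2) by blast
    have "y * v + z \<in> msp (insert v V)" using u t sub by (intro mspan_step) auto
    moreover have "x = (u * v + t) + p * (y * v + z)" using c u t by (simp add: algebra_simps)
    moreover have "u * v + t \<in> ?T" using u t by auto
    ultimately show ?thesis by blast
  qed
  moreover have "?T \<subseteq> msp (insert v V)" using T(2) U(2) sub by (auto intro!: mspan_step)
  ultimately show ?case using T(1) U(1) by (intro exI[of _ ?T]) auto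
qed

lemma mspan_complete:
  assumes "finite V" "\<And>n. a n \<in> msp V"
  shows "\<exists>l\<in>msp V. \<forall>n. \<exists>y\<in>msp V. l = (\<Sum>i<n. p ^ i * a i) + p ^ n * y"
  using assms
proof (induction V arbitrary: a)
  case empty
  have "a n = 0" for n
  proof -
    have "a n \<in> {0}" using empty(1) by (rule O.V.mspan_least) auto
    then show ?thesis by simp
  qed
  then show ?case by (intro bexI[of _ 0]) (auto simp: mspan_zero intro!: bexI[of _ 0])
next
  case (insert v V)
  have "\<forall>n. \<exists>c m. c \<in> Ok \<and> m \<in> msp V \<and> a n = c * v + m"
    using O.V.mspan_insert[OF insert.prems] by blast
  then obtain c m where cm: "\<And>n. c n \<in> Ok" "\<And>n. m n \<in> msp V" "\<And>n. a n = c n * v + m n" by metis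
  obtain l where l: "l \<in> Ok" "\<forall>n. \<exists>y\<in>Ok. l = (\<Sum>i<n. p ^ i * c i) + p ^ n * y" using complete cm(1) by blast
  obtain k where k: "k \<in> msp V" "\<forall>n. \<exists>y\<in>msp V. k = (\<Sum>i<n. p ^ i * m i) + p ^ n * y"
    using insert.IH[of m] cm(2) by blast
  have sub: "m \<in> msp V \<Longrightarrow> m \<in> msp (insert v V)" for m by (rule O.V.mspan_mono) auto
  have "\<exists>y\<in>msp (insert v V). l * v + k = (\<Sum>i<n. p ^ i * a i) + p ^ n * y" for n
  proof -
    obtain y z where y: "y \<in> Ok" "l = (\<Sum>i<n. p ^ i * c i) + p ^ n * y"
      "z \<in> msp V" "k = (\<Sum>i<n. p ^ i * m i) + p ^ n * z" using l k by meson
    have "(\<Sum>i<n. p ^ i * a i) = (\<Sum>i<n. p ^ i * c i) * v + (\<Sum>i<n. p ^ i * m i)"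
      by (simp add: cm(3) distrib_left sum.distrib sum_distrib_right mult.assoc)
    then have "l * v + k = (\<Sum>i<n. p ^ i * a i) + p ^ n * (y * v + z)"
      using y(2,4) by (simp add: algebra_simps)
    moreover have "y * v + z \<in> msp (insert v V)" using y sub by (intro mspan_step) auto
    ultimately show ?thesis by blast
  qed
  moreover have "l * v + k \<in> msp (insert v V)" using l k sub by (intro mspan_step) auto
  ultimately show ?case by blast
qed

end

section \<open>The integral closure in L is a valuation ring\<close>

locale order_ring = local_field +
  fixes L :: "'a set" and V :: "'a set"
  assumes subL: "subfield L" and KL: "K \<subseteq> L"
    and finV: "finite V" and VL: "V \<subseteq> L" and oneV: "1 \<in> V"
    and multV: "\<And>u v. u \<in> V \<Longrightarrow> v \<in> V \<Longrightarrow> u * v \<in> msp V"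
    and absorb: "\<And>x. x \<in> L \<Longrightarrow> \<exists>n. p ^ n * x \<in> msp V"
begin

abbreviation "S \<equiv> msp V"

lemma ringS: "subring_of S"
proof
  show "0 \<in> S" by (rule mspan_zero)
  show "1 \<in> S" using oneV by (rule O.V.mspan_base)
  show "x * y \<in> S" if "x \<in> S" "y \<in> S" for x y using O.V.mspan_mult2[OF that multV] .
qed (rule O.V.mspan_add O.V.mspan_diff; assumption)+

sublocale S: subring_of S by (rule ringS)

lemma OkS: "c \<in> Ok \<Longrightarrow> c \<in> S" using O.V.mspan_scale[of c 1 V] S.S1 by simp

lemma pS [simp]: "p \<in> S" using OkS pO by blast

lemma S_isint: "x \<in> S \<Longrightarrow> isint x"
  by (rule isint_if_stable[OF finV]) (auto intro: S.Smult O.V.mspan_base)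

text \<open>Divisibility is taken inside \<open>S\<close>. Since \<open>S\<close> need not be
  integrally closed, a product of primitive elements need not be primitive, and the exponent of
  \<open>p\<close> split off by \<open>normalize\<close> is multiplicative only up to the bound of
  \<open>primitive_product\<close>.\<close>

definition primitive :: "'a \<Rightarrow> bool" where "primitive x \<longleftrightarrow> x \<in> S \<and> (\<forall>y\<in>S. x \<noteq> p * y)"

definition near :: "nat \<Rightarrow> 'a \<Rightarrow> 'a \<Rightarrow> bool" where "near n x y \<longleftrightarrow> (\<exists>s\<in>S. x - y = p ^ n * s)"

lemma near_sym: "near n x y \<Longrightarrow> near n y x"
proof -
  assume "near n x y"
  then obtain s where "s \<in> S" "x - y = p ^ n * s" unfolding near_def by blast
  then have "y - x = p ^ n * (- s)" "- s \<in> S" by (simp_all add: algebra_simps)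
  then show ?thesis unfolding near_def by blast
qed

lemma near_trans: "near n x y \<Longrightarrow> near n y z \<Longrightarrow> near n x z"
proof -
  assume "near n x y" "near n y z"
  then obtain s t where "s \<in> S" "x - y = p ^ n * s" "t \<in> S" "y - z = p ^ n * t" unfolding near_def by blast
  then have "x - z = p ^ n * (s + t)" "s + t \<in> S" by (simp_all add: algebra_simps)
  then show ?thesis unfolding near_def by blast
qed

lemma near_mult: "near n x y \<Longrightarrow> z \<in> S \<Longrightarrow> near n (x * z) (y * z)"
proof -
  assume "near n x y" "z \<in> S"
  then obtain s where "s \<in> S" "x - y = p ^ n * s" unfolding near_def by blast
  then have "x * z - y * z = p ^ n * (s * z)" "s * z \<in> S"
    using \<open>z \<in> S\<close> by (simp_all add: left_diff_distrib[symmetric] mult.assoc)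
  then show ?thesis unfolding near_def by blast
qed

lemma near_mono: "near n x y \<Longrightarrow> m \<le> n \<Longrightarrow> near m x y"
proof -
  assume "near n x y" "m \<le> n"
  then obtain s where "s \<in> S" "x - y = p ^ n * s" unfolding near_def by blast
  then have "x - y = p ^ m * (p ^ (n - m) * s)" "p ^ (n - m) * s \<in> S"
    using \<open>m \<le> n\<close> by (simp_all add: mult.assoc[symmetric] power_add[symmetric])
  then show ?thesis unfolding near_def by blast
qed

lemma near_in_S: "near n x y \<Longrightarrow> y \<in> S \<Longrightarrow> x \<in> S"
proof -
  assume "near n x y" "y \<in> S"
  then obtain s where "s \<in> S" "x - y = p ^ n * s" unfolding near_def by blast
  then have "x = y + p ^ n * s" by (simp add: algebra_simps)
  then show ?thesis using \<open>s \<in> S\<close> \<open>y \<in> S\<close> by simp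
qed

lemma primitive_near: "near (Suc n) x y \<Longrightarrow> primitive y \<Longrightarrow> primitive x"
proof -
  assume n: "near (Suc n) x y" and y: "primitive y"
  have "x \<in> S" using near_in_S[OF n] y unfolding primitive_def by blast
  moreover have "x \<noteq> p * z" if z: "z \<in> S" for z
  proof
    assume "x = p * z"
    obtain s where "s \<in> S" "x - y = p ^ Suc n * s" using n unfolding near_def by blast
    then have "y = p * (z - p ^ n * s)" "z - p ^ n * s \<in> S" using \<open>x = p * z\<close> z by (simp_all add: algebra_simps)
    then show False using y unfolding primitive_def by blast
  qed
  ultimately show ?thesis unfolding primitive_def by blast
qed

lemma inv_p_notin_S: "inverse p \<notin> S"
  using S_isint isint_K inv_p_notin Kinv[OF pK] by blast

text \<open>If \<open>z\<close> is nonzero, \<open>p ^ n * inverse z\<close> lies in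
  \<open>S\<close> for some \<open>n\<close>; multiplied by \<open>z / p ^ Suc n\<close>, it would
  put \<open>inverse p\<close> into \<open>S\<close>, whose elements are integral.\<close>

lemma S_separated:
  assumes "z \<in> L" "\<And>n. near n z 0"
  shows "z = 0"
proof (rule ccontr)
  assume z: "z \<noteq> 0"
  have "inverse z \<in> L" using subL assms(1) unfolding subfield_def by blast
  then obtain n where n: "p ^ n * inverse z \<in> S" using absorb by blast
  obtain s where s: "s \<in> S" "z = p ^ Suc n * s" using assms(2)[of "Suc n"] unfolding near_def by auto
  have "(p ^ n * inverse z) * s \<in> S" using n s by simp
  moreover have "s = z / p ^ Suc n" using s(2) by (simp add: field_simps)
  then have "(p ^ n * inverse z) * s = inverse p" using z by (simp add: field_simps)
  ultimately show False using inv_p_notin_S by simp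
qed

lemma S_L: "x \<in> S \<Longrightarrow> x \<in> L"
  by (erule O.V.mspan_least)
     (use subL KL VL in \<open>auto simp: subfield_def Ok_iff\<close>)

text \<open>Compactness: otherwise a nested-ball argument produces zero divisors in the field L.\<close>

lemma primitive_product:
  "\<exists>s. \<forall>u v. primitive u \<longrightarrow> primitive v \<longrightarrow> \<not> near s (u * v) 0"
proof (rule ccontr)
  assume "\<not> ?thesis"
  then have bad: "\<exists>u v. primitive u \<and> primitive v \<and> near s (u * v) 0" for s by blast
  obtain T where T: "finite T" "T \<subseteq> S" "\<forall>x\<in>S. \<exists>t\<in>T. \<exists>y\<in>S. x = t + p * y"
    using mspan_residue[OF finV] by blast
  \<comment> \<open>The ball of level \<open>n\<close> about the pair \<open>w\<close> contains
    primitive elements whose product is divisible by \<open>p ^ s\<close>. Balls are kept for which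
    this holds at every \<open>s\<close>; as there are finitely many sub-balls, one of them inherits
    the property.\<close>
  define B where "B n w s \<longleftrightarrow> (\<exists>u v. primitive u \<and> primitive v \<and> near n u (fst w) \<and> near n v (snd w) \<and> near s (u * v) 0)"
    for n s and w :: "'a \<times> 'a"
  define P where "P n w \<longleftrightarrow> fst w \<in> S \<and> snd w \<in> S \<and> (\<forall>s. B n w s)" for n w
  have "\<exists>f. \<forall>n. P n (f n) \<and> (\<exists>d\<in>S \<times> S. f (Suc n) = (fst (f n) + p ^ n * fst d, snd (f n) + p ^ n * snd d))"
  proof (rule dependent_nat_choice)
    have "near 0 u 0" if "primitive u" for u using that unfolding primitive_def near_def by auto
    then have "P 0 (0,0)" using bad unfolding P_def B_def by (simp add: mspan_zero) blast
    then show "\<exists>w. P 0 w" ..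
  next
    fix w n assume w: "P n w"
    define g where "g d = (fst w + p ^ n * fst d, snd w + p ^ n * snd d)" for d :: "'a \<times> 'a"
    have "\<exists>d\<in>T \<times> T. \<forall>s. B (Suc n) (g d) s"
    proof (rule ccontr)
      assume "\<not> ?thesis"
      then have "\<forall>d\<in>T \<times> T. \<exists>s. \<not> B (Suc n) (g d) s" by blast
      moreover have "\<not> B (Suc n) (g d) s'" if "\<not> B (Suc n) (g d) s" "s \<le> s'" for d s s'
        using that near_mono unfolding B_def by blast
      ultimately have "\<exists>s. \<forall>d\<in>T \<times> T. \<not> B (Suc n) (g d) s"
        using T(1) by (intro uniform_exponent) auto
      then obtain s where s: "\<And>d. d \<in> T \<times> T \<Longrightarrow> \<not> B (Suc n) (g d) s" by blast
      obtain u v where uv: "primitive u" "primitive v" "near n u (fst w)" "near n v (snd w)" "near s (u * v) 0"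
        using w unfolding P_def B_def by blast
      have "\<exists>t\<in>T. near (Suc n) x (y + p ^ n * t)" if "near n x y" for x y
      proof -
        obtain a where a: "a \<in> S" "x - y = p ^ n * a" using \<open>near n x y\<close> unfolding near_def by blast
        obtain t b where t: "t \<in> T" "b \<in> S" "a = t + p * b" using T(3) a(1) by blast
        have "x - (y + p ^ n * t) = p ^ Suc n * b" using a t by (simp add: algebra_simps)
        then show ?thesis using t unfolding near_def by blast
      qed
      then obtain t t' where "t \<in> T" "near (Suc n) u (fst w + p ^ n * t)" "t' \<in> T" "near (Suc n) v (snd w + p ^ n * t')"
        using uv by meson
      then have "B (Suc n) (g (t, t')) s" unfolding B_def g_def using uv by auto
      then show False using s \<open>t \<in> T\<close> \<open>t' \<in> T\<close> by blast
    qed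
    then obtain d where d: "d \<in> T \<times> T" "\<forall>s. B (Suc n) (g d) s" by blast
    then have "d \<in> S \<times> S" using T by auto
    moreover have "P (Suc n) (g d)" using d(2) \<open>d \<in> S \<times> S\<close> w unfolding P_def g_def by auto
    ultimately show "\<exists>w'. P (Suc n) w' \<and> (\<exists>d\<in>S \<times> S. w' = (fst w + p ^ n * fst d, snd w + p ^ n * snd d))"
      unfolding g_def by blast
  qed
  then obtain f where f: "\<And>n. P n (f n)"
    "\<And>n. \<exists>d\<in>S \<times> S. f (Suc n) = (fst (f n) + p ^ n * fst d, snd (f n) + p ^ n * snd d)" by blast
  then obtain d where d: "\<And>n. d n \<in> S \<times> S" "\<And>n. f (Suc n) = (fst (f n) + p ^ n * fst (d n), snd (f n) + p ^ n * snd (d n))"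
    by metis
  have lim: "\<exists>l\<in>S. \<forall>n. near n l (h n)" if h: "h 0 \<in> S" "\<And>n. e n \<in> S" "\<And>n. h (Suc n) = h n + p ^ n * e n" for h e
  proof -
    have hn: "h n = h 0 + (\<Sum>i<n. p ^ i * e i)" for n by (induction n) (simp_all add: h(3) add.assoc)
    obtain l where l: "l \<in> S" "\<forall>n. \<exists>y\<in>S. l = (\<Sum>i<n. p ^ i * e i) + p ^ n * y" using mspan_complete[OF finV, of e] h(2) by blast
    have "near n (h 0 + l) (h n)" for n
    proof -
      obtain y where y: "y \<in> S" "l = (\<Sum>i<n. p ^ i * e i) + p ^ n * y" using l(2) by blast
      have "h 0 + l - h n = p ^ n * y" unfolding hn[of n] using y(2) by (simp add: algebra_simps)
      then show ?thesis using y(1) unfolding near_def by blast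
    qed
    moreover have "h 0 + l \<in> S" using h(1) l(1) by (rule S.Sadd)
    ultimately show ?thesis by blast
  qed
  have dS: "fst (d n) \<in> S" "snd (d n) \<in> S" for n using d(1)[of n] by auto
  have f0: "fst (f 0) \<in> S" "snd (f 0) \<in> S" using f(1)[of 0] unfolding P_def by blast+
  obtain a where a: "a \<in> S" "\<And>n. near n a (fst (f n))"
    using lim[of "\<lambda>n. fst (f n)" "\<lambda>n. fst (d n)", OF f0(1) dS(1)] by (auto simp: d(2))
  obtain b where b: "b \<in> S" "\<And>n. near n b (snd (f n))"
    using lim[of "\<lambda>n. snd (f n)" "\<lambda>n. snd (d n)", OF f0(2) dS(2)] by (auto simp: d(2))
  have uv: "\<exists>u v. primitive u \<and> primitive v \<and> near n u a \<and> near n v b \<and> near n (u * v) 0" for n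
  proof -
    obtain u v where "primitive u" "primitive v" "near n u (fst (f n))" "near n v (snd (f n))" "near n (u * v) 0"
      using f(1)[of n] unfolding P_def B_def by blast
    then show ?thesis using a(2)[of n] b(2)[of n] near_sym near_trans by blast
  qed
  \<comment> \<open>Agreement modulo \<open>p\<close> is enough to carry primitivity over to the
    limits \<open>a\<close> and \<open>b\<close>.\<close>
  obtain u v where "primitive u" "primitive v" "near (Suc 0) u a" "near (Suc 0) v b" using uv by blast
  then have "primitive a" "primitive b" using primitive_near near_sym by blast+
  then have "a \<noteq> 0" "b \<noteq> 0" unfolding primitive_def using mspan_zero by auto
  moreover have "near n (a * b) 0" for n
  proof -
    obtain u v where u: "primitive u" "primitive v" "near n u a" "near n v b" "near n (u * v) 0" using uv by blast
    have "near n (a * b) (u * b)" using near_mult[OF near_sym[OF u(3)] b(1)] .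
    moreover have "near n (b * u) (v * u)" using near_mult[OF near_sym[OF u(4)]] u(1) unfolding primitive_def by blast
    ultimately show ?thesis using u(5) near_trans by (metis mult.commute)
  qed
  then have "a * b = 0" using S_separated S_L a(1) b(1) S.Smult by blast
  ultimately show False by simp
qed

lemma normalize:
  assumes "x \<in> L" "x \<noteq> 0"
  shows "\<exists>m::int. \<exists>u. primitive u \<and> x = p powi m * u"
proof -
  obtain n where n: "p ^ n * x \<in> S" using absorb assms by blast
  define y where "y = p ^ n * x"
  have y: "y \<in> S" "y \<noteq> 0" using n assms(2) by (auto simp: y_def)
  have "\<exists>k. \<not> near k y 0" using S_separated[of y] S_L y by blast
  then have k: "\<not> near (LEAST k. \<not> near k y 0) y 0" by (rule LeastI_ex)
  define k where "k = (LEAST k. \<not> near k y 0)"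
  have "near 0 y 0" using y(1) unfolding near_def by simp
  then have "k \<noteq> 0" using k unfolding k_def[symmetric] by metis
  then obtain j where j: "k = Suc j" by (cases k) auto
  then have "near j y 0" using not_less_Least[of j "\<lambda>k. \<not> near k y 0"] unfolding k_def by auto
  then obtain u where u: "u \<in> S" "y = p ^ j * u" unfolding near_def by auto
  have "primitive u" unfolding primitive_def
  proof (intro conjI ballI u(1) notI)
    fix z assume z: "z \<in> S" "u = p * z"
    then have "y - 0 = p ^ k * z" using u j by simp
    then have "near k y 0" using z(1) unfolding near_def by blast
    then show False using k unfolding k_def[symmetric] by blast
  qed
  moreover have "x = p powi (int j - int n) * u"
    using u(2) unfolding y_def by (simp add: power_int_diff field_simps)
  ultimately show ?thesis by blast
qed

text \<open>Let \<open>m k\<close> and \<open>m' k\<close> be the exponents of \<open>p\<close> in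
  \<open>x ^ k\<close> and \<open>inverse x ^ k\<close>; their sum exceeds \<open>- s\<close>. If
  all \<open>m k\<close> are at least \<open>- s\<close>, the powers of \<open>x\<close> lie in the
  finitely generated module \<open>inverse p ^ s * S\<close>. Otherwise some \<open>m' k\<close> is
  positive, so a power of \<open>inverse x\<close> lies in \<open>S\<close>, and finitely many
  translates of \<open>S\<close> contain all the others.\<close>

lemma isint_total:
  assumes x: "x \<in> L" "x \<noteq> 0"
  shows "isint x \<or> isint (inverse x)"
proof -
  have Lp: "y \<in> L \<Longrightarrow> y ^ k \<in> L" for y k
    by (induction k) (use subL in \<open>auto simp: subfield_def\<close>)
  have xi: "inverse x \<in> L" using subL x unfolding subfield_def by blast
  obtain s where s: "\<And>u v. primitive u \<Longrightarrow> primitive v \<Longrightarrow> \<not> near s (u * v) 0" using primitive_product by blast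
  have "\<forall>k. \<exists>m u. primitive u \<and> x ^ k = p powi m * u" "\<forall>k. \<exists>m u. primitive u \<and> inverse x ^ k = p powi m * u"
    using normalize Lp x xi by simp_all
  then obtain m u m' u' where mu: "\<And>k. primitive (u k)" "\<And>k. x ^ k = p powi m k * u k"
    "\<And>k. primitive (u' k)" "\<And>k. inverse x ^ k = p powi m' k * u' k" by metis
  \<comment> \<open>Otherwise the product \<open>u k * u' k\<close>, which is \<open>p\<close> to
    the exponent \<open>- (m k + m' k)\<close>, would be divisible by \<open>p ^ s\<close>.\<close>
  have mm: "- (m k + m' k) < int s" for k
  proof (rule ccontr)
    assume "\<not> ?thesis"
    then have ge: "- (m k + m' k) \<ge> int s" by simp
    have "1 = x ^ k * inverse x ^ k" using x(2) by (simp add: power_inverse)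
    also have "\<dots> = p powi (m k + m' k) * (u k * u' k)" by (simp add: mu(2)[of k] mu(4)[of k] power_int_add)
    finally have "u k * u' k = p powi (- (m k + m' k))"
      using inverse_unique[of "p powi (m k + m' k)" "u k * u' k"] by (simp only: power_int_minus)
    also have "\<dots> = p ^ nat (- (m k + m' k))" using ge by (simp add: power_int_def)
    also have "nat (- (m k + m' k)) = s + (nat (- (m k + m' k)) - s)" using ge by simp
    finally have "u k * u' k - 0 = p ^ s * p ^ (nat (- (m k + m' k)) - s)" by (simp only: power_add diff_zero)
    then have "near s (u k * u' k) 0" unfolding near_def using S.Spower[OF pS] by blast
    then show False using s mu by blast
  qed
  have uS: "u k \<in> S" "u' k \<in> S" for k using mu(1,3)[of k] unfolding primitive_def by blast+
  show ?thesis
  proof (cases "\<forall>k. m k \<ge> - int s")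
    case True
    let ?W = "(\<lambda>v. inverse p ^ s * v) ` V"
    have "x ^ k \<in> msp ?W" for k
    proof -
      have "p ^ nat (m k + int s) * u k \<in> S" using uS by simp
      then have "inverse p ^ s * (p ^ nat (m k + int s) * u k) \<in> msp ?W"
        by (rule O.V.mspan_mult) (auto intro: O.V.mspan_base)
      moreover have "x ^ k = inverse p ^ s * (p ^ nat (m k + int s) * u k)"
      proof -
        have "p ^ nat (m k + int s) = p powi (m k + int s)" using True by (simp add: power_int_def add.commute)
        also have "\<dots> = p powi (m k) * p ^ s" by (simp add: power_int_add)
        finally show ?thesis by (simp add: mu(2)[of k] power_inverse)
      qed
      ultimately show ?thesis by simp
    qed
    then show ?thesis using isint_if_powers[of ?W x] finV by blast
  next
    case False
    then obtain k where k: "m k < - int s" by (meson not_less)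
    then have "m' k > 0" using mm[of k] by simp
    then have "inverse x ^ k = p ^ nat (m' k) * u' k" by (simp add: mu(4)[of k] power_int_def)
    then have wk: "inverse x ^ k \<in> S" using uS by simp
    \<comment> \<open>For \<open>k = 0\<close> the power is 1, and a negative exponent
      \<open>m 0\<close> would make \<open>u 0\<close> a multiple of \<open>p\<close>.\<close>
    have "k \<noteq> 0"
    proof
      assume "k = 0"
      then have "1 = p powi (m 0) * u 0" using mu(2)[of 0] by simp
      moreover have "p powi (m 0) = inverse (p ^ nat (- m 0))" using k \<open>k = 0\<close> by (simp add: power_int_def power_inverse)
      ultimately have "u 0 = p ^ nat (- m 0)" by (simp add: field_simps)
      also have "\<dots> = p * p ^ (nat (- m 0) - 1)" using k \<open>k = 0\<close> by (simp add: power_Suc[symmetric] del: power_Suc)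
      finally show False using mu(1)[of 0] S.Spower[OF pS] unfolding primitive_def by blast
    qed
    let ?W = "(\<lambda>(i,v). inverse x ^ i * v) ` ({..<k} \<times> V)"
    have "inverse x ^ n \<in> msp ?W" for n
    proof -
      have "(inverse x ^ k) ^ (n div k) \<in> S" using wk by (rule S.Spower)
      then have "inverse x ^ (n mod k) * (inverse x ^ k) ^ (n div k) \<in> msp ?W"
      proof (rule O.V.mspan_mult)
        fix v assume "v \<in> V"
        then have "(n mod k, v) \<in> {..<k} \<times> V" using \<open>k \<noteq> 0\<close> by simp
        then have "(\<lambda>(i,v). inverse x ^ i * v) (n mod k, v) \<in> ?W" by (rule imageI)
        then show "inverse x ^ (n mod k) * v \<in> msp ?W" unfolding prod.case by (rule O.V.mspan_base)
      qed
      then show ?thesis by (simp only: power_mult[symmetric] power_add[symmetric] mod_mult_div_eq)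
    qed
    moreover have "finite ?W" using finV by simp
    ultimately have "isint (inverse x)" by (intro isint_if_powers[of ?W])
    then show ?thesis by blast
  qed
qed

end

context local_field
begin

lemma valring_ext:
  assumes L: "finite_extension K L"
  shows "valring (ext_integers K absv L) L"
proof -
  have sL: "subfield L" "K \<subseteq> L" using L unfolding finite_extension_def by blast+
  obtain V where V: "finite V" "V \<subseteq> L" "1 \<in> V" "\<forall>u\<in>V. \<forall>v\<in>V. u * v \<in> msp V" "\<forall>x\<in>L. \<exists>n. p ^ n * x \<in> msp V"
    using ex_order_ring[OF L] by blast
  interpret order_ring K absv p L V
    using sL V by unfold_locales blast+
  show ?thesis
  proof
    show "0 \<in> ext_integers K absv L" "1 \<in> ext_integers K absv L"
      using sL(1) isint_Ok unfolding ext_integers_eq subfield_def by auto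
    show "x + y \<in> ext_integers K absv L" "x - y \<in> ext_integers K absv L" "x * y \<in> ext_integers K absv L"
      if "x \<in> ext_integers K absv L" "y \<in> ext_integers K absv L" for x y
      using that sL(1) isint_ring unfolding ext_integers_eq subfield_def by auto
    show "subfield L" by (rule sL)
    show "ext_integers K absv L \<subseteq> L" unfolding ext_integers_eq by blast
    show "x \<in> ext_integers K absv L \<or> inverse x \<in> ext_integers K absv L" if x: "x \<in> L" for x
    proof (cases "x = 0")
      case True
      then show ?thesis using isint_Ok[of 0] x unfolding ext_integers_eq by simp
    next
      case False
      have "inverse x \<in> L" using x sL(1) unfolding subfield_def by blast
      then show ?thesis using isint_total[OF x False] x unfolding ext_integers_eq by blast
    qed
  qed
qed

lemma ext_integers_K: "finite_extension K L \<Longrightarrow> x \<in> K \<Longrightarrow> x \<in> ext_integers K absv L \<longleftrightarrow> x \<in> Ok"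
  using isint_K isint_Ok unfolding ext_integers_eq finite_extension_def by blast

end

section \<open>Gorenstein orders\<close>

lemma mat_mult_zero [simp]: "(A::'a::semiring_1^2^2) ** 0 = 0" "0 ** A = 0"
  by (cases A rule: mk_cases; simp add: mk_zero del: zero_index)+

lemma mtrace_zero [simp]: "mtrace 0 = (0::'a::semiring_1)"
  by (simp add: mk_zero)

lemma tri_cyc: "tri j k i = tri i j (k::'a::comm_ring_1^2^2)"
  by (cases i rule: mk_cases; cases j rule: mk_cases; cases k rule: mk_cases) (simp add: tri_def comm_def algebra_simps)

lemma tri_alt [simp]: "tri i i k = 0" "tri i k k = 0" "tri i k i = (0::'a::comm_ring_1)"
  by (cases i rule: mk_cases; cases k rule: mk_cases; simp add: tri_def comm_def algebra_simps)+

lemma tri_one [simp]: "tri (mat 1) i k = 0" "tri i (mat 1) k = 0" "tri i k (mat 1) = (0::'a::comm_ring_1)"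
  by (cases i rule: mk_cases; cases k rule: mk_cases; simp add: tri_def comm_def mk_one algebra_simps)+

text \<open>A commutator has trace zero, so by Cayley-Hamilton its square is scalar. With the two
  product formulas that follow, this shows that products of the dual basis vectors fall back into
  the order once multiplied by \<open>D\<close>.\<close>

lemma comm_square: "comm i j ** comm i j = mscale (- dt (comm i j)) (mat 1 :: 'a::comm_ring_1^2^2)"
  by (cases i rule: mk_cases; cases j rule: mk_cases) (simp add: comm_def mk_one algebra_simps)

lemma comm_comm_mult:
  "comm j k ** comm k i = mscale (mtrace (j ** k ** comm k i)) (mat 1) - mscale (tri i j k) (k::'a::comm_ring_1^2^2)"
  by (cases i rule: mk_cases; cases j rule: mk_cases; cases k rule: mk_cases)
     (simp add: tri_def comm_def mk_one algebra_simps)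

lemma comm_comm_mult':
  "comm k i ** comm j k = mscale (mtrace (i ** k ** comm k j)) (mat 1) + mscale (tri i j k) (k::'a::comm_ring_1^2^2)"
  by (cases i rule: mk_cases; cases j rule: mk_cases; cases k rule: mk_cases)
     (simp add: tri_def comm_def mk_one algebra_simps)

lemma tri_prod_left: "tri (j ** k) j k = - dt (comm j (k::'a::comm_ring_1^2^2))"
  "tri (k ** j) j k = dt (comm j k)"
  by (cases j rule: mk_cases; cases k rule: mk_cases; simp add: tri_def comm_def algebra_simps)+

text \<open>The polarization at \<open>i\<close> and \<open>j\<close> of the quadratic form sending
  \<open>x\<close> to \<open>dt (comm x k)\<close>. It is written through values of the form at
  elements of the order, so a divisibility of all these values passes to it.\<close>

definition polar :: "'a::comm_ring_1^2^2 \<Rightarrow> 'a^2^2 \<Rightarrow> 'a^2^2 \<Rightarrow> 'a" where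
  "polar i j k = dt (comm j k) + dt (comm k i) - dt (comm (j - i) k)"

lemma tri_prod_diff:
  "tri i (j ** k) k - tri i (k ** j) k = polar i j (k::'a::comm_ring_1^2^2)"
  "tri i (j ** k) k - tri (i ** k) j k = polar i j k"
  "tri (i ** k) j k - tri (k ** i) j k = - polar i j k"
  by (cases i rule: mk_cases; cases j rule: mk_cases; cases k rule: mk_cases;
      simp add: polar_def tri_def comm_def algebra_simps)+

lemma tri_square: "tri i (j ** k) k + tri i (k ** j) k = mtrace k * tri i j (k::'a::comm_ring_1^2^2)"
  by (cases i rule: mk_cases; cases j rule: mk_cases; cases k rule: mk_cases)
     (simp add: tri_def comm_def algebra_simps)

text \<open>The counterpart of \<open>tri_cramer\<close> for trace-zero matrices: up to the factor
  \<open>tri i j k\<close> the three commutators are dual to \<open>i\<close>, \<open>j\<close>,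
  \<open>k\<close> under the trace pairing.\<close>

lemma dual_cramer:
  assumes "mtrace y = 0"
  shows "mscale (tri i j k) y = mscale (mtrace (y ** i)) (comm j k) + mscale (mtrace (y ** j)) (comm k i)
     + mscale (mtrace (y ** k)) (comm i (j::'a::comm_ring_1^2^2))"
proof -
  obtain a b c d where y: "y = mk a b c d" by (rule mk_cases)
  then have d: "d = - a" using assms by (simp add: eq_neg_iff_add_eq_0 add.commute)
  show ?thesis unfolding y d
    by (cases i rule: mk_cases; cases j rule: mk_cases; cases k rule: mk_cases)
       (simp add: tri_def comm_def algebra_simps)
qed

lemma tri_lin [simp]:
  fixes i j k :: "'a::comm_ring_1^2^2"
  shows "tri (lin i j k a b c d) j k = b * tri i j k"
    "tri i (lin i j k a b c d) k = c * tri i j k"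
    "tri i j (lin i j k a b c d) = d * tri i j k"
  unfolding lin_def by (simp_all add: tri_add tri_scale)

lemma lin_add: "lin i j k a b c d + lin i j k a' b' c' d' = lin i j k (a+a') (b+b') (c+c') (d+(d'::'a::comm_ring_1))"
  unfolding lin_def by (simp add: mscale_add_left algebra_simps)

lemma lin_scale: "mscale r (lin i j k a b c d) = lin i j k (r*a) (r*b) (r*c) (r*(d::'a::comm_ring_1))"
  unfolding lin_def by (simp add: mscale_add mscale_mscale)

lemma lin_eqs: "lin i j k 1 0 0 0 = mat 1" "lin i j k 0 1 0 0 = i" "lin i j k 0 0 1 0 = j"
  "lin i j k 0 0 0 1 = k" "lin i j k 0 0 0 0 = 0" "lin i j k a 0 0 0 = mscale a (mat 1)"
  unfolding lin_def by simp_all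

context local_field
begin

definition latt :: "'a^2^2 \<Rightarrow> 'a^2^2 \<Rightarrow> 'a^2^2 \<Rightarrow> ('a^2^2) set" where
  "latt i j k = {lin i j k a b c d | a b c d. a \<in> Ok \<and> b \<in> Ok \<and> c \<in> Ok \<and> d \<in> Ok}"

lemma lattI: "a \<in> Ok \<Longrightarrow> b \<in> Ok \<Longrightarrow> c \<in> Ok \<Longrightarrow> d \<in> Ok \<Longrightarrow> lin i j k a b c d \<in> latt i j k"
  unfolding latt_def by blast

lemma lattE:
  assumes "x \<in> latt i j k"
  obtains a b c d where "a \<in> Ok" "b \<in> Ok" "c \<in> Ok" "d \<in> Ok" "x = lin i j k a b c d"
  using assms unfolding latt_def by blast

lemma latt_mod: "is_mod Ok (latt i j k)"
  unfolding is_mod_def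
proof (intro conjI ballI)
  show "0 \<in> latt i j k" using lattI[of 0 0 0 0 i j k] by (simp add: lin_eqs)
  show "x + y \<in> latt i j k" if "x \<in> latt i j k" "y \<in> latt i j k" for x y
    using that by (elim lattE) (simp add: lin_add lattI)
  show "mscale c x \<in> latt i j k" if "c \<in> Ok" "x \<in> latt i j k" for c x
    using that(2) by (elim lattE) (simp add: lin_scale lattI that(1))
qed

lemma latt_gens: "mat 1 \<in> latt i j k" "i \<in> latt i j k" "j \<in> latt i j k" "k \<in> latt i j k"
  using lattI[of 1 0 0 0 i j k] lattI[of 0 1 0 0 i j k] lattI[of 0 0 1 0 i j k] lattI[of 0 0 0 1 i j k]
  by (simp_all add: lin_eqs)

lemma lin_in_mod:
  assumes "is_mod S M" "mat 1 \<in> M" "i \<in> M" "j \<in> M" "k \<in> M" "a \<in> S" "b \<in> S" "c \<in> S" "d \<in> S"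
  shows "lin i j k a b c d \<in> M"
  using assms unfolding is_mod_def lin_def by blast

lemma latt_least: "is_mod Ok M \<Longrightarrow> mat 1 \<in> M \<Longrightarrow> i \<in> M \<Longrightarrow> j \<in> M \<Longrightarrow> k \<in> M \<Longrightarrow> latt i j k \<subseteq> M"
  using lin_in_mod unfolding latt_def by blast

lemma mod_diff: "is_mod Ok M \<Longrightarrow> x \<in> M \<Longrightarrow> y \<in> M \<Longrightarrow> x - y \<in> M"
proof -
  assume M: "is_mod Ok M" and "x \<in> M" "y \<in> M"
  have "x - y = x + mscale (-1) y" by (cases x rule: mk_cases; cases y rule: mk_cases) simp
  moreover have "-1 \<in> Ok" by simp
  ultimately show ?thesis using M \<open>x \<in> M\<close> \<open>y \<in> M\<close> unfolding is_mod_def by metis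
qed

lemma latt_fin_gen: "fin_gen Ok (latt i j k)"
proof (rule O.V.fin_genI[of _ "{mat 1, i, j, k}"])
  show "latt i j k \<subseteq> lspan Ok {mat 1, i, j, k}"
    by (rule latt_least) (auto intro: O.V.lspan_is_mod lspan_base)
qed (use latt_mod latt_gens in auto)

lemma lin_K:
  assumes "i \<in> mats K" "j \<in> mats K" "k \<in> mats K" "tri i j k \<noteq> 0" "x \<in> mats K"
  shows "\<exists>a\<in>K. \<exists>b\<in>K. \<exists>c\<in>K. \<exists>d\<in>K. x = lin i j k a b c d"
proof -
  define D where "D = tri i j k"
  obtain s where s: "mscale D x = mscale s (mat 1) + mscale (tri x j k) i + mscale (tri i x k) j + mscale (tri i j x) k"
    using tri_cramer D_def by blast
  have "x = mscale (inverse D) (mscale D x)" using assms(4) by (simp add: mscale_mscale D_def)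
  also have "\<dots> = lin i j k (s / D) (tri x j k / D) (tri i x k / D) (tri i j x / D)"
    unfolding s lin_def by (simp add: mscale_add mscale_mscale divide_inverse mult.commute)
  finally have xe: "x = lin i j k (s / D) (tri x j k / D) (tri i x k / D) (tri i j x / D)" .
  have tK: "tri x j k / D \<in> K" "tri i x k / D \<in> K" "tri i j x / D \<in> K"
    using assms unfolding D_def by (auto intro!: O.Fdiv O.F.mats_tri)
  have "mscale (s / D) (mat 1) = x - (mscale (tri x j k / D) i + mscale (tri i x k / D) j + mscale (tri i j x / D) k)"
    by (subst (1) xe) (simp add: lin_def algebra_simps)
  also have "\<dots> \<in> mats K" using assms tK by simp
  finally have "s / D \<in> K" by (simp add: mk_one)
  then show ?thesis using xe tK by blast
qed

lemma latt_span:
  assumes "i \<in> mats K" "j \<in> mats K" "k \<in> mats K" "tri i j k \<noteq> 0" "latt i j k \<subseteq> M" "M \<subseteq> mats K"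
  shows "lspan K M = mats K"
proof
  show "lspan K M \<subseteq> mats K" using assms(6) by (rule lspan_least[OF O.F.mats_is_mod])
  show "mats K \<subseteq> lspan K M"
  proof
    fix x assume "x \<in> mats K"
    then obtain a b c d where abcd: "a \<in> K" "b \<in> K" "c \<in> K" "d \<in> K" "x = lin i j k a b c d"
      using lin_K[OF assms(1-4)] by blast
    have g: "y \<in> latt i j k \<Longrightarrow> y \<in> lspan K M" for y using assms(5) by (intro lspan_base) auto
    show "x \<in> lspan K M" unfolding abcd(5)
      by (rule lin_in_mod[OF O.F.lspan_is_mod]) (use abcd g latt_gens in auto)
  qed
qed

lemma latt_order:
  assumes K: "i \<in> mats K" "j \<in> mats K" "k \<in> mats K" and D: "tri i j k \<noteq> 0"
    and prod: "\<And>x y. x \<in> {i,j,k} \<Longrightarrow> y \<in> {i,j,k} \<Longrightarrow> x ** y \<in> latt i j k"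
  shows "full_order K absv (latt i j k)"
proof -
  let ?L = "latt i j k"
  have sub: "?L \<subseteq> mats K"
    by (rule latt_least) (use K in \<open>auto intro: O.mod_VF O.F.mats_is_mod\<close>)
  have M1: "is_mod Ok {x. x ** y \<in> ?L}" for y
    using latt_mod[of i j k] unfolding is_mod_def by (auto simp: mat_lin)
  have M2: "is_mod Ok {y. x ** y \<in> ?L}" for x
    using latt_mod[of i j k] unfolding is_mod_def by (auto simp: mat_lin)
  have g: "x ** y \<in> ?L" if "x \<in> {mat 1, i, j, k}" "y \<in> {mat 1, i,j,k}" for x y
    using that prod latt_gens by auto
  have "x ** y \<in> ?L" if "x \<in> {mat 1,i,j,k}" "y \<in> ?L" for x y
    using latt_least[OF M2[of x], of i j k] g that by blast
  then have mult: "x ** y \<in> ?L" if "x \<in> ?L" "y \<in> ?L" for x y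
    using latt_least[OF M1[of y], of i j k] that by blast
  have "is_order Ok K ?L"
    unfolding is_order_def
  proof (intro conjI ballI)
    show "x + y \<in> ?L" if "x \<in> ?L" "y \<in> ?L" for x y using latt_mod that unfolding is_mod_def by blast
    show "x - y \<in> ?L" if "x \<in> ?L" "y \<in> ?L" for x y using mod_diff[OF latt_mod] that by blast
  qed (use sub mult in \<open>auto intro: latt_gens latt_fin_gen\<close>)
  moreover have "lspan K ?L = mats K" using latt_span[OF K D] sub by blast
  ultimately show ?thesis unfolding full_order_def full_order_over_def by blast
qed

lemma full_orderD:
  assumes "full_order K absv R"
  shows "is_order Ok K R" "R \<subseteq> mats K" "mat 1 \<in> R" "is_mod Ok R" "lspan K R = mats K"
    "\<And>x y. x \<in> R \<Longrightarrow> y \<in> R \<Longrightarrow> x + y \<in> R" "\<And>x y. x \<in> R \<Longrightarrow> y \<in> R \<Longrightarrow> x - y \<in> R"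
    "\<And>x y. x \<in> R \<Longrightarrow> y \<in> R \<Longrightarrow> x ** y \<in> R" "\<And>c x. c \<in> Ok \<Longrightarrow> x \<in> R \<Longrightarrow> mscale c x \<in> R"
    "\<And>x. x \<in> R \<Longrightarrow> mtrace x \<in> Ok" "\<And>x. x \<in> R \<Longrightarrow> dt x \<in> Ok" "\<And>c. c \<in> Ok \<Longrightarrow> mscale c (mat 1) \<in> R"
    "\<And>x y. x \<in> R \<Longrightarrow> y \<in> R \<Longrightarrow> comm x y \<in> R"
proof -
  have o: "is_order Ok K R" and s: "lspan K R = mats K"
    using assms unfolding full_order_def full_order_over_def by auto
  have m: "is_mod Ok R" using O.order_mod[OF o] .
  note u = o[unfolded is_order_def] m[unfolded is_mod_def]
  show "is_order Ok K R" "R \<subseteq> mats K" "mat 1 \<in> R" "is_mod Ok R" "lspan K R = mats K"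
    using u m s o by blast+
  show "\<And>x y. x \<in> R \<Longrightarrow> y \<in> R \<Longrightarrow> x + y \<in> R" "\<And>x y. x \<in> R \<Longrightarrow> y \<in> R \<Longrightarrow> x - y \<in> R"
    "\<And>x y. x \<in> R \<Longrightarrow> y \<in> R \<Longrightarrow> x ** y \<in> R" "\<And>c x. c \<in> Ok \<Longrightarrow> x \<in> R \<Longrightarrow> mscale c x \<in> R"
    "\<And>c. c \<in> Ok \<Longrightarrow> mscale c (mat 1) \<in> R" using u by blast+
  then show "\<And>x y. x \<in> R \<Longrightarrow> y \<in> R \<Longrightarrow> comm x y \<in> R" unfolding comm_def by blast
  show "\<And>x. x \<in> R \<Longrightarrow> mtrace x \<in> Ok" "\<And>x. x \<in> R \<Longrightarrow> dt x \<in> Ok" using O.order_integral[OF o] by blast+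
qed

lemma full_order_latt:
  assumes "full_order K absv R"
  shows "\<exists>i j k. i \<in> mats K \<and> j \<in> mats K \<and> k \<in> mats K \<and> tri i j k \<noteq> 0 \<and> R = latt i j k"
proof -
  obtain i j k where ijk: "i \<in> R" "j \<in> R" "k \<in> R" "tri i j k \<noteq> 0"
    and c: "\<forall>x\<in>R. \<exists>a\<in>Ok. \<exists>b\<in>Ok. \<exists>c\<in>Ok. \<exists>d\<in>Ok. x = lin i j k a b c d"
    using O.full_order_basis[OF assms[unfolded full_order_def]] by (elim bexE conjE)
  have "R \<subseteq> latt i j k"
  proof
    fix x assume "x \<in> R"
    with c have "\<exists>a\<in>Ok. \<exists>b\<in>Ok. \<exists>c\<in>Ok. \<exists>d\<in>Ok. x = lin i j k a b c d" by (rule bspec)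
    then show "x \<in> latt i j k" by (elim bexE) (simp add: lattI)
  qed
  moreover have "latt i j k \<subseteq> R" using latt_least[OF full_orderD(4,3)[OF assms] ijk(1-3)] .
  ultimately show ?thesis using ijk full_orderD(2)[OF assms] by blast
qed

lemma latt_expand:
  assumes "x \<in> latt i j k" "D = tri i j k" "D \<noteq> 0"
  shows "\<exists>a\<in>Ok. x = lin i j k a (tri x j k / D) (tri i x k / D) (tri i j x / D)"
  using assms by (auto elim!: lattE)

end

section \<open>The codifferent in terms of a basis\<close>

locale full_order_basis = local_field +
  fixes R i j k
  assumes fullR: "full_order K absv R" and ijkK: "i \<in> mats K" "j \<in> mats K" "k \<in> mats K"
    and D0: "tri i j k \<noteq> 0" and Rl: "R = latt i j k"
begin

definition "D = tri i j k"

lemma Dnz [simp]: "D \<noteq> 0" using D0 by (simp add: D_def)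

lemma DK: "D \<in> K" unfolding D_def using ijkK by simp

lemmas Rd = full_orderD[OF fullR]

lemma ijkR: "i \<in> R" "j \<in> R" "k \<in> R" unfolding Rl by (rule latt_gens)+

text \<open>Cyclic permutations of \<open>i\<close>, \<open>j\<close>, \<open>k\<close> preserve the
  setting and the value of \<open>D\<close>; each computation is made in one position and carried
  over to the other two.\<close>

lemma rotate: "full_order_basis K absv p R j k i"
proof
  show "tri j k i \<noteq> 0" using D0 by (simp add: tri_cyc)
  show "R = latt j k i" unfolding Rl by (intro equalityI latt_least latt_mod latt_gens)
qed (use fullR ijkK in auto)

abbreviation "Cd \<equiv> codifferent K absv R"

lemma Cd_iff: "x \<in> Cd \<longleftrightarrow> x \<in> mats K \<and> (\<forall>r\<in>R. mtrace (x ** r) \<in> Ok)"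
  unfolding codifferent_def by blast

lemma Cd_mod: "is_mod Ok Cd"
proof -
  show ?thesis unfolding is_mod_def by (auto simp: Cd_iff mat_lin)
qed

lemma Cd_mult:
  assumes "x \<in> Cd" "r \<in> R"
  shows "r ** x \<in> Cd" "x ** r \<in> Cd"
proof -
  have K: "x \<in> mats K" "r \<in> mats K" using assms Rd(2) Cd_iff by auto
  have "mtrace (r ** x ** s) = mtrace (x ** (s ** r))" for s
    by (metis matrix_mul_assoc mtrace_mult_commute)
  then show "r ** x \<in> Cd" "x ** r \<in> Cd" using assms K Rd(8) unfolding Cd_iff
    by (simp_all add: matrix_mul_assoc[symmetric])
qed

text \<open>The quotient is the determinant of the coordinates of \<open>a\<close>,
  \<open>b\<close>, \<open>c\<close> modulo scalars with respect to \<open>i\<close>,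
  \<open>j\<close>, \<open>k\<close>.\<close>

lemma tri_div_D:
  assumes "a \<in> R" "b \<in> R" "c \<in> R"
  shows "tri a b c / D \<in> Ok"
proof -
  have M: "is_mod Ok {x. tri x b c / D \<in> Ok}" "is_mod Ok {x. tri a x c / D \<in> Ok}" "is_mod Ok {x. tri a b x / D \<in> Ok}" for a b c
    unfolding is_mod_def
    by (simp_all add: tri_add tri_scale tri_zero add_divide_distrib times_divide_eq_right[symmetric] del: times_divide_eq_right)
  have neg: "tri b a c = - tri a b c" for a b c :: "'a^2^2"
    by (cases a rule: mk_cases; cases b rule: mk_cases; cases c rule: mk_cases) (simp add: tri_def comm_def algebra_simps)
  have b: "tri u v w / D \<in> Ok" if "u \<in> {i,j,k}" "v \<in> {i,j,k}" "w \<in> {i,j,k}" for u v w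
  proof -
    have e: "tri i j k / D \<in> Ok" "tri j k i / D \<in> Ok" "tri k i j / D \<in> Ok"
      using tri_cyc[of i j k] tri_cyc[of j k i] by (simp_all add: D_def[symmetric])
    have "tri j i k / D = - (tri i j k / D)" "tri k j i / D = - (tri j k i / D)" "tri i k j / D = - (tri k i j / D)"
      by (simp_all only: neg[of i j k] neg[of j k i] neg[of k i j] minus_divide_left minus_minus)
    then have "tri j i k / D \<in> Ok" "tri k j i / D \<in> Ok" "tri i k j / D \<in> Ok"
      using e O.V.Suminus by metis+
    then show ?thesis using e that by auto
  qed
  have "tri u v w / D \<in> Ok" if "u \<in> R" "v \<in> {i,j,k}" "w \<in> {i,j,k}" for u v w
    using latt_least[OF M(1)[of v w], of i j k] b that unfolding Rl by auto
  then have "tri u v w / D \<in> Ok" if "u \<in> R" "v \<in> R" "w \<in> {i,j,k}" for u v w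
    using latt_least[OF M(2)[of u w], of i j k] that unfolding Rl by auto
  then show ?thesis
    using latt_least[OF M(3)[of a b], of i j k] assms unfolding Rl by auto
qed

lemma comm_D_Cd:
  assumes "a \<in> R" "b \<in> R"
  shows "mscale (inverse D) (comm a b) \<in> Cd"
  unfolding Cd_iff
proof (intro conjI ballI)
  have "a \<in> mats K" "b \<in> mats K" using assms Rd(2) by auto
  then show "mscale (inverse D) (comm a b) \<in> mats K" using DK by simp
  fix r assume r: "r \<in> R"
  have "mtrace (mscale (inverse D) (comm a b) ** r) = tri r a b / D"
    unfolding tri_def mscale_mult_left mtrace_scale by (simp add: mtrace_mult_commute[of _ r] divide_inverse)
  then show "mtrace (mscale (inverse D) (comm a b) ** r) \<in> Ok" using tri_div_D r assms by simp
qed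

text \<open>\<open>v1\<close>, \<open>v2\<close>, \<open>v3\<close> are dual to \<open>i\<close>,
  \<open>j\<close>, \<open>k\<close> under the trace pairing and orthogonal to
  \<open>mat 1\<close>.\<close>

definition "v1 = mscale (inverse D) (comm j k)"
definition "v2 = mscale (inverse D) (comm k i)"
definition "v3 = mscale (inverse D) (comm i j)"

lemma v_Cd: "v1 \<in> Cd" "v2 \<in> Cd" "v3 \<in> Cd"
  unfolding v1_def v2_def v3_def using comm_D_Cd ijkR by blast+

lemma mtrace_v: "mtrace (v1 ** x) = tri x j k / D" "mtrace (v2 ** x) = tri i x k / D" "mtrace (v3 ** x) = tri i j x / D"
  using tri_cyc[of i x k] tri_cyc[of i j x] tri_cyc[of j x i] tri_cyc[of x k i]
  unfolding v1_def v2_def v3_def tri_def mscale_mult_left mtrace_scale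
  by (simp_all add: mtrace_mult_commute[of _ x] divide_inverse)

lemma tri_ijk: "tri i j k = D" by (simp add: D_def)

text \<open>Subtracting a multiple of \<open>w\<close> leaves trace zero, where
  \<open>dual_cramer\<close> applies. The element \<open>w\<close> of trace 1 is kept arbitrary
  because \<open>Cd_Cd\<close> makes different choices on its two sides.\<close>

lemma Cd_expand:
  assumes w: "w \<in> Cd" "mtrace w = 1" and x: "x \<in> Cd"
  shows "\<exists>t\<in>Ok. \<exists>a\<in>Ok. \<exists>b\<in>Ok. \<exists>c\<in>Ok. x = mscale t w + (mscale a v1 + mscale b v2 + mscale c v3)"
proof -
  define t where "t = mtrace x"
  have "mtrace (x ** mat 1) \<in> Ok" using x Rd(3) Cd_iff by blast
  then have t: "t \<in> Ok" by (simp add: t_def)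
  define y where "y = x - mscale t w"
  have y: "y \<in> Cd" using x w t Cd_mod mod_diff[OF Cd_mod] unfolding y_def is_mod_def by blast
  have "mtrace y = 0" by (simp add: y_def t_def w mtrace_diff mtrace_scale)
  from dual_cramer[OF this, of i j k]
  have "mscale D y = mscale (mtrace (y ** i)) (comm j k) + mscale (mtrace (y ** j)) (comm k i) + mscale (mtrace (y ** k)) (comm i j)"
    by (simp add: D_def)
  then have "mscale (inverse D) (mscale D y) = mscale (mtrace (y ** i)) v1 + mscale (mtrace (y ** j)) v2 + mscale (mtrace (y ** k)) v3"
    unfolding v1_def v2_def v3_def by (simp add: mscale_add mscale_mscale mult.commute)
  then have ye: "y = mscale (mtrace (y ** i)) v1 + mscale (mtrace (y ** j)) v2 + mscale (mtrace (y ** k)) v3"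
    by (simp add: mscale_mscale)
  have "mtrace (y ** i) \<in> Ok" "mtrace (y ** j) \<in> Ok" "mtrace (y ** k) \<in> Ok" using y ijkR unfolding Cd_iff by blast+
  moreover have "x = mscale t w + y" by (simp add: y_def)
  ultimately show ?thesis using t ye by metis
qed

lemma Cd_fin_gen: "fin_gen Ok Cd"
proof -
  let ?w = "v1 ** i"
  have w: "?w \<in> Cd" "mtrace ?w = 1" using Cd_mult v_Cd ijkR by (simp_all add: mtrace_v tri_ijk)
  show ?thesis
  proof (rule O.V.fin_genI[of _ "{?w, v1, v2, v3}"])
    show "Cd \<subseteq> lspan Ok {?w, v1, v2, v3}"
    proof
      fix x assume "x \<in> Cd"
      then obtain t a b c where "t \<in> Ok" "a \<in> Ok" "b \<in> Ok" "c \<in> Ok" "x = mscale t ?w + (mscale a v1 + mscale b v2 + mscale c v3)"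
        using Cd_expand[OF w] by blast
      moreover have "g \<in> {?w, v1, v2, v3} \<Longrightarrow> g \<in> lspan Ok {?w, v1, v2, v3}" for g by (rule lspan_base) simp_all
      ultimately show "x \<in> lspan Ok {?w, v1, v2, v3}"
        using O.V.lspan_is_mod[of "{?w, v1, v2, v3}"] unfolding is_mod_def by (metis insertCI)
    qed
  qed (use Cd_mod w v_Cd in auto)
qed

lemma R_Cd: "R \<subseteq> Cd"
  unfolding subset_iff Cd_iff using Rd(2,8,10) by blast

lemma Cd_frac_ideal: "frac_ideal K absv R Cd"
proof -
  have "lspan K Cd = mats K"
    by (rule latt_span[OF ijkK D0]) (use R_Cd Rl Cd_iff in auto)
  then show ?thesis unfolding frac_ideal_def using Cd_fin_gen Cd_mult by (auto simp: Cd_iff)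
qed

lemma D_v11: "mscale D (v1 ** v1) \<in> R"
proof -
  have "mscale D (v1 ** v1) = mscale (tri (j ** k) j k / D) (mat 1)"
    unfolding v1_def mscale_mult_left mscale_mult_right comm_square mscale_mscale tri_prod_left
    by (simp add: field_simps)
  then show ?thesis using tri_div_D[of "j ** k" j k] ijkR Rd(8,12) by simp
qed

lemma D_v12: "mscale D (v1 ** v2) \<in> R"
proof -
  have "mscale D (v1 ** v2) = mscale (tri (j ** k) k i / D) (mat 1) - k"
    unfolding v1_def v2_def mscale_mult_left mscale_mult_right comm_comm_mult mscale_mscale mscale_diff tri_ijk
    by (simp add: field_simps tri_def)
  then show ?thesis using tri_div_D[of "j ** k" k i] ijkR Rd(7,8,12) by simp
qed

lemma D_v21: "mscale D (v2 ** v1) \<in> R"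
proof -
  have "mscale D (v2 ** v1) = mscale (tri (i ** k) k j / D) (mat 1) + k"
    unfolding v1_def v2_def mscale_mult_left mscale_mult_right comm_comm_mult' mscale_mscale mscale_add tri_ijk
    by (simp add: field_simps tri_def)
  then show ?thesis using tri_div_D[of "i ** k" k j] ijkR Rd(6,8,12) by simp
qed

lemma D_vv:
  assumes "x \<in> {v1,v2,v3}" "y \<in> {v1,v2,v3}"
  shows "mscale D (x ** y) \<in> R"
proof -
  interpret B: full_order_basis K absv p R j k i by (rule rotate)
  interpret C: full_order_basis K absv p R k i j by (rule B.rotate)
  have D: "B.D = D" "C.D = D" using tri_cyc[of i j k] tri_cyc[of j k i] unfolding B.D_def C.D_def D_def by simp_all
  have "B.v1 = v2" "B.v2 = v3" "C.v1 = v3" "C.v2 = v1"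
    unfolding B.v1_def B.v2_def C.v1_def C.v2_def v1_def v2_def v3_def D by simp_all
  then show ?thesis using assms D_v11 D_v12 D_v21 B.D_v11 B.D_v12 B.D_v21 C.D_v11 C.D_v12 C.D_v21
    unfolding D by auto
qed

text \<open>The trace-one generator is taken as \<open>i ** v1\<close> on the left and as
  \<open>v1 ** i\<close> on the right. The outer factors \<open>i\<close> then pull out of every
  product, and only products of the dual vectors remain, which are covered by
  \<open>D_vv\<close>.\<close>

lemma Cd_Cd:
  assumes "x \<in> Cd" "y \<in> Cd"
  shows "mscale D (x ** y) \<in> R"
proof -
  have M1: "is_mod Ok {x. mscale D (x ** y) \<in> R}" and M2: "is_mod Ok {x. mscale D (y ** x) \<in> R}" for y
    using Rd(4) unfolding is_mod_def by (auto simp: mat_lin mult.commute[of D]) (auto simp: mscale_mscale[symmetric] mk_zero)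
  let ?w = "i ** v1" and ?w' = "v1 ** i"
  have w: "?w \<in> Cd" "mtrace ?w = 1" "?w' \<in> Cd" "mtrace ?w' = 1"
    using Cd_mult v_Cd ijkR by (simp_all add: mtrace_mult_commute[of i] mtrace_v tri_ijk)
  have V: "mscale D (a ** b) \<in> R" if "a \<in> {?w, v1, v2, v3}" "b \<in> {?w', v1, v2, v3}" for a b
  proof -
    have e: "mscale D (i ** v1 ** (v1 ** i)) = i ** mscale D (v1 ** v1) ** i"
      "mscale D (i ** v1 ** b) = i ** mscale D (v1 ** b)" "mscale D (a ** (v1 ** i)) = mscale D (a ** v1) ** i" for a b
      by (simp_all add: mat_lin matrix_mul_assoc)
    show ?thesis using that D_vv ijkR Rd(8) by (auto simp: e)
  qed
  obtain t a b c where x: "t \<in> Ok" "a \<in> Ok" "b \<in> Ok" "c \<in> Ok" "x = mscale t ?w + (mscale a v1 + mscale b v2 + mscale c v3)"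
    using Cd_expand[OF w(1,2) assms(1)] by blast
  obtain t' a' b' c' where y: "t' \<in> Ok" "a' \<in> Ok" "b' \<in> Ok" "c' \<in> Ok" "y = mscale t' ?w' + (mscale a' v1 + mscale b' v2 + mscale c' v3)"
    using Cd_expand[OF w(3,4) assms(2)] by blast
  have comb: "mscale t e + (mscale a f + (mscale b g) + mscale c h) \<in> M"
    if "is_mod Ok M" "e \<in> M" "f \<in> M" "g \<in> M" "h \<in> M" "t \<in> Ok" "a \<in> Ok" "b \<in> Ok" "c \<in> Ok" for M e f g h t a b c
    using that unfolding is_mod_def by simp
  have xb: "mscale D (x ** b) \<in> R" if "b \<in> {?w', v1, v2, v3}" for b
  proof -
    have "x \<in> {x. mscale D (x ** b) \<in> R}"
      unfolding x(5) using V[OF _ that] x(1-4) by (intro comb[OF M1]) simp_all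
    then show ?thesis by simp
  qed
  have "y \<in> {y. mscale D (x ** y) \<in> R}"
    unfolding y(5) using xb y(1-4) by (intro comb[OF M2]) simp_all
  then show ?thesis by simp
qed

text \<open>The element \<open>v = [a,b]/D\<close> of the codifferent satisfies
  \<open>D v^2 = -d\<close> with \<open>d = dt (comm a b) / D\<close>. When \<open>d\<close> is a
  unit, \<open>v\<close> has an inverse in \<open>J = D Cd\<close>. Hence each \<open>r\<close> in
  \<open>R\<close> is a product of an element of the codifferent and one of \<open>J\<close>, while
  \<open>Cd_Cd\<close> keeps all such products inside \<open>R\<close>.\<close>

lemma gorenstein_if_unit:
  assumes ab: "a \<in> R" "b \<in> R" and u: "\<not> O.vle (dt (comm a b) / D) p"
  shows "gorenstein K absv R"
proof -
  define v where "v = mscale (inverse D) (comm a b)"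
  define d where "d = dt (comm a b) / D"
  have vC: "v \<in> Cd" unfolding v_def using comm_D_Cd ab by blast
  have vv: "mscale D (v ** v) = mscale (- d) (mat 1)"
    unfolding v_def mscale_mult_left mscale_mult_right comm_square mscale_mscale d_def by (simp add: field_simps)
  have "mscale (-d) (mat 1) \<in> R" using Cd_Cd[OF vC vC] vv by simp
  moreover have "a \<in> mats K" "b \<in> mats K" using ab Rd(2) by auto
  then have "d \<in> K" unfolding d_def using DK by simp
  ultimately have "-d \<in> Ok" using O.scalar_in_order[OF Rd(1), of "-d"] by simp
  then have "- (-d) \<in> Ok" by (rule O.V.Suminus)
  then have dO: "d \<in> Ok" by simp
  then have du: "d \<noteq> 0" "inverse d \<in> Ok" using unit_iff[OF dO] u unfolding d_def by blast+
  define J where "J = {mscale D x | x. x \<in> Cd}"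
  have J: "frac_ideal K absv R J"
    unfolding frac_ideal_def
  proof (intro conjI ballI)
    show "J \<subseteq> mats K" using DK Cd_iff unfolding J_def by auto
    have Jm: "is_mod Ok J"
    proof -
      have "0 = mscale D 0" by simp
      then have "0 \<in> J" using Cd_mod unfolding J_def is_mod_def by blast
      moreover have "mscale D x + mscale D y = mscale D (x + y)" for x y by (simp add: mscale_add)
      moreover have "mscale c (mscale D x) = mscale D (mscale c x)" for c x by (simp add: mscale_mscale mult.commute)
      ultimately show ?thesis using Cd_mod unfolding is_mod_def J_def by auto
    qed
    obtain G where G: "finite G" "G \<subseteq> Cd" "Cd = lspan Ok G" using Cd_fin_gen unfolding fin_gen_def by blast
    show "fin_gen Ok J"
    proof (rule O.V.fin_genI[OF Jm, of "mscale D ` G"])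
      show "finite (mscale D ` G)" "mscale D ` G \<subseteq> J" using G unfolding J_def by auto
      have "is_mod Ok {x. mscale D x \<in> lspan Ok (mscale D ` G)}"
        using O.V.lspan_is_mod[of "mscale D ` G"] unfolding is_mod_def
        by (simp add: mscale_add mscale_mscale mult.commute[of D]) (simp add: mscale_mscale[symmetric])
      moreover have "G \<subseteq> {x. mscale D x \<in> lspan Ok (mscale D ` G)}" by (auto intro: lspan_base)
      ultimately have "Cd \<subseteq> {x. mscale D x \<in> lspan Ok (mscale D ` G)}" using lspan_least G(3) by metis
      then show "J \<subseteq> lspan Ok (mscale D ` G)" unfolding J_def by blast
    qed
    show "lspan K J = mats K"
    proof
      show "lspan K J \<subseteq> mats K" using \<open>J \<subseteq> mats K\<close> by (rule lspan_least[OF O.F.mats_is_mod])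
      have "Cd \<subseteq> lspan K J"
      proof
        fix x assume "x \<in> Cd"
        then have "mscale D x \<in> lspan K J" unfolding J_def by (intro lspan_base) auto
        then have "mscale (inverse D) (mscale D x) \<in> lspan K J"
          using O.F.lspan_is_mod[of J] DK unfolding is_mod_def by auto
        then show "x \<in> lspan K J" by (simp add: mscale_mscale)
      qed
      then have "lspan K Cd \<subseteq> lspan K J" using lspan_least[OF O.F.lspan_is_mod] by blast
      then show "mats K \<subseteq> lspan K J" using Cd_frac_ideal unfolding frac_ideal_def by blast
    qed
    show "r ** x \<in> J" "x ** r \<in> J" if "r \<in> R" "x \<in> J" for r x
    proof -
      obtain y where y: "y \<in> Cd" "x = mscale D y" using \<open>x \<in> J\<close> unfolding J_def by blast
      then show "r ** x \<in> J" "x ** r \<in> J" unfolding J_def using Cd_mult[OF y(1) \<open>r \<in> R\<close>]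
        by (auto simp: mat_lin)
    qed
  qed
  have l: "lprod Ok X Y = R" if le: "\<And>x y. x \<in> X \<Longrightarrow> y \<in> Y \<Longrightarrow> x ** y \<in> R"
    and ex: "\<And>r. r \<in> R \<Longrightarrow> \<exists>x\<in>X. \<exists>y\<in>Y. r = x ** y" for X Y
  proof
    show "lprod Ok X Y \<subseteq> R" unfolding lprod_def using le by (intro lspan_least Rd(4)) auto
    show "R \<subseteq> lprod Ok X Y"
    proof
      fix r assume "r \<in> R"
      then obtain x y where "x \<in> X" "y \<in> Y" "r = x ** y" using ex by blast
      then show "r \<in> lprod Ok X Y" unfolding lprod_def by (intro lspan_base) auto
    qed
  qed
  let ?v = "mscale (- inverse d) v"
  have vI: "?v \<in> Cd" using vC du Cd_mod unfolding is_mod_def by simp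
  have one: "v ** mscale D ?v = mat 1" "mscale D ?v ** v = mat 1"
  proof -
    have "v ** mscale D ?v = mscale (- inverse d) (mscale D (v ** v))" "mscale D ?v ** v = mscale (- inverse d) (mscale D (v ** v))"
      by (simp_all add: mat_lin mult.commute)
    then show "v ** mscale D ?v = mat 1" "mscale D ?v ** v = mat 1" unfolding vv using du by (simp_all add: mscale_mscale)
  qed
  have "lprod Ok Cd J = R"
  proof (rule l)
    show "x ** y \<in> R" if "x \<in> Cd" "y \<in> J" for x y
      using that Cd_Cd[of x] unfolding J_def by (auto simp: mat_lin)
    show "\<exists>x\<in>Cd. \<exists>y\<in>J. r = x ** y" if "r \<in> R" for r
    proof (intro bexI)
      show "r = (r ** v) ** mscale D ?v" using one(1) by (simp add: matrix_mul_assoc[symmetric])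
      show "mscale D ?v \<in> J" using vI unfolding J_def by blast
      show "r ** v \<in> Cd" using Cd_mult vC that by blast
    qed
  qed
  moreover have "lprod Ok J Cd = R"
  proof (rule l)
    show "x ** y \<in> R" if "x \<in> J" "y \<in> Cd" for x y
      using that Cd_Cd[of _ y] unfolding J_def by (auto simp: mat_lin)
    show "\<exists>x\<in>J. \<exists>y\<in>Cd. r = x ** y" if "r \<in> R" for r
    proof (intro bexI)
      show "r = mscale D ?v ** (v ** r)" using one(2) by (simp add: matrix_mul_assoc)
      show "mscale D ?v \<in> J" using vI unfolding J_def by blast
      show "v ** r \<in> Cd" using Cd_mult vC that by blast
    qed
  qed
  ultimately show ?thesis unfolding gorenstein_def invertible_frac_ideal_def using fullR Cd_frac_ideal J by blast
qed

end

section \<open>Orders that are not Gorenstein have the form O + p R'\<close>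

context valring
begin

lemma vle_add: "vle x z \<Longrightarrow> vle y z \<Longrightarrow> vle (x + y) z"
  unfolding vle_def by (metis V.Sadd distrib_right)

lemma vle_diff: "vle x z \<Longrightarrow> vle y z \<Longrightarrow> vle (x - y) z"
  unfolding vle_def by (metis V.Sdiff left_diff_distrib)

lemma vle_uminus: "vle x z \<Longrightarrow> vle (- x) z"
  using vle_diff[of 0 z x] by simp

lemma vle_uminus_iff: "vle (- x) z \<longleftrightarrow> vle x z"
  using vle_uminus[of x z] vle_uminus[of "- x" z] by auto

lemma vle_mult: "c \<in> V \<Longrightarrow> vle x z \<Longrightarrow> vle (c * x) z"
  unfolding vle_def by (metis V.Smult mult.assoc)

lemma vle_mult': "c \<in> V \<Longrightarrow> vle x z \<Longrightarrow> vle (x * c) z"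
  using vle_mult[of c x z] by (simp add: mult.commute)

lemma vle_self: "c \<in> V \<Longrightarrow> vle (z * c) z" "c \<in> V \<Longrightarrow> vle (c * z) z"
  unfolding vle_def by (auto intro: bexI[of _ c])

end

lemma lin_zero_shift: "lin i j k a b c d = mscale a (mat 1) + lin i j k 0 b c (d::'a::comm_ring_1)"
  unfolding lin_def by simp

lemma tri_shift:
  fixes i j k :: "'a::comm_ring_1^2^2"
  shows "tri x (j - mscale s (mat 1)) (k - mscale t (mat 1)) = tri x j k"
    "tri (i - mscale s (mat 1)) x (k - mscale t (mat 1)) = tri i x k"
    "tri (i - mscale s (mat 1)) (j - mscale t (mat 1)) x = tri i j x"
proof -
  have m: "a - mscale s (mat 1) = a + mscale (- s) (mat 1)" for a :: "'a^2^2" and s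
    by (cases a rule: mk_cases) (simp add: mk_one)
  show "tri x (j - mscale s (mat 1)) (k - mscale t (mat 1)) = tri x j k"
    "tri (i - mscale s (mat 1)) x (k - mscale t (mat 1)) = tri i x k"
    "tri (i - mscale s (mat 1)) (j - mscale t (mat 1)) x = tri i j x"
    unfolding m by (simp_all add: tri_add tri_scale)
qed

lemma shift_mult:
  "(x - mscale s (mat 1)) ** (y - mscale t (mat 1)) = x ** y - mscale t x - mscale s y + mscale (s * t) (mat 1 :: 'a::comm_ring_1^2^2)"
  by (cases x rule: mk_cases; cases y rule: mk_cases) (simp add: mk_one algebra_simps)

context local_field
begin

lemma p_prime:
  assumes "x \<in> Ok" "y \<in> Ok" "O.vle (x * y) p"
  shows "O.vle x p \<or> O.vle y p"
proof (rule ccontr)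
  assume "\<not> ?thesis"
  then have "x \<noteq> 0" "inverse x \<in> Ok" "y \<noteq> 0" "inverse y \<in> Ok" using unit_iff assms by blast+
  then have "\<not> O.vle (x * y) p" using assms by (subst unit_iff) simp_all
  then show False using assms by blast
qed

text \<open>\<open>spi n R\<close> is the order \<open>\<O>\<^sub>K 1 + \<pi>\<^sup>n R\<close>, with the uniformizer called \<open>p\<close>.\<close>

definition spi :: "nat \<Rightarrow> ('a^2^2) set \<Rightarrow> ('a^2^2) set" where
  "spi n R = {mscale a (mat 1) + mscale (p ^ n) r | a r. a \<in> Ok \<and> r \<in> R}"

lemma spiI: "a \<in> Ok \<Longrightarrow> r \<in> R \<Longrightarrow> mscale a (mat 1) + mscale (p ^ n) r \<in> spi n R"
  unfolding spi_def by blast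

lemma spiE:
  assumes "x \<in> spi n R"
  obtains a r where "a \<in> Ok" "r \<in> R" "x = mscale a (mat 1) + mscale (p ^ n) r"
  using assms unfolding spi_def by blast

text \<open>Applied with \<open>b1\<close>, \<open>b2\<close> the first two coordinates of an
  element \<open>x\<close>: if \<open>c i = d x\<close> and \<open>c j = d' x\<close> modulo
  \<open>p\<close>, then \<open>c\<close> vanishes modulo \<open>p\<close>, since \<open>i\<close>
  and \<open>j\<close> are not proportional.\<close>

lemma unit_comparison:
  assumes "c \<in> Ok" "b1 \<in> Ok" "b2 \<in> Ok" "d \<in> Ok" "d' \<in> Ok"
    and "O.vle (c - d * b1) p" "O.vle (d * b2) p" "O.vle (d' * b1) p" "O.vle (c - d' * b2) p"
  shows "O.vle c p"
proof -
  have "O.vle d p \<or> O.vle b2 p" using p_prime assms by blast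
  then show ?thesis
  proof
    assume "O.vle d p"
    then have "O.vle (c - d * b1 + d * b1) p" using assms by (intro O.vle_add O.vle_mult')
    then show ?thesis by simp
  next
    assume "O.vle b2 p"
    then have "O.vle (c - d' * b2 + d' * b2) p" using assms by (intro O.vle_add O.vle_mult)
    then show ?thesis by simp
  qed
qed

end

context full_order_basis
begin

text \<open>For elements of \<open>R\<close> this says that the image in \<open>R / p R\<close> is
  scalar.\<close>

definition Qp :: "'a^2^2 \<Rightarrow> bool" where
  "Qp x \<longleftrightarrow> O.vle (tri x j k / D) p \<and> O.vle (tri i x k / D) p \<and> O.vle (tri i j x / D) p"

lemma Qp_mod: "is_mod Ok {x. Qp x}"
  unfolding is_mod_def Qp_def
  by (auto simp: tri_add tri_scale tri_zero add_divide_distrib O.vle_add times_divide_eq_right[symmetric] O.vle_mult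
      simp del: times_divide_eq_right)

definition "N = {lin i j k 0 b c d | b c d. b \<in> Ok \<and> c \<in> Ok \<and> d \<in> Ok}"

lemma N_R: "x \<in> N \<Longrightarrow> x \<in> R"
  unfolding N_def Rl using lattI[of 0] by auto

lemma NI: "b \<in> Ok \<Longrightarrow> c \<in> Ok \<Longrightarrow> d \<in> Ok \<Longrightarrow> lin i j k 0 b c d \<in> N"
  unfolding N_def by blast

lemma N_ijk: "i \<in> N" "j \<in> N" "k \<in> N"
proof -
  have "lin i j k 0 1 0 0 \<in> N" "lin i j k 0 0 1 0 \<in> N" "lin i j k 0 0 0 1 \<in> N" by (simp_all add: NI)
  then show "i \<in> N" "j \<in> N" "k \<in> N" by (simp_all add: lin_eqs)
qed

lemma N_least: "is_mod Ok M \<Longrightarrow> i \<in> M \<Longrightarrow> j \<in> M \<Longrightarrow> k \<in> M \<Longrightarrow> x \<in> N \<Longrightarrow> x \<in> M"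
  unfolding N_def lin_def is_mod_def by auto

lemma Qp_expand:
  assumes "x \<in> R" "Qp x"
  shows "\<exists>c\<in>Ok. \<exists>n\<in>N. x = mscale c (mat 1) + mscale p n"
proof -
  obtain a where a: "a \<in> Ok" "x = lin i j k a (tri x j k / D) (tri i x k / D) (tri i j x / D)"
    using latt_expand[of x i j k D] assms(1) Rl D_def Dnz by blast
  obtain b c d where bcd: "b \<in> Ok" "c \<in> Ok" "d \<in> Ok" "tri x j k / D = b * p" "tri i x k / D = c * p" "tri i j x / D = d * p"
    using assms(2) unfolding Qp_def O.vle_def by blast
  have "x = mscale a (mat 1) + mscale p (lin i j k 0 b c d)"
    by (subst a(2), unfold bcd(4-6)) (simp add: lin_scale lin_zero_shift[of i j k a] mult.commute)
  then show ?thesis using a bcd unfolding N_def by blast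
qed

text \<open>For \<open>x\<close>, \<open>y\<close> in the span \<open>N\<close> of \<open>i\<close>,
  \<open>j\<close>, \<open>k\<close> one has \<open>x y = c + p n\<close> with \<open>n\<close> in
  \<open>N\<close>. The order \<open>O + N/p\<close> is closed under products as soon as
  \<open>p * p\<close> divides every such \<open>c\<close>. Both factors come from associativity:
  comparing \<open>(x y) z\<close> with \<open>x (y z)\<close> gives \<open>c z = d x\<close> modulo
  \<open>p\<close> and scalars, for every \<open>z\<close> in \<open>N\<close>.\<close>

lemma quotient_order:
  assumes H: "\<And>x y. x \<in> {i,j,k} \<Longrightarrow> y \<in> {i,j,k} \<Longrightarrow> Qp (x ** y)"
  shows "\<exists>R'. full_order K absv R' \<and> R = spi 1 R'"
proof -
  have M1: "is_mod Ok {x. Qp (x ** y)}" and M2: "is_mod Ok {x. Qp (y ** x)}" for y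
    using Qp_mod unfolding is_mod_def by (auto simp: mat_lin)
  have "Qp (x ** y)" if "x \<in> N" "y \<in> {i,j,k}" for x y
    using N_least[OF M1[of y]] H that by blast
  then have QN: "Qp (x ** y)" if "x \<in> N" "y \<in> N" for x y
    using N_least[OF M2[of x]] that by blast
  have assoc: "mscale c z + mscale p (n ** z) = mscale d x + mscale p (x ** n')"
    if "x ** y = mscale c (mat 1) + mscale p n" "y ** z = mscale d (mat 1) + mscale p n'" for x y z n n' c d
  proof -
    have "(x ** y) ** z = x ** (y ** z)" by (simp add: matrix_mul_assoc)
    then show ?thesis unfolding that by (simp add: mat_lin)
  qed
  have cf: "tri (mscale c z) j k / D - tri (mscale d x) j k / D = p * (tri (x ** n') j k / D - tri (n ** z) j k / D)"
    "tri i (mscale c z) k / D - tri i (mscale d x) k / D = p * (tri i (x ** n') k / D - tri i (n ** z) k / D)"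
    if "mscale c z + mscale p (n ** z) = mscale d x + mscale p (x ** n')" for x z n n' c d
  proof -
    have "tri (mscale c z + mscale p (n ** z)) j k = tri (mscale d x + mscale p (x ** n')) j k"
      "tri i (mscale c z + mscale p (n ** z)) k = tri i (mscale d x + mscale p (x ** n')) k" using that by simp_all
    then show "tri (mscale c z) j k / D - tri (mscale d x) j k / D = p * (tri (x ** n') j k / D - tri (n ** z) j k / D)"
    "tri i (mscale c z) k / D - tri i (mscale d x) k / D = p * (tri i (x ** n') k / D - tri i (n ** z) k / D)"
      by (simp_all add: tri_add tri_scale field_simps)
  qed
  have RO: "tri x j k / D \<in> Ok" "tri i x k / D \<in> Ok" if "x \<in> R" for x
    using tri_div_D that ijkR by blast+
  have step1: "O.vle c p" if xy: "x \<in> N" "y \<in> N" and c: "c \<in> Ok" "n \<in> N" "x ** y = mscale c (mat 1) + mscale p n" for x y c n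
  proof -
    have ex: "\<exists>d\<in>Ok. O.vle (c * (tri z j k / D) - d * (tri x j k / D)) p \<and> O.vle (c * (tri i z k / D) - d * (tri i x k / D)) p" if z: "z \<in> N" for z
    proof -
      obtain d n' where d: "d \<in> Ok" "n' \<in> N" "y ** z = mscale d (mat 1) + mscale p n'"
        using Qp_expand[OF Rd(8)[OF N_R[OF xy(2)] N_R[OF z]] QN[OF xy(2) z]] by blast
      have "x ** n' \<in> R" "n ** z \<in> R" using Rd(8)[OF N_R[OF xy(1)] N_R[OF d(2)]] Rd(8)[OF N_R[OF c(2)] N_R[OF z]] .
      then have "O.vle (c * (tri z j k / D) - d * (tri x j k / D)) p \<and> O.vle (c * (tri i z k / D) - d * (tri i x k / D)) p"
        using cf[OF assoc[OF c(3) d(3)]] RO by (simp add: tri_scale O.vle_self)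
      then show ?thesis using d by blast
    qed
    obtain d where d: "d \<in> Ok" "O.vle (c - d * (tri x j k / D)) p" "O.vle (d * (tri i x k / D)) p"
      using ex[OF N_ijk(1)] by (auto simp: tri_ijk O.vle_uminus_iff)
    obtain d' where d': "d' \<in> Ok" "O.vle (d' * (tri x j k / D)) p" "O.vle (c - d' * (tri i x k / D)) p"
      using ex[OF N_ijk(2)] by (auto simp: tri_ijk O.vle_uminus_iff)
    show ?thesis using unit_comparison[OF c(1) RO(1)[OF N_R[OF xy(1)]] RO(2)[OF N_R[OF xy(1)]] d(1) d'(1) d(2,3) d'(2,3)] .
  qed
  have step2: "O.vle c (p * p)" if xy: "x \<in> N" "y \<in> N" and c: "c \<in> Ok" "n \<in> N" "x ** y = mscale c (mat 1) + mscale p n" for x y c n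
  proof -
    obtain c' where c': "c' \<in> Ok" "c = c' * p" using step1[OF xy c] unfolding O.vle_def by blast
    have ex: "\<exists>d\<in>Ok. O.vle (c' * (tri z j k / D) - d * (tri x j k / D)) p \<and> O.vle (c' * (tri i z k / D) - d * (tri i x k / D)) p" if z: "z \<in> N" for z
    proof -
      obtain d n' where d: "d \<in> Ok" "n' \<in> N" "y ** z = mscale d (mat 1) + mscale p n'"
        using Qp_expand[OF Rd(8)[OF N_R[OF xy(2)] N_R[OF z]] QN[OF xy(2) z]] by blast
      obtain d' where d': "d' \<in> Ok" "d = d' * p" using step1[OF xy(2) z d] unfolding O.vle_def by blast
      \<comment> \<open>With one factor \<open>p\<close> of \<open>c\<close> and \<open>d\<close>
        cancelled, the error terms are products of elements of \<open>N\<close> and hence again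
        scalar modulo \<open>p\<close>, so the comparison can be repeated.\<close>
      have Q: "Qp (x ** n')" "Qp (n ** z)" using QN[OF xy(1) d(2)] QN[OF c(2) z] .
      have "p * (c' * (tri z j k / D) - d' * (tri x j k / D)) = p * (tri (x ** n') j k / D - tri (n ** z) j k / D)"
        "p * (c' * (tri i z k / D) - d' * (tri i x k / D)) = p * (tri i (x ** n') k / D - tri i (n ** z) k / D)"
        using cf[OF assoc[OF c(3) d(3)]] unfolding c' d' by (simp_all add: tri_scale algebra_simps)
      then have "c' * (tri z j k / D) - d' * (tri x j k / D) = tri (x ** n') j k / D - tri (n ** z) j k / D"
        "c' * (tri i z k / D) - d' * (tri i x k / D) = tri i (x ** n') k / D - tri i (n ** z) k / D" by simp_all
      then show ?thesis using Q d'(1) unfolding Qp_def by (metis O.vle_diff)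
    qed
    obtain d where d: "d \<in> Ok" "O.vle (c' - d * (tri x j k / D)) p" "O.vle (d * (tri i x k / D)) p"
      using ex[OF N_ijk(1)] by (auto simp: tri_ijk O.vle_uminus_iff)
    obtain d' where d': "d' \<in> Ok" "O.vle (d' * (tri x j k / D)) p" "O.vle (c' - d' * (tri i x k / D)) p"
      using ex[OF N_ijk(2)] by (auto simp: tri_ijk O.vle_uminus_iff)
    have "O.vle c' p" using unit_comparison[OF c'(1) RO(1)[OF N_R[OF xy(1)]] RO(2)[OF N_R[OF xy(1)]] d(1) d'(1) d(2,3) d'(2,3)] .
    then show ?thesis unfolding c'(2) O.vle_def by (metis mult.assoc)
  qed
  define q where "q = inverse p"
  have qp: "q * p = 1" "q \<in> K" by (simp_all add: q_def Kinv pK)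
  let ?R = "latt (mscale q i) (mscale q j) (mscale q k)"
  have ln: "lin (mscale q i) (mscale q j) (mscale q k) a b c d = lin i j k a (q * b) (q * c) (q * d)" for a b c d
    unfolding lin_def by (simp add: mscale_mscale mult.commute)
  have qN: "mscale q n \<in> ?R" if nN: "n \<in> N" for n
  proof -
    obtain b c d where "b \<in> Ok" "c \<in> Ok" "d \<in> Ok" "n = lin i j k 0 b c d" using nN unfolding N_def by blast
    then show ?thesis using lattI[of 0 b c d "mscale q i" "mscale q j" "mscale q k"] by (simp add: ln lin_scale)
  qed
  have "full_order K absv ?R"
  proof (rule latt_order)
    show "mscale q i \<in> mats K" "mscale q j \<in> mats K" "mscale q k \<in> mats K" using ijkK qp by simp_all
    show "tri (mscale q i) (mscale q j) (mscale q k) \<noteq> 0" using D0 qp by (auto simp: tri_scale)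
    fix x y assume "x \<in> {mscale q i, mscale q j, mscale q k}" "y \<in> {mscale q i, mscale q j, mscale q k}"
    then obtain x' y' where xy: "x' \<in> {i,j,k}" "y' \<in> {i,j,k}" "x = mscale q x'" "y = mscale q y'" by auto
    then have N: "x' \<in> N" "y' \<in> N" using N_ijk by auto
    obtain c n where c: "c \<in> Ok" "n \<in> N" "x' ** y' = mscale c (mat 1) + mscale p n"
      using Qp_expand[OF Rd(8)[OF N_R[OF N(1)] N_R[OF N(2)]] QN[OF N]] by blast
    obtain e where e: "e \<in> Ok" "c = e * (p * p)" using step2[OF N c] unfolding O.vle_def by blast
    have qq: "q * (q * (e * (p * p))) = e" "q * (q * p) = q" using qp(1) by (simp_all add: field_simps q_def)
    have "x ** y = mscale q (mscale q (x' ** y'))" unfolding xy by (simp add: mat_lin)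
    also have "\<dots> = mscale e (mat 1) + mscale q n" unfolding c(3) e(2) by (simp only: mscale_add mscale_mscale qq mult.assoc)
    finally have "x ** y = mscale e (mat 1) + mscale q n" .
    moreover have "mscale e (mat 1) \<in> ?R" using lattI[of e 0 0 0] e(1) by (simp add: lin_eqs)
    ultimately show "x ** y \<in> ?R" using qN[OF c(2)] latt_mod unfolding is_mod_def by metis
  qed
  moreover have "R = spi 1 ?R"
  proof (intro equalityI subsetI)
    fix x assume "x \<in> R"
    then obtain a b c d where abcd: "a \<in> Ok" "b \<in> Ok" "c \<in> Ok" "d \<in> Ok" "x = lin i j k a b c d" unfolding Rl by (elim lattE)
    have xe: "x = mscale a (mat 1) + mscale (p ^ 1) (lin (mscale q i) (mscale q j) (mscale q k) 0 b c d)"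
      unfolding abcd(5) ln lin_scale using qp(1) lin_zero_shift[of i j k a b c d] by (simp add: mult.assoc[symmetric] mult.commute[of p])
    show "x \<in> spi 1 ?R" unfolding xe using abcd(1-4) by (intro spiI lattI) simp_all
  next
    fix x assume "x \<in> spi 1 ?R"
    then obtain r s where r: "r \<in> Ok" "s \<in> ?R" "x = mscale r (mat 1) + mscale p s" unfolding spi_def by auto
    then obtain a b c d where abcd: "a \<in> Ok" "b \<in> Ok" "c \<in> Ok" "d \<in> Ok" "s = lin (mscale q i) (mscale q j) (mscale q k) a b c d"
      by (elim lattE)
    have "mscale p s = lin i j k (p * a) b c d"
      unfolding abcd(5) ln lin_scale using qp(1) by (simp add: mult.assoc[symmetric] mult.commute[of p])
    then show "x \<in> R" unfolding r(3) using lattI[of "p * a" b c d i j k] abcd Rd(6) Rd(12)[OF r(1)] Rl by simp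
  qed
  ultimately show ?thesis by blast
qed

text \<open>\<open>tri x j k / D\<close>, \<open>tri i x k / D\<close> and
  \<open>tri i j x / D\<close> are the coordinates of \<open>x\<close> at \<open>i\<close>,
  \<open>j\<close>, \<open>k\<close>. The congruences say that modulo \<open>p\<close>, scalars and
  multiples of \<open>k\<close>, multiplication by \<open>k\<close> on either side acts on
  \<open>i\<close> and \<open>j\<close> as one number, the coordinate of \<open>j ** k\<close> at
  \<open>j\<close>, and that \<open>mtrace k\<close> is twice that number.\<close>

lemma congruences:
  assumes H: "\<And>a b. a \<in> R \<Longrightarrow> b \<in> R \<Longrightarrow> O.vle (dt (comm a b) / D) p"
  shows "O.vle (tri (j ** k) j k / D) p" "O.vle (tri (k ** j) j k / D) p"
    "O.vle (tri i (k ** j) k / D - tri i (j ** k) k / D) p"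
    "O.vle (tri (i ** k) j k / D - tri i (j ** k) k / D) p"
    "O.vle (tri (k ** i) j k / D - tri i (j ** k) k / D) p"
    "O.vle (mtrace k - 2 * (tri i (j ** k) k / D)) p"
proof -
  have pol: "O.vle (polar i j k / D) p"
    unfolding polar_def diff_divide_distrib add_divide_distrib using H ijkR Rd(7) by (intro O.vle_diff O.vle_add) blast+
  show "O.vle (tri (j ** k) j k / D) p" "O.vle (tri (k ** j) j k / D) p"
    unfolding tri_prod_left using H[OF ijkR(2,3)] O.vle_uminus by (simp_all add: minus_divide_left[symmetric])
  have "tri i (k ** j) k = tri i (j ** k) k - polar i j k" "tri (i ** k) j k = tri i (j ** k) k - polar i j k"
    using tri_prod_diff(1,2)[of i j k] by (simp_all add: algebra_simps)
  then have e: "tri i (k ** j) k / D - tri i (j ** k) k / D = - (polar i j k / D)" "tri (i ** k) j k / D - tri i (j ** k) k / D = - (polar i j k / D)"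
    by (simp_all add: diff_divide_distrib)
  then show a: "O.vle (tri i (k ** j) k / D - tri i (j ** k) k / D) p" "O.vle (tri (i ** k) j k / D - tri i (j ** k) k / D) p"
    using pol O.vle_uminus by simp_all
  have "tri (k ** i) j k = tri i (j ** k) k" using tri_prod_diff(2)[of i j k] tri_prod_diff(3)[of i k j] by (simp add: algebra_simps)
  then show "O.vle (tri (k ** i) j k / D - tri i (j ** k) k / D) p" by simp
  have "mtrace k = (mtrace k * D) / D" by simp
  also have "\<dots> = tri i (j ** k) k / D + tri i (k ** j) k / D"
    using tri_square[of i j k] by (simp add: tri_ijk add_divide_distrib[symmetric] mult.commute)
  finally have "mtrace k - 2 * (tri i (j ** k) k / D) = tri i (k ** j) k / D - tri i (j ** k) k / D" by simp
  then show "O.vle (mtrace k - 2 * (tri i (j ** k) k / D)) p" using a by simp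
qed

lemma not_gorenstein_imp_spi:
  assumes "\<not> gorenstein K absv R"
  shows "\<exists>R'. full_order K absv R' \<and> R = spi 1 R'"
proof -
  have H: "O.vle (dt (comm a b) / D) p" if "a \<in> R" "b \<in> R" for a b
    using gorenstein_if_unit that assms by blast
  interpret B: full_order_basis K absv p R j k i by (rule rotate)
  interpret C: full_order_basis K absv p R k i j by (rule B.rotate)
  have DD: "B.D = D" "C.D = D" using tri_cyc[of i j k] tri_cyc[of j k i] unfolding B.D_def C.D_def D_def by simp_all
  have cy: "tri x k i = tri i x k" "tri j x i = tri i j x" "tri j k x = tri x j k"
     "tri x i j = tri i j x" "tri k x j = tri x j k" "tri k i x = tri i x k" for x
    using tri_cyc[of i x k] tri_cyc[of i j x] tri_cyc[of x j k] tri_cyc[of j x i] tri_cyc[of x k i] tri_cyc[of k x j] by simp_all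
  note cA = congruences[OF H] and cB = B.congruences[unfolded DD cy, OF H] and cC = C.congruences[unfolded DD cy, OF H]
  \<comment> \<open>The numbers by which \<open>k\<close>, \<open>i\<close> and \<open>j\<close> act
    in the sense of \<open>congruences\<close>. After subtracting them as scalars, all products of
    the new basis vectors are scalar modulo \<open>p\<close>, as \<open>quotient_order\<close>
    requires.\<close>
  define s3 where "s3 = tri i (j ** k) k / D"
  define s1 where "s1 = tri i j (k ** i) / D"
  define s2 where "s2 = tri (i ** j) j k / D"
  note A = cA[folded s3_def] and B = cB[folded s1_def] and C = cC[folded s2_def]
  have sO: "s1 \<in> Ok" "s2 \<in> Ok" "s3 \<in> Ok" unfolding s1_def s2_def s3_def using tri_div_D ijkR Rd(8) by blast+
  define i' where "i' = i - mscale s1 (mat 1)"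
  define j' where "j' = j - mscale s2 (mat 1)"
  define k' where "k' = k - mscale s3 (mat 1)"
  have ijkl: "i = i' + mscale s1 (mat 1)" "j = j' + mscale s2 (mat 1)" "k = k' + mscale s3 (mat 1)"
    by (simp_all add: i'_def j'_def k'_def)
  have t: "tri i' j' k' = D" unfolding i'_def j'_def k'_def tri_shift(1)
    using tri_shift(2)[where i=i and x=j and k=k and s=s1 and t=0] by (simp add: D_def)
  have "full_order_basis K absv p R i' j' k'"
  proof
    show "tri i' j' k' \<noteq> 0" using t by simp
    have m: "mscale c (mat 1) \<in> latt a b d" if "c \<in> Ok" for a b c d
      using lattI[OF that, of 0 0 0] by (simp add: lin_eqs)
    have ad: "x \<in> latt a b d \<Longrightarrow> y \<in> latt a b d \<Longrightarrow> x + y \<in> latt a b d" for x y a b d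
      using latt_mod unfolding is_mod_def by blast
    have "latt i j k \<subseteq> latt i' j' k'"
      by (rule latt_least[OF latt_mod]) (subst ijkl | intro latt_gens ad m sO)+
    moreover have "latt i' j' k' \<subseteq> latt i j k"
      unfolding i'_def j'_def k'_def
      by (rule latt_least[OF latt_mod latt_gens(1)]; rule mod_diff[OF latt_mod _ m]; rule latt_gens sO)
    ultimately show "R = latt i' j' k'" unfolding Rl by blast
    have sK: "s1 \<in> K" "s2 \<in> K" "s3 \<in> K" using sO by simp_all
    then show "i' \<in> mats K" "j' \<in> mats K" "k' \<in> mats K" unfolding i'_def j'_def k'_def using ijkK by simp_all
  qed (rule fullR)
  then interpret E: full_order_basis K absv p R i' j' k' .
  have ED: "E.D = D" unfolding E.D_def t ..
  have EQ: "E.Qp x \<longleftrightarrow> O.vle (tri x j k / D) p \<and> O.vle (tri i x k / D) p \<and> O.vle (tri i j x / D) p" for x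
    unfolding E.Qp_def ED unfolding i'_def j'_def k'_def tri_shift ..
  have lin: "tri (x ** y - mscale b x - mscale a y + mscale (a * b) (mat 1)) j k / D = tri (x ** y) j k / D - b * (tri x j k / D) - a * (tri y j k / D)"
    "tri i (x ** y - mscale b x - mscale a y + mscale (a * b) (mat 1)) k / D = tri i (x ** y) k / D - b * (tri i x k / D) - a * (tri i y k / D)"
    "tri i j (x ** y - mscale b x - mscale a y + mscale (a * b) (mat 1)) / D = tri i j (x ** y) / D - b * (tri i j x / D) - a * (tri i j y / D)"
    for x y a b
  proof -
    have d: "tri (x - y) b c = tri x b c - tri y b c" "tri b (x - y) c = tri b x c - tri b y c" "tri b c (x - y) = tri b c x - tri b c y" for x y b c :: "'a^2^2"
      unfolding tri_def comm_def by (simp_all add: mat_lin)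
    show "tri (x ** y - mscale b x - mscale a y + mscale (a * b) (mat 1)) j k / D = tri (x ** y) j k / D - b * (tri x j k / D) - a * (tri y j k / D)"
    "tri i (x ** y - mscale b x - mscale a y + mscale (a * b) (mat 1)) k / D = tri i (x ** y) k / D - b * (tri i x k / D) - a * (tri i y k / D)"
    "tri i j (x ** y - mscale b x - mscale a y + mscale (a * b) (mat 1)) / D = tri i j (x ** y) / D - b * (tri i j x / D) - a * (tri i j y / D)"
      by (simp_all add: tri_add d tri_scale diff_divide_distrib add_divide_distrib)
  qed
  \<comment> \<open>For the squares Cayley-Hamilton reduces the condition to the trace congruence,
    for instance \<open>mtrace k = 2 s3\<close> modulo \<open>p\<close>.\<close>
  have sq: "tri (x ** x) a b = mtrace x * tri x a b" "tri a (x ** x) b = mtrace x * tri a x b" "tri a b (x ** x) = mtrace x * tri a b x" for x a b :: "'a^2^2"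
  proof -
    have e: "x ** x = mscale (mtrace x) x + mscale (- dt x) (mat 1)" for x :: "'a^2^2"
      by (cases x rule: mk_cases) (simp add: mk_one algebra_simps)
    show "tri (x ** x) a b = mtrace x * tri x a b" "tri a (x ** x) b = mtrace x * tri a x b" "tri a b (x ** x) = mtrace x * tri a b x"
      unfolding e by (simp_all add: tri_add tri_scale)
  qed
  have Qprod: "E.Qp ((x - mscale a (mat 1)) ** (y - mscale b (mat 1))) \<longleftrightarrow>
      O.vle (tri (x ** y) j k / D - b * (tri x j k / D) - a * (tri y j k / D)) p \<and>
      O.vle (tri i (x ** y) k / D - b * (tri i x k / D) - a * (tri i y k / D)) p \<and>
      O.vle (tri i j (x ** y) / D - b * (tri i j x / D) - a * (tri i j y / D)) p" for x y a b
    unfolding EQ shift_mult lin ..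
  have e2: "m - a - a = m - 2 * a" for m a :: 'a by simp
  have val: "tri i j k / D = 1" "tri j j k / D = 0" "tri k j k / D = 0" "tri i i k / D = 0" "tri i k k / D = 0"
    "tri i j i / D = 0" "tri i j j / D = 0" by (simp_all add: tri_ijk)
  have Qii: "E.Qp (i' ** i')" unfolding Qprod[of i s1 i s1, folded i'_def] val sq times_divide_eq_right[symmetric] val
    using A B C by (simp add: s1_def[symmetric] s2_def[symmetric] s3_def[symmetric] e2)
  have Qij: "E.Qp (i' ** j')" unfolding Qprod[of i s1 j s2, folded i'_def j'_def] val
    using A B C by (simp add: s1_def[symmetric] s2_def[symmetric] s3_def[symmetric])
  have Qik: "E.Qp (i' ** k')" unfolding Qprod[of i s1 k s3, folded i'_def k'_def] val
    using A B C by (simp add: s1_def[symmetric] s2_def[symmetric] s3_def[symmetric])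
  have Qji: "E.Qp (j' ** i')" unfolding Qprod[of j s2 i s1, folded j'_def i'_def] val
    using A B C by (simp add: s1_def[symmetric] s2_def[symmetric] s3_def[symmetric])
  have Qjj: "E.Qp (j' ** j')" unfolding Qprod[of j s2 j s2, folded j'_def] val sq times_divide_eq_right[symmetric] val
    using A B C by (simp add: s1_def[symmetric] s2_def[symmetric] s3_def[symmetric] e2)
  have Qjk: "E.Qp (j' ** k')" unfolding Qprod[of j s2 k s3, folded j'_def k'_def] val
    using A B C by (simp add: s1_def[symmetric] s2_def[symmetric] s3_def[symmetric])
  have Qki: "E.Qp (k' ** i')" unfolding Qprod[of k s3 i s1, folded k'_def i'_def] val
    using A B C by (simp add: s1_def[symmetric] s2_def[symmetric] s3_def[symmetric])
  have Qkj: "E.Qp (k' ** j')" unfolding Qprod[of k s3 j s2, folded k'_def j'_def] val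
    using A B C by (simp add: s1_def[symmetric] s2_def[symmetric] s3_def[symmetric])
  have Qkk: "E.Qp (k' ** k')" unfolding Qprod[of k s3 k s3, folded k'_def] val sq times_divide_eq_right[symmetric] val
    using A B C by (simp add: s1_def[symmetric] s2_def[symmetric] s3_def[symmetric] e2)
  have "E.Qp (x ** y)" if "x \<in> {i',j',k'}" "y \<in> {i',j',k'}" for x y
    using that Qii Qij Qik Qji Qjj Qjk Qki Qkj Qkk by (elim insertE emptyE) simp_all
  then show ?thesis by (rule E.quotient_order)
qed

end

context local_field
begin

lemma full_order_basisI:
  assumes "full_order K absv R"
  obtains i j k where "full_order_basis K absv p R i j k"
proof -
  obtain i j k where "i \<in> mats K" "j \<in> mats K" "k \<in> mats K" "tri i j k \<noteq> 0" "R = latt i j k"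
    using full_order_latt[OF assms] by blast
  then have "full_order_basis K absv p R i j k" using assms by unfold_locales
  then show ?thesis by (rule that)
qed

lemma not_gorenstein_spi:
  assumes "full_order K absv R" "\<not> gorenstein K absv R"
  shows "\<exists>R'. full_order K absv R' \<and> R = spi 1 R'"
proof -
  obtain i j k where "full_order_basis K absv p R i j k" using full_order_basisI[OF assms(1)] .
  then show ?thesis using full_order_basis.not_gorenstein_imp_spi assms(2) by blast
qed

lemma spi_latt: "spi n (latt i j k) = latt (mscale (p ^ n) i) (mscale (p ^ n) j) (mscale (p ^ n) k)"
proof (intro equalityI subsetI)
  fix x assume "x \<in> spi n (latt i j k)"
  then obtain r s where r: "r \<in> Ok" "s \<in> latt i j k" "x = mscale r (mat 1) + mscale (p ^ n) s" by (elim spiE)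
  obtain a b c d where abcd: "a \<in> Ok" "b \<in> Ok" "c \<in> Ok" "d \<in> Ok" "s = lin i j k a b c d" using r(2) by (elim lattE)
  have "x = lin (mscale (p ^ n) i) (mscale (p ^ n) j) (mscale (p ^ n) k) (r + p ^ n * a) b c d"
    unfolding r(3) abcd(5) lin_def by (simp add: mscale_add mscale_mscale mscale_add_left mult.commute)
  then show "x \<in> latt (mscale (p ^ n) i) (mscale (p ^ n) j) (mscale (p ^ n) k)" using r abcd by (simp add: lattI)
next
  fix x assume "x \<in> latt (mscale (p ^ n) i) (mscale (p ^ n) j) (mscale (p ^ n) k)"
  then obtain a b c d where abcd: "a \<in> Ok" "b \<in> Ok" "c \<in> Ok" "d \<in> Ok"
    "x = lin (mscale (p ^ n) i) (mscale (p ^ n) j) (mscale (p ^ n) k) a b c d" by (elim lattE)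
  have "x = mscale a (mat 1) + mscale (p ^ n) (lin i j k 0 b c d)"
    unfolding abcd(5) lin_def by (simp add: mscale_add mscale_mscale mult.commute)
  then show "x \<in> spi n (latt i j k)" using abcd by (simp add: spiI lattI)
qed

lemma spi_full_order:
  assumes "full_order K absv R"
  shows "full_order K absv (spi n R)"
proof -
  obtain i j k where ijk: "i \<in> mats K" "j \<in> mats K" "k \<in> mats K" "tri i j k \<noteq> 0" "R = latt i j k"
    using full_order_latt[OF assms] by blast
  let ?P = "p ^ n"
  have PK: "?P \<in> K" using pK Kpow by blast
  show ?thesis unfolding ijk(5) spi_latt
  proof (rule latt_order)
    show "mscale ?P i \<in> mats K" "mscale ?P j \<in> mats K" "mscale ?P k \<in> mats K" using ijk PK by simp_all
    show "tri (mscale ?P i) (mscale ?P j) (mscale ?P k) \<noteq> 0" using ijk by (simp add: tri_scale)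
    fix x y assume "x \<in> {mscale ?P i, mscale ?P j, mscale ?P k}" "y \<in> {mscale ?P i, mscale ?P j, mscale ?P k}"
    then obtain x' y' where xy: "x' \<in> {i,j,k}" "y' \<in> {i,j,k}" "x = mscale ?P x'" "y = mscale ?P y'" by auto
    then have "x' \<in> R" "y' \<in> R" using latt_gens unfolding ijk(5) by auto
    then have r: "mscale ?P (x' ** y') \<in> R" using full_orderD(8,9)[OF assms] by simp
    have "x ** y = mscale 0 (mat 1) + mscale ?P (mscale ?P (x' ** y'))" unfolding xy by (simp add: mat_lin)
    then have "x ** y \<in> spi n R" using r spiI[of 0] by simp
    then show "x ** y \<in> latt (mscale ?P i) (mscale ?P j) (mscale ?P k)" unfolding ijk(5) spi_latt .
  qed
qed

lemma mscale_cancel: "c \<noteq> 0 \<Longrightarrow> mscale c x = mscale c y \<Longrightarrow> x = (y::'a^2^2)"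
  by (metis mscale_mscale mscale_one left_inverse)

text \<open>The order \<open>O + p R'\<close> is a local ring, so an invertible codifferent would be generated by one element;
  but it contains two elements that are independent modulo the codifferent of \<open>R'\<close>.\<close>

lemma spi_1_not_gorenstein:
  assumes R': "full_order K absv R'"
  shows "\<not> gorenstein K absv (spi 1 R')"
proof
  assume g: "gorenstein K absv (spi 1 R')"
  define R where "R = spi 1 R'"
  have R: "full_order K absv R" unfolding R_def using spi_full_order[OF R'] .
  let ?C = "codifferent K absv R"
  obtain J where J: "frac_ideal K absv R J" "lprod Ok ?C J = R" "lprod Ok J ?C = R" and Cf: "frac_ideal K absv R ?C"
    using g unfolding gorenstein_def invertible_frac_ideal_def R_def by blast
  obtain i j k where "full_order_basis K absv p R' i j k" using full_order_basisI[OF R'] .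
  then interpret B: full_order_basis K absv p R' i j k .
  note Rd = full_orderD[OF R]
  have pR: "mscale p r \<in> R" if "r \<in> R'" for r
    using spiI[of 0 r R' 1] that by (simp add: R_def)
  have RE: "\<exists>a r. a \<in> Ok \<and> r \<in> R' \<and> x = mscale a (mat 1) + mscale p r" if "x \<in> R" for x
    using that unfolding R_def by (elim spiE) auto
  \<comment> \<open>\<open>p R'\<close> is the maximal ideal of \<open>R\<close>: an element
    \<open>a + p r\<close> outside of it has a unit \<open>a\<close>, so its determinant is a unit
    and its inverse lies in \<open>R\<close>.\<close>
  let ?M = "{mscale p r | r. r \<in> R'}"
  have Mm: "is_mod Ok ?M"
    unfolding is_mod_def
  proof (intro conjI ballI)
    have "0 = mscale p 0" by simp
    then show "0 \<in> ?M" using B.Rd(4) unfolding is_mod_def by blast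
    show "x + y \<in> ?M" if "x \<in> ?M" "y \<in> ?M" for x y
      using that B.Rd(6) by (auto simp: mscale_add[symmetric])
    show "mscale c x \<in> ?M" if c: "c \<in> Ok" and x: "x \<in> ?M" for c x
    proof -
      obtain r where "r \<in> R'" "x = mscale p r" using x by blast
      then have "mscale c x = mscale p (mscale c r)" "mscale c r \<in> R'" using c B.Rd(9) by (auto simp: mscale_mscale mult.commute)
      then show ?thesis by blast
    qed
  qed
  have oneM: "mat 1 \<notin> ?M"
  proof
    assume "mat 1 \<in> ?M"
    then obtain r where r: "r \<in> R'" "mat 1 = mscale p r" by blast
    then have "mscale (inverse p) (mat 1) = r" by (simp add: mscale_mscale)
    then have "mscale (inverse p) (mat 1) \<in> R'" using r by simp
    then show False using O.scalar_in_order[OF B.Rd(1)] inv_p_notin Kinv[OF pK] by blast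
  qed
  \<comment> \<open>Since the products span \<open>R\<close>, which contains 1, not all of them lie
    in the maximal ideal. One that does not is invertible.\<close>
  have "\<exists>\<beta>\<in>?C. \<exists>\<gamma>\<in>J. \<beta> ** \<gamma> \<notin> ?M"
  proof (rule ccontr)
    assume "\<not> ?thesis"
    then have "lprod Ok ?C J \<subseteq> ?M" unfolding lprod_def by (intro lspan_least[OF Mm]) blast
    then show False using J(2) Rd(3) oneM by blast
  qed
  then obtain \<beta> \<gamma> where bg: "\<beta> \<in> ?C" "\<gamma> \<in> J" "\<beta> ** \<gamma> \<notin> ?M" by blast
  define u where "u = \<beta> ** \<gamma>"
  have CJR: "x ** y \<in> R" if "x \<in> ?C" "y \<in> J" for x y
  proof -
    have "x ** y \<in> lprod Ok ?C J" unfolding lprod_def using that by (intro lspan_base) auto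
    then show ?thesis using J(2) by simp
  qed
  have uR: "u \<in> R" unfolding u_def using CJR bg by blast
  obtain a r where ar: "a \<in> Ok" "r \<in> R'" "u = mscale a (mat 1) + mscale p r" using RE[OF uR] by blast
  have au: "\<not> O.vle a p"
  proof
    assume "O.vle a p"
    then obtain b where b: "b \<in> Ok" "a = b * p" unfolding O.vle_def by blast
    then have "u = mscale p (mscale b (mat 1) + r)" unfolding ar(3) by (simp add: mscale_add mscale_mscale mult.commute)
    moreover have "mscale b (mat 1) + r \<in> R'" using B.Rd(6,12) ar b by blast
    ultimately show False using bg(3) unfolding u_def by blast
  qed
  have du: "dt u = a * a + p * (a * mtrace r + p * dt r)"
    unfolding ar(3) by (cases r rule: mk_cases) (simp add: mk_one algebra_simps)
  have dO: "dt u \<in> Ok" using Rd(11) uR by blast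
  have "\<not> O.vle (dt u) p"
  proof
    assume "O.vle (dt u) p"
    then have "O.vle (dt u - p * (a * mtrace r + p * dt r)) p"
      using ar B.Rd(10,11) by (intro O.vle_diff O.vle_self) simp_all
    then have "O.vle (a * a) p" using du by simp
    then show False using p_prime[OF ar(1) ar(1)] au by blast
  qed
  then have di: "dt u \<noteq> 0" "inverse (dt u) \<in> Ok" using unit_iff[OF dO] by blast+
  define w where "w = mscale (inverse (dt u)) (mscale (mtrace u) (mat 1) - u)"
  have "mscale (mtrace u) (mat 1) - u \<in> R" using Rd(7,10,12) uR by blast
  then have wR: "w \<in> R" unfolding w_def using Rd(9) di by blast
  have uw: "u ** w = mat 1"
  proof -
    have "u ** (mscale (mtrace u) (mat 1) - u) = mscale (dt u) (mat 1)"
      by (cases u rule: mk_cases) (simp add: mk_one algebra_simps)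
    then show ?thesis unfolding w_def mscale_mult_right using di by (simp add: mscale_mscale)
  qed
  define g where "g = \<gamma> ** w"
  have gJ: "g \<in> J" unfolding g_def using J(1) bg(2) wR unfolding frac_ideal_def by blast
  have "\<beta> ** g = mat 1" using uw unfolding u_def g_def by (simp add: matrix_mul_assoc)
  then have gb: "g ** \<beta> = mat 1" using matrix_left_right_inverse[of \<beta> g] by blast
  \<comment> \<open>Thus the codifferent is the principal left module generated by
    \<open>\<beta>\<close>.\<close>
  have CRb: "\<exists>s\<in>R. x = s ** \<beta>" if "x \<in> ?C" for x
  proof -
    have "x ** g ** \<beta> = x" using gb by (simp add: matrix_mul_assoc[symmetric])
    then show ?thesis using CJR[OF that gJ] by metis
  qed
  define q where "q = inverse p"
  have qp: "q * p = 1" "q \<in> K" by (simp_all add: q_def Kinv pK)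
  have vK: "B.v1 \<in> mats K" "B.v2 \<in> mats K" using B.v_Cd B.Cd_iff by blast+
  \<comment> \<open>Trace zero kills the pairing with the scalar part of an element of
    \<open>R\<close>, and the factor \<open>p\<close> of the rest absorbs the denominator of
    \<open>q = 1/p\<close>.\<close>
  have vC: "mscale q v \<in> ?C" if v: "v \<in> B.Cd" "mtrace v = 0" for v
    unfolding codifferent_def
  proof (intro CollectI conjI ballI)
    show "mscale q v \<in> mats K" using v qp B.Cd_iff by simp
    fix x assume "x \<in> R"
    then obtain a r where "a \<in> Ok" "r \<in> R'" "x = mscale a (mat 1) + mscale p r" using RE by blast
    then have "mtrace (mscale q v ** x) = mtrace (v ** r)" using v(2) qp(1)
      by (simp add: mat_lin mult.assoc[symmetric] mult.commute[of p q])
    then show "mtrace (mscale q v ** x) \<in> Ok" using v(1) \<open>r \<in> R'\<close> unfolding B.Cd_iff by simp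
  qed
  have tv: "mtrace B.v1 = 0" "mtrace B.v2 = 0" using B.mtrace_v(1)[of "mat 1"] B.mtrace_v(2)[of "mat 1"] by simp_all
  obtain r1 r2 where r12: "r1 \<in> R" "mscale q B.v1 = r1 ** \<beta>" "r2 \<in> R" "mscale q B.v2 = r2 ** \<beta>"
    using CRb vC B.v_Cd tv by meson
  obtain a1 s1 where 1: "a1 \<in> Ok" "s1 \<in> R'" "r1 = mscale a1 (mat 1) + mscale p s1" using RE r12 by blast
  obtain a2 s2 where 2: "a2 \<in> Ok" "s2 \<in> R'" "r2 = mscale a2 (mat 1) + mscale p s2" using RE r12 by blast
  have pb: "mtrace (mscale p x ** \<beta>) \<in> Ok" if "x \<in> R'" for x
  proof -
    have "mtrace (\<beta> ** mscale p x) \<in> Ok" using bg(1) pR[OF that] unfolding codifferent_def by blast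
    then show ?thesis by (simp add: mtrace_mult_commute)
  qed
  \<comment> \<open>The combination of \<open>v1/p = r1 ** \<beta>\<close> and
    \<open>v2/p = r2 ** \<beta>\<close> that eliminates the scalar parts \<open>a1\<close>,
    \<open>a2\<close> is an element of \<open>p R'\<close> times \<open>\<beta>\<close>, and such
    elements pair integrally with \<open>R'\<close>.\<close>
  have key: "O.vle (a2 * mtrace (B.v1 ** x) - a1 * mtrace (B.v2 ** x)) p" if x: "x \<in> R'" for x
  proof -
    have "mscale a2 (mscale q B.v1) - mscale a1 (mscale q B.v2) = mscale p (mscale a2 s1 - mscale a1 s2) ** \<beta>"
      unfolding r12 1 2 by (simp add: mat_lin mult.commute[of a1 a2] mult.commute[of p])
    then have "x ** (mscale a2 (mscale q B.v1) - mscale a1 (mscale q B.v2)) = mscale p (x ** (mscale a2 s1 - mscale a1 s2)) ** \<beta>"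
      by (simp add: matrix_mul_assoc mscale_mult_right)
    moreover have "x ** (mscale a2 s1 - mscale a1 s2) \<in> R'" by (rule B.Rd(8)[OF x B.Rd(7)[OF B.Rd(9)[OF 2(1) 1(2)] B.Rd(9)[OF 1(1) 2(2)]]])
    ultimately have "mtrace (x ** (mscale a2 (mscale q B.v1) - mscale a1 (mscale q B.v2))) \<in> Ok" using pb by simp
    moreover have "mtrace (x ** (mscale a2 (mscale q B.v1) - mscale a1 (mscale q B.v2))) = q * (a2 * mtrace (B.v1 ** x) - a1 * mtrace (B.v2 ** x))"
      by (simp add: mat_lin mtrace_mult_commute[of x] algebra_simps)
    ultimately show ?thesis by (simp add: O.vle_div q_def divide_inverse mult.commute)
  qed
  \<comment> \<open>At \<open>x = j\<close> the pairings are 0 and 1, so \<open>p\<close> divides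
    \<open>a1\<close>. Then \<open>v1/p\<close> itself lies in \<open>p R'\<close> times
    \<open>\<beta>\<close>, although its pairing with \<open>i\<close> is
    \<open>1/p\<close>.\<close>
  have "O.vle a1 p" using key[OF B.ijkR(2)] O.vle_uminus_iff by (simp add: B.mtrace_v B.tri_ijk)
  then obtain b where b: "b \<in> Ok" "a1 = b * p" unfolding O.vle_def by blast
  have e: "mscale q B.v1 = mscale p (mscale b (mat 1) + s1) ** \<beta>" unfolding r12 1 b by (simp add: mscale_add mscale_mscale mult.commute)
  have "i ** mscale q B.v1 = mscale p (i ** (mscale b (mat 1) + s1)) ** \<beta>" unfolding e
    by (simp add: matrix_mul_assoc mscale_mult_right)
  moreover have "i ** (mscale b (mat 1) + s1) \<in> R'" by (rule B.Rd(8)[OF B.ijkR(1) B.Rd(6)[OF B.Rd(12)[OF b(1)] 1(2)]])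
  ultimately have "mtrace (i ** mscale q B.v1) \<in> Ok" using pb by simp
  moreover have "mtrace (i ** mscale q B.v1) = q" by (simp add: mat_lin mtrace_mult_commute[of i] B.mtrace_v B.tri_ijk)
  ultimately show False using inv_p_notin q_def by simp
qed

end

section \<open>Uniqueness and existence of the Gorenstein closure\<close>

context local_field
begin

lemma integral_scalar_diff:
  assumes "is_order Ok K X" "is_order Ok K Y" "x \<in> X" "y \<in> Y" "x = mscale c (mat 1) + y" "c \<in> K"
  shows "c \<in> Ok"
proof (rule ccontr)
  assume c: "c \<notin> Ok"
  then have ci: "inverse c \<in> Ok" "c \<noteq> 0" using O.val[OF assms(6)] by auto
  have "dt x = c * c + c * mtrace y + dt y"
    unfolding assms(5) by (cases y rule: mk_cases) (simp add: mk_one algebra_simps)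
  then have "inverse c * (dt x - dt y) - mtrace y = c" using ci by (simp add: field_simps)
  moreover have "inverse c * (dt x - dt y) - mtrace y \<in> Ok"
    using ci O.order_integral assms(1-4) by (intro O.V.Sdiff O.V.Smult) blast+
  ultimately show False using c by simp
qed

text \<open>Cancelling \<open>p ^ n\<close> leaves a scalar with a possible denominator, which is a
  difference of elements of the orders \<open>X\<close> and \<open>Y\<close> and hence integral.
  \<open>R1\<close> and \<open>R2\<close> are taken as mere modules, since in
  \<open>cmats_absorb\<close> this is applied before \<open>R1\<close> is known to be an
  order.\<close>

lemma spi_strip:
  assumes X: "is_order Ok K X" "R1 \<subseteq> X" and Y: "is_order Ok K Y" "R2 \<subseteq> Y"
    and m1: "is_mod Ok R1" "mat 1 \<in> R1" and m2: "is_mod Ok R2"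
    and eq: "spi n R1 = spi (n + m) R2"
  shows "R1 = spi m R2"
proof (intro equalityI subsetI)
  have pn: "p ^ n \<noteq> 0" "p ^ n \<in> K" using Kpow[OF pK] by simp_all
  fix x assume x: "x \<in> R1"
  then have "mscale 0 (mat 1) + mscale (p ^ n) x \<in> spi (n + m) R2" unfolding eq[symmetric] by (intro spiI) simp_all
  then obtain a r where r: "a \<in> Ok" "r \<in> R2" "mscale 0 (mat 1) + mscale (p ^ n) x = mscale a (mat 1) + mscale (p ^ (n + m)) r" by (elim spiE)
  have "mscale (p ^ n) x = mscale (p ^ n) (mscale (a / p ^ n) (mat 1) + mscale (p ^ m) r)"
    using r(3) pn by (simp add: mscale_add mscale_mscale power_add)
  then have xe: "x = mscale (a / p ^ n) (mat 1) + mscale (p ^ m) r" using mscale_cancel pn by blast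
  have "mscale (p ^ m) r \<in> R2" using m2 r(2) unfolding is_mod_def by simp
  then have Yr: "mscale (p ^ m) r \<in> Y" using Y(2) by (rule rev_subsetD)
  have "x \<in> X" "a / p ^ n \<in> K" using X(2) x r(1) pn by auto
  then have "a / p ^ n \<in> Ok" using integral_scalar_diff[OF X(1) Y(1) _ Yr xe] by simp
  then show "x \<in> spi m R2" using xe r(2) spiI by metis
next
  have pn: "p ^ n \<noteq> 0" "p ^ n \<in> K" using Kpow[OF pK] by simp_all
  fix y assume "y \<in> spi m R2"
  then obtain c r where r: "c \<in> Ok" "r \<in> R2" "y = mscale c (mat 1) + mscale (p ^ m) r" by (elim spiE)
  have "mscale 0 (mat 1) + mscale (p ^ (n + m)) r \<in> spi n R1" unfolding eq using r by (intro spiI) simp_all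
  then obtain a x where x: "a \<in> Ok" "x \<in> R1" "mscale 0 (mat 1) + mscale (p ^ (n + m)) r = mscale a (mat 1) + mscale (p ^ n) x" by (elim spiE)
  have "mscale (p ^ n) (mscale (p ^ m) r) = mscale (p ^ n) (mscale (a / p ^ n) (mat 1) + x)"
    using x(3) pn by (simp add: mscale_add mscale_mscale power_add)
  then have e: "mscale (p ^ m) r = mscale (a / p ^ n) (mat 1) + x" using mscale_cancel pn by blast
  have "mscale (p ^ m) r \<in> R2" using m2 r(2) unfolding is_mod_def by simp
  then have Yr: "mscale (p ^ m) r \<in> Y" using Y(2) by (rule rev_subsetD)
  have "x \<in> X" "a / p ^ n \<in> K" using X(2) x pn by auto
  then have a: "a / p ^ n \<in> Ok" using integral_scalar_diff[OF Y(1) X(1) Yr _ e] by simp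
  have "y = mscale (c + a / p ^ n) (mat 1) + x" unfolding r(3) e by (simp add: mscale_add_left add.assoc)
  moreover have "mscale (c + a / p ^ n) (mat 1) \<in> R1" using m1 a r(1) unfolding is_mod_def by simp
  ultimately show "y \<in> R1" using m1(1) x(2) unfolding is_mod_def by simp
qed

lemma spi_0: "is_mod Ok R \<Longrightarrow> mat 1 \<in> R \<Longrightarrow> spi 0 R = R"
proof (intro equalityI subsetI)
  assume R: "is_mod Ok R" "mat 1 \<in> R"
  show "x \<in> R" if "x \<in> spi 0 R" for x using that R unfolding is_mod_def by (elim spiE) simp
  show "x \<in> spi 0 R" if "x \<in> R" for x using spiI[of 0 x R 0] that by simp
qed

lemma spi_spi: "spi n (spi m R) = spi (n + m) R"
proof (intro equalityI subsetI)
  fix x assume "x \<in> spi n (spi m R)"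
  then obtain a b r where *: "a \<in> Ok" "b \<in> Ok" "r \<in> R" "x = mscale a (mat 1) + mscale (p ^ n) (mscale b (mat 1) + mscale (p ^ m) r)"
    by (elim spiE) auto
  have e: "x = mscale (a + p ^ n * b) (mat 1) + mscale (p ^ (n + m)) r"
    unfolding *(4) by (simp add: mscale_add mscale_mscale mscale_add_left power_add add.assoc)
  show "x \<in> spi (n + m) R" unfolding e using * by (intro spiI) simp_all
next
  fix x assume "x \<in> spi (n + m) R"
  then obtain a r where *: "a \<in> Ok" "r \<in> R" "x = mscale a (mat 1) + mscale (p ^ (n + m)) r" by (elim spiE)
  have e: "x = mscale a (mat 1) + mscale (p ^ n) (mscale 0 (mat 1) + mscale (p ^ m) r)"
    unfolding *(3) by (simp add: mscale_mscale power_add)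
  show "x \<in> spi n (spi m R)" unfolding e using * by (intro spiI) simp_all
qed

lemma gorenstein_full: "gorenstein K absv G \<Longrightarrow> full_order K absv G"
  unfolding gorenstein_def by blast

text \<open>Cancelling the smaller power leaves one of the two orders equal to
  \<open>O + p ^ d\<close> times the other, and \<open>spi_1_not_gorenstein\<close> forces
  \<open>d = 0\<close>.\<close>

lemma spi_gorenstein_unique:
  assumes G: "gorenstein K absv G" "gorenstein K absv G'" and eq: "spi n G = spi m G'"
  shows "G = G'"
proof -
  have le: "H = H'" if H: "gorenstein K absv H" "gorenstein K absv H'" and e: "spi a H = spi (a + d) H'" for H H' a d
  proof -
    note F = full_orderD[OF gorenstein_full[OF H(1)]] and F' = full_orderD[OF gorenstein_full[OF H(2)]]
    have HH: "H = spi d H'" using spi_strip[OF F(1) order_refl F'(1) order_refl F(4,3) F'(4) e] .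
    show ?thesis
    proof (cases d)
      case 0
      then show ?thesis using HH spi_0[OF F'(4,3)] by simp
    next
      case (Suc e)
      then have "H = spi 1 (spi e H')" using HH by (simp add: spi_spi)
      then show ?thesis using spi_1_not_gorenstein[OF spi_full_order[OF gorenstein_full[OF H(2)]]] H(1) by metis
    qed
  qed
  show ?thesis
  proof (cases "n \<le> m")
    case True
    then show ?thesis using le[OF G, of n "m - n"] eq by simp
  next
    case False
    then show ?thesis using le[OF G(2,1), of m "n - m"] eq by simp
  qed
qed

lemma exists_noncommuting:
  assumes R: "full_order K absv R"
  shows "\<exists>a\<in>R. \<exists>b\<in>R. dt (comm a b) \<noteq> 0"
proof -
  have M: "is_mod K {x \<in> mats K. \<exists>n. mscale (p ^ n) x \<in> R}"
    unfolding is_mod_def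
  proof (intro conjI ballI)
    note Rd = full_orderD[OF R]
    have up: "mscale (p ^ (n + m)) x \<in> R" if "mscale (p ^ n) x \<in> R" for n m x
      using Rd(9)[OF _ that, of "p ^ m"] by (simp add: mscale_mscale power_add mult.commute)
    show "0 \<in> {x \<in> mats K. \<exists>n. mscale (p ^ n) x \<in> R}" using Rd(4) unfolding is_mod_def by simp
    show "x + y \<in> {x \<in> mats K. \<exists>n. mscale (p ^ n) x \<in> R}"
      if xy: "x \<in> {x \<in> mats K. \<exists>n. mscale (p ^ n) x \<in> R}" "y \<in> {x \<in> mats K. \<exists>n. mscale (p ^ n) x \<in> R}" for x y
    proof -
      obtain n m where "mscale (p ^ n) x \<in> R" "mscale (p ^ m) y \<in> R" using xy by blast
      then have "mscale (p ^ (n + m)) x \<in> R" "mscale (p ^ (n + m)) y \<in> R" using up[of n x m] up[of m y n] by (simp_all add: add.commute)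
      then have "mscale (p ^ (n + m)) (x + y) \<in> R" using Rd(6) by (simp add: mscale_add)
      then show ?thesis using xy by auto
    qed
    show "mscale c x \<in> {x \<in> mats K. \<exists>n. mscale (p ^ n) x \<in> R}"
      if c: "c \<in> K" and x: "x \<in> {x \<in> mats K. \<exists>n. mscale (p ^ n) x \<in> R}" for c x
    proof -
      obtain n m where nm: "mscale (p ^ n) x \<in> R" "p ^ m * c \<in> Ok" using x decomp_K[OF c] by blast
      then have "mscale (p ^ m * c) (mscale (p ^ n) x) \<in> R" using Rd(9) by blast
      then have "mscale (p ^ (m + n)) (mscale c x) \<in> R" by (simp add: mscale_mscale power_add ac_simps)
      then show ?thesis using x c by auto
    qed
  qed
  have "R \<subseteq> {x \<in> mats K. \<exists>n. mscale (p ^ n) x \<in> R}"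
  proof
    fix x assume "x \<in> R"
    then have "mscale (p ^ 0) x \<in> R" "x \<in> mats K" using full_orderD(2)[OF R] by auto
    then show "x \<in> {x \<in> mats K. \<exists>n. mscale (p ^ n) x \<in> R}" by blast
  qed
  from lspan_least[OF M this] have all: "\<exists>n. mscale (p ^ n) x \<in> R" if "x \<in> mats K" for x
    using that full_orderD(5)[OF R] by blast
  obtain n m where "mscale (p ^ n) (mk 0 1 0 0) \<in> R" "mscale (p ^ m) (mk 0 0 1 0) \<in> R"
    using all[of "mk 0 1 0 0"] all[of "mk 0 0 1 0"] by auto
  moreover have "dt (comm (mscale (p ^ n) (mk 0 1 0 0)) (mscale (p ^ m) (mk 0 0 1 0))) \<noteq> 0"
    by (simp add: comm_def)
  ultimately show ?thesis by blast
qed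

text \<open>Take the largest \<open>n\<close> for which \<open>R\<close> has the form
  \<open>O + p ^ n H\<close>; then \<open>H\<close> is Gorenstein by
  \<open>not_gorenstein_spi\<close>. A nonzero determinant of a commutator of two elements of
  \<open>R\<close> bounds the exponents.\<close>

lemma exists_gorenstein_closure:
  assumes R: "full_order K absv R"
  shows "\<exists>n G. gorenstein K absv G \<and> R = spi n G"
proof -
  obtain a b where ab: "a \<in> R" "b \<in> R" "dt (comm a b) \<noteq> 0" using exists_noncommuting[OF R] by blast
  have "dt (comm a b) \<in> Ok" using full_orderD(11,13)[OF R] ab by blast
  then obtain N u where N: "u \<in> Ok" "\<not> O.vle u p" "dt (comm a b) = p ^ N * u" using decomp ab(3) by blast
  have bound: "n \<le> N" if H: "full_order K absv H" "R = spi n H" for n H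
  proof -
    obtain r r' s s' where rs: "r' \<in> H" "s' \<in> H" "a = mscale r (mat 1) + mscale (p ^ n) r'" "b = mscale s (mat 1) + mscale (p ^ n) s'"
      using ab(1,2) unfolding H(2) by (elim spiE) blast
    \<comment> \<open>Commutators gain the factor \<open>p ^ (2 * n)\<close> and their determinants
      its square; a single factor \<open>p ^ n\<close> is enough for the bound.\<close>
    have "dt (comm a b) = p ^ n * (p ^ n * p ^ n * p ^ n * dt (comm r' s'))"
      unfolding rs(3,4) by (cases r' rule: mk_cases; cases s' rule: mk_cases) (simp add: comm_def mk_one algebra_simps)
    moreover have "dt (comm r' s') \<in> Ok" using full_orderD(11,13)[OF H(1)] rs by blast
    ultimately obtain v where v: "v \<in> Ok" "dt (comm a b) = p ^ n * v" by (metis O.V.Smult O.V.Spower pO)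
    show "n \<le> N"
    proof (rule ccontr)
      assume n: "\<not> n \<le> N"
      then have "p ^ n = p ^ N * (p * p ^ (n - N - 1))" by (simp add: power_add[symmetric] power_Suc[symmetric] del: power_Suc)
      then have "u = p * (p ^ (n - N - 1) * v)" using v(2) N(3) by simp
      then show False using N(2) O.vle_self(1)[of "p ^ (n - N - 1) * v" p] v(1) by simp
    qed
  qed
  let ?P = "\<lambda>n. \<exists>H. full_order K absv H \<and> R = spi n H"
  have "?P 0" using R spi_0[OF full_orderD(4,3)[OF R]] by metis
  then have ex: "?P (GREATEST n. ?P n)" using bound by (intro GreatestI_nat[of ?P 0 N]) blast+
  define n where "n = (GREATEST n. ?P n)"
  obtain G where G: "full_order K absv G" "R = spi n G" using ex unfolding n_def by blast
  have "gorenstein K absv G"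
  proof (rule ccontr)
    assume "\<not> ?thesis"
    then obtain G' where G': "full_order K absv G'" "G = spi 1 G'" using not_gorenstein_spi[OF G(1)] by blast
    then have "?P (n + 1)" using G(2) by (auto simp: spi_spi)
    then have "n + 1 \<le> n" unfolding n_def using bound by (intro Greatest_le_nat[of ?P _ N]) blast+
    then show False by simp
  qed
  then show ?thesis using G by blast
qed

lemma nonzero_ideal_iff:
  "nonzero_ideal Ok I \<longleftrightarrow> (\<exists>n. I = {p ^ n * u | u. u \<in> Ok})"
proof
  assume I: "nonzero_ideal Ok I"
  then have I': "I \<subseteq> Ok" "I \<noteq> {}" "\<not> I \<subseteq> {0}" "\<And>a x. a \<in> Ok \<Longrightarrow> x \<in> I \<Longrightarrow> a * x \<in> I" unfolding nonzero_ideal_def by blast+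
  obtain d where d: "d \<in> I" "\<forall>c\<in>I. O.vle c d" using ex_max_Ok[OF I'(1,2)] by blast
  have "d \<noteq> 0" using d I'(3) unfolding O.vle_def by auto
  then obtain n u where u: "u \<in> Ok" "\<not> O.vle u p" "d = p ^ n * u" using decomp d(1) I'(1) by blast
  have ui: "u \<noteq> 0" "inverse u \<in> Ok" using unit_iff u by blast+
  have "I = {p ^ n * u | u. u \<in> Ok}"
  proof (intro equalityI subsetI)
    fix c assume "c \<in> I"
    then obtain v where "v \<in> Ok" "c = v * d" using d(2) unfolding O.vle_def by blast
    then have "c = p ^ n * (v * u)" "v * u \<in> Ok" using u by simp_all
    then show "c \<in> {p ^ n * u | u. u \<in> Ok}" by blast
  next
    fix c assume "c \<in> {p ^ n * u | u. u \<in> Ok}"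
    then obtain v where v: "v \<in> Ok" "c = p ^ n * v" by blast
    have "(v * inverse u) * d = c" using u(3) v ui by simp
    moreover have "(v * inverse u) * d \<in> I" using I'(4) d(1) v(1) ui(2) by simp
    ultimately show "c \<in> I" by simp
  qed
  then show "\<exists>n. I = {p ^ n * u | u. u \<in> Ok}" by blast
next
  assume "\<exists>n. I = {p ^ n * u | u. u \<in> Ok}"
  then obtain n where I: "I = {p ^ n * u | u. u \<in> Ok}" by blast
  have i: "u \<in> Ok \<Longrightarrow> p ^ n * u \<in> I" for u unfolding I by blast
  show "nonzero_ideal Ok I" unfolding nonzero_ideal_def
  proof (intro conjI ballI)
    show "I \<subseteq> Ok" unfolding I by auto
    show "0 \<in> I" using i[of 0] by simp
    show "I \<noteq> {0}" using i[of 1] by auto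
    show "x + y \<in> I" if "x \<in> I" "y \<in> I" for x y
      using that i unfolding I by (auto simp: distrib_left[symmetric])
    show "a * x \<in> I" if a: "a \<in> Ok" and x: "x \<in> I" for a x
    proof -
      obtain u where "u \<in> Ok" "x = p ^ n * u" using x unfolding I by blast
      then show ?thesis using i[of "a * u"] a by (simp add: mult.left_commute)
    qed
  qed
qed

lemma scalar_plus_ideal_spi:
  assumes R: "is_mod Ok R" and I: "I = {p ^ n * u | u. u \<in> Ok}"
  shows "scalar_plus_ideal Ok I R = spi n R"
proof -
  let ?M = "{mscale (p ^ n) r | r. r \<in> R}"
  have Mm: "is_mod Ok ?M"
    unfolding is_mod_def
  proof (intro conjI ballI)
    have "0 = mscale (p ^ n) 0" by simp
    then show "0 \<in> ?M" using R unfolding is_mod_def by blast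
    show "x + y \<in> ?M" if "x \<in> ?M" "y \<in> ?M" for x y
      using that R unfolding is_mod_def by (auto simp: mscale_add[symmetric])
    show "mscale c x \<in> ?M" if c: "c \<in> Ok" and x: "x \<in> ?M" for c x
    proof -
      obtain r where "r \<in> R" "x = mscale (p ^ n) r" using x by blast
      then have "mscale c x = mscale (p ^ n) (mscale c r)" "mscale c r \<in> R"
        using c R unfolding is_mod_def by (auto simp: mscale_mscale mult.commute)
      then show ?thesis by blast
    qed
  qed
  have L: "lspan Ok {mscale b r | b r. b \<in> I \<and> r \<in> R} = ?M"
  proof
    show "lspan Ok {mscale b r | b r. b \<in> I \<and> r \<in> R} \<subseteq> ?M"
    proof (rule lspan_least[OF Mm], rule subsetI)
      fix x assume "x \<in> {mscale b r | b r. b \<in> I \<and> r \<in> R}"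
      then obtain u r where "u \<in> Ok" "r \<in> R" "x = mscale (p ^ n * u) r" unfolding I by blast
      then have "x = mscale (p ^ n) (mscale u r)" "mscale u r \<in> R" using R unfolding is_mod_def by (auto simp: mscale_mscale)
      then show "x \<in> ?M" by blast
    qed
    have "p ^ n \<in> I" unfolding I using O.V.S1 by force
    then show "?M \<subseteq> lspan Ok {mscale b r | b r. b \<in> I \<and> r \<in> R}"
      by (auto intro!: lspan_base)
  qed
  show ?thesis unfolding scalar_plus_ideal_def L spi_def by auto
qed

lemma gor_closure_eq:
  assumes G: "gorenstein K absv G"
  shows "gor_closure K absv (spi n G) = G"
  unfolding gor_closure_def
proof (rule the_equality)
  show "gorenstein K absv G \<and> (\<exists>I. nonzero_ideal Ok I \<and> spi n G = scalar_plus_ideal Ok I G)"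
  proof (intro conjI G exI)
    show "nonzero_ideal Ok {p ^ n * u | u. u \<in> Ok}" unfolding nonzero_ideal_iff by blast
    show "spi n G = scalar_plus_ideal Ok {p ^ n * u | u. u \<in> Ok} G"
      using scalar_plus_ideal_spi[OF full_orderD(4)[OF gorenstein_full[OF G]] refl] ..
  qed
next
  fix G' assume *: "gorenstein K absv G' \<and> (\<exists>I. nonzero_ideal Ok I \<and> spi n G = scalar_plus_ideal Ok I G')"
  then obtain I where I: "gorenstein K absv G'" "nonzero_ideal Ok I" "spi n G = scalar_plus_ideal Ok I G'" by blast
  then obtain m where "I = {p ^ m * u | u. u \<in> Ok}" using nonzero_ideal_iff by blast
  then have "spi n G = spi m G'" using scalar_plus_ideal_spi[OF full_orderD(4)[OF gorenstein_full[OF I(1)]]] I(3) by simp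
  then show "G' = G" using spi_gorenstein_unique[OF G I(1)] by blast
qed

end

section \<open>Ghost intersections have Bass Gorenstein closure\<close>

context valring
begin

definition unimodular :: "'a^2^2 \<Rightarrow> bool" where
  "unimodular A \<longleftrightarrow> A \<in> mats V \<and> (\<exists>A'\<in>mats V. A ** A' = mat 1 \<and> A' ** A = mat 1)"

lemma unimodular_mult: "unimodular A \<Longrightarrow> unimodular B \<Longrightarrow> unimodular (A ** B)"
proof -
  assume "unimodular A" "unimodular B"
  then obtain A' B' where *: "A \<in> mats V" "A' \<in> mats V" "A ** A' = mat 1" "A' ** A = mat 1"
    "B \<in> mats V" "B' \<in> mats V" "B ** B' = mat 1" "B' ** B = mat 1" unfolding unimodular_def by blast
  have "(A ** B) ** (B' ** A') = A ** (B ** B') ** A'" "(B' ** A') ** (A ** B) = B' ** (A' ** A) ** B"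
    by (simp_all only: matrix_mul_assoc)
  then have "(A ** B) ** (B' ** A') = mat 1" "(B' ** A') ** (A ** B) = mat 1" using * by simp_all
  moreover have "A ** B \<in> mats V" "B' ** A' \<in> mats V" using * by simp_all
  ultimately show ?thesis unfolding unimodular_def by blast
qed

text \<open>Elimination with an entry of largest size as pivot. \<open>base\<close> treats a pivot
  in the upper left corner; the swap \<open>S\<close> on the left or right brings the other three
  positions there.\<close>

lemma elementary_divisors:
  assumes h: "h \<in> mats F" "dt h \<noteq> 0"
  shows "\<exists>A B a b. unimodular A \<and> unimodular B \<and> a \<in> F \<and> b \<in> F \<and> a \<noteq> 0 \<and> b \<noteq> 0 \<and> h = A ** mk a 0 0 b ** B"
proof -
  have base: "\<exists>A B a b. unimodular A \<and> unimodular B \<and> a \<in> F \<and> b \<in> F \<and> a \<noteq> 0 \<and> b \<noteq> 0 \<and> mk x y z w = A ** mk a 0 0 b ** B"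
    if F: "x \<in> F" "y \<in> F" "z \<in> F" "w \<in> F" and d: "x * w - y * z \<noteq> 0" and v: "vle y x" "vle z x" for x y z w
  proof -
    have x: "x \<noteq> 0" using d v unfolding vle_def by auto
    have V: "y / x \<in> V" "z / x \<in> V" using v x by (simp_all add: vle_div)
    have "mk 1 0 (z / x) 1 ** mk 1 0 (- (z / x)) 1 = mat 1" "mk 1 0 (- (z / x)) 1 ** mk 1 0 (z / x) 1 = mat 1"
      "mk 1 (y / x) 0 1 ** mk 1 (- (y / x)) 0 1 = mat 1" "mk 1 (- (y / x)) 0 1 ** mk 1 (y / x) 0 1 = mat 1"
      by (simp_all add: mk_one)
    moreover have "mk 1 0 (- (z / x)) 1 \<in> mats V" "mk 1 (- (y / x)) 0 1 \<in> mats V"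
      "mk 1 0 (z / x) 1 \<in> mats V" "mk 1 (y / x) 0 1 \<in> mats V"
      using V V.Suminus[OF V(1)] V.Suminus[OF V(2)] by simp_all
    ultimately have "unimodular (mk 1 0 (z / x) 1)" "unimodular (mk 1 (y / x) 0 1)"
      unfolding unimodular_def by blast+
    moreover have "mk x y z w = mk 1 0 (z / x) 1 ** mk x 0 0 (w - y * z / x) ** mk 1 (y / x) 0 1"
      using x by (simp add: field_simps)
    moreover have "w - y * z / x \<noteq> 0" using d x by (simp add: field_simps)
    moreover have "w - y * z / x \<in> F" using F by simp
    ultimately show ?thesis using x F by blast
  qed
  define S where "S = mk 0 1 1 (0::'a)"
  have SS: "S ** S = mat 1" by (simp add: S_def mk_one)
  have US: "unimodular S" unfolding unimodular_def
    by (intro conjI bexI[of _ S] SS) (simp_all add: S_def)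
  obtain x y z w where hx: "h = mk x y z w" by (rule mk_cases)
  have F: "x \<in> F" "y \<in> F" "z \<in> F" "w \<in> F" and d: "x * w - y * z \<noteq> 0" using h by (simp_all add: hx)
  have "\<exists>m\<in>{x,y,z,w}. \<forall>u\<in>{x,y,z,w}. vle u m" using F by (intro ex_max) auto
  then consider "vle y x" "vle z x" | "vle x y" "vle w y" | "vle x z" "vle w z" | "vle y w" "vle z w" by auto
  then show ?thesis
  proof cases
    case 1
    then show ?thesis unfolding hx using base[OF F d] by blast
  next
    case 2
    have "y * z - x * w \<noteq> 0" using d by (simp add: algebra_simps)
    then obtain A B a b where *: "unimodular A" "unimodular B" "a \<in> F" "b \<in> F" "a \<noteq> 0" "b \<noteq> 0" "mk y x w z = A ** mk a 0 0 b ** B"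
      using base[of y x w z] F 2 by blast
    have "h = mk y x w z ** S" by (simp add: hx S_def)
    then have "h = A ** mk a 0 0 b ** (B ** S)" unfolding *(7) by (simp add: matrix_mul_assoc)
    then show ?thesis using * unimodular_mult US by blast
  next
    case 3
    have "z * y - w * x \<noteq> 0" using d by (simp add: algebra_simps)
    then obtain A B a b where *: "unimodular A" "unimodular B" "a \<in> F" "b \<in> F" "a \<noteq> 0" "b \<noteq> 0" "mk z w x y = A ** mk a 0 0 b ** B"
      using base[of z w x y] F 3 by blast
    have "h = S ** mk z w x y" by (simp add: hx S_def)
    then have "h = (S ** A) ** mk a 0 0 b ** B" unfolding *(7) by (simp add: matrix_mul_assoc)
    then show ?thesis using * unimodular_mult US by blast
  next
    case 4
    have "w * x - z * y \<noteq> 0" using d by (simp add: algebra_simps)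
    then obtain A B a b where *: "unimodular A" "unimodular B" "a \<in> F" "b \<in> F" "a \<noteq> 0" "b \<noteq> 0" "mk w z y x = A ** mk a 0 0 b ** B"
      using base[of w z y x] F 4 by blast
    have "h = S ** mk w z y x ** S" by (simp add: hx S_def)
    then have "h = (S ** A) ** mk a 0 0 b ** (B ** S)" unfolding *(7) by (simp add: matrix_mul_assoc)
    then show ?thesis using * unimodular_mult US by blast
  qed
qed

text \<open>With respect to a basis adapted to both lattices the condition on \<open>x\<close> only bounds the two
  off-diagonal entries, and such bounds are stable under products of integral matrices.\<close>

lemma scaled_conj_mult:
  assumes h: "inv_pair h h'" and xy: "x \<in> mats V" "y \<in> mats V"
    and s: "mscale n (h' ** x ** h) \<in> mats V" "mscale n (h' ** y ** h) \<in> mats V" and n: "n \<in> V"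
  shows "mscale n (h' ** (x ** y) ** h) \<in> mats V"
proof -
  have hh: "h \<in> mats F" "h' \<in> mats F" "h ** h' = mat 1" "h' ** h = mat 1" using h unfolding inv_pair_def by auto
  have "dt h * dt h' = 1" using hh(3) by (metis dt_mult dt_one)
  then have "dt h \<noteq> 0" by auto
  then obtain A B a b where *: "unimodular A" "unimodular B" "a \<in> F" "b \<in> F" "a \<noteq> 0" "b \<noteq> 0" "h = A ** mk a 0 0 b ** B"
    using elementary_divisors[OF hh(1)] by blast
  obtain A' where A': "A \<in> mats V" "A' \<in> mats V" "A ** A' = mat 1" "A' ** A = mat 1" using *(1) unfolding unimodular_def by blast
  obtain B' where B': "B \<in> mats V" "B' \<in> mats V" "B ** B' = mat 1" "B' ** B = mat 1" using *(2) unfolding unimodular_def by blast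
  let ?d = "mk a 0 0 b" and ?d' = "mk (inverse a) 0 0 (inverse b)"
  have dd: "?d ** ?d' = mat 1" "?d' ** ?d = mat 1" using * by (simp_all add: mk_one)
  have "(B' ** ?d' ** A') ** h = B' ** (?d' ** (A' ** A) ** ?d) ** B" unfolding *(7) by (simp only: matrix_mul_assoc)
  then have hinv: "(B' ** ?d' ** A') ** h = mat 1" using A' B' dd by simp
  have "h' = (B' ** ?d' ** A') ** h ** h'" unfolding hinv by simp
  also have "\<dots> = B' ** ?d' ** A'" using hh(3) by (simp add: matrix_mul_assoc[symmetric])
  finally have h': "h' = B' ** ?d' ** A'" .
  have conj: "mscale n (h' ** u ** h) \<in> mats V \<longleftrightarrow> mscale n (?d' ** (A' ** u ** A) ** ?d) \<in> mats V" for u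
  proof -
    have e: "mscale n (h' ** u ** h) = B' ** mscale n (?d' ** (A' ** u ** A) ** ?d) ** B"
      unfolding h' *(7) by (simp add: mat_lin matrix_mul_assoc)
    have "B ** mscale n (h' ** u ** h) ** B' = mscale n (?d' ** (A' ** u ** A) ** ?d)"
      unfolding e using conj_cancel[OF B'(3), of "mscale n (?d' ** (A' ** u ** A) ** ?d)"] .
    then show ?thesis using e B' V.mats_mult by metis
  qed
  have entries: "mscale n (?d' ** u ** ?d) \<in> mats V \<longleftrightarrow> n * (inverse a * b) * u$1$2 \<in> V \<and> n * (inverse b * a) * u$2$1 \<in> V"
    if "u \<in> mats V" for u
    using that n * by (cases u rule: mk_cases) (simp add: field_simps)
  define X Y where "X = A' ** x ** A" and "Y = A' ** y ** A"
  have XY: "X \<in> mats V" "Y \<in> mats V" unfolding X_def Y_def using A' xy by simp_all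
  have prod: "A' ** (x ** y) ** A = X ** Y" unfolding X_def Y_def by (rule conj_mult[OF A'(3)])
  have i: "n * (inverse a * b) * X$1$2 \<in> V" "n * (inverse b * a) * X$2$1 \<in> V"
    "n * (inverse a * b) * Y$1$2 \<in> V" "n * (inverse b * a) * Y$2$1 \<in> V"
    using s entries XY unfolding conj X_def Y_def by blast+
  obtain x1 x2 x3 x4 where X: "X = mk x1 x2 x3 x4" by (rule mk_cases)
  obtain y1 y2 y3 y4 where Y: "Y = mk y1 y2 y3 y4" by (rule mk_cases)
  have V: "x1 \<in> V" "x4 \<in> V" "y1 \<in> V" "y4 \<in> V" using XY unfolding X Y by simp_all
  note i' = i[unfolded X Y mk_nth]
  \<comment> \<open>Each summand of an off-diagonal entry of \<open>X ** Y\<close> is an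
    off-diagonal entry of one factor, already bounded, times a diagonal entry of the other, which is
    integral.\<close>
  have "x1 * (n * (inverse a * b) * y2) + (n * (inverse a * b) * x2) * y4 \<in> V"
    "(n * (inverse b * a) * x3) * y1 + x4 * (n * (inverse b * a) * y3) \<in> V"
    by (rule V.Sadd[OF V.Smult[OF V(1) i'(3)] V.Smult[OF i'(1) V(4)]],
        rule V.Sadd[OF V.Smult[OF i'(2) V(3)] V.Smult[OF V(2) i'(4)]])
  then have "n * (inverse a * b) * (X ** Y)$1$2 \<in> V \<and> n * (inverse b * a) * (X ** Y)$2$1 \<in> V"
    unfolding X Y by (simp add: algebra_simps)
  then show ?thesis unfolding conj prod using entries XY by simp
qed

end

context local_field
begin

lemma full_order_mono:
  assumes "full_order K absv G" "is_order Ok K R" "G \<subseteq> R"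
  shows "full_order K absv R"
proof -
  have "lspan K R \<subseteq> mats K" using assms(2) unfolding is_order_def by (intro lspan_least[OF O.F.mats_is_mod]) blast
  moreover have "mats K \<subseteq> lspan K R" using full_orderD(5)[OF assms(1)] lspan_mono[OF order_refl assms(3)] by metis
  ultimately show ?thesis using assms(2) unfolding full_order_def full_order_over_def by blast
qed

text \<open>The algebraic part of the first implication; the assumption \<open>ring\<close> is what
  being a ghost intersection contributes. Comparing \<open>R = O + p ^ Suc k R1\<close> with
  \<open>R = O + p ^ k G\<close> gives \<open>G = O + p R1\<close>. That \<open>R1\<close> is a full
  lattice is seen by dividing the non-scalar parts of a basis of \<open>G\<close> by
  \<open>p\<close>.\<close>

lemma cmats_absorb:
  assumes PQ: "O.inv_pair P Q" and R: "full_order K absv R" and G: "full_order K absv G" "R = spi k G"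
    and RX: "R \<subseteq> spi (Suc k) (O.cmats P Q)"
    and ring: "\<And>x y. x \<in> O.cmats P Q \<Longrightarrow> y \<in> O.cmats P Q \<Longrightarrow> mscale (p ^ Suc k) x \<in> R \<Longrightarrow> mscale (p ^ Suc k) y \<in> R
       \<Longrightarrow> mscale (p ^ Suc k) (x ** y) \<in> R"
  shows "\<exists>R1. full_order K absv R1 \<and> G = spi 1 R1"
proof -
  let ?X = "O.cmats P Q"
  define R1 where "R1 = {x \<in> ?X. mscale (p ^ Suc k) x \<in> R}"
  have Xo: "is_order Ok K ?X" using O.cmats_order[OF PQ] .
  note Xu = Xo[unfolded is_order_def]
  have Xm: "is_mod Ok ?X" using O.order_mod[OF Xo] .
  note Rd = full_orderD[OF R] and Gd = full_orderD[OF G(1)]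
  have RR1: "R = spi (Suc k) R1"
  proof (intro equalityI subsetI)
    fix x assume x: "x \<in> R"
    then obtain a y where y: "a \<in> Ok" "y \<in> ?X" "x = mscale a (mat 1) + mscale (p ^ Suc k) y" using RX by (blast elim: spiE)
    have "mscale (p ^ Suc k) y = x - mscale a (mat 1)" unfolding y(3) by simp
    then have "mscale (p ^ Suc k) y \<in> R" using Rd(7) Rd(12)[OF y(1)] x by simp
    then show "x \<in> spi (Suc k) R1" unfolding y(3) using y by (intro spiI) (simp_all add: R1_def)
  next
    fix x assume "x \<in> spi (Suc k) R1"
    then obtain a y where "a \<in> Ok" "y \<in> R1" "x = mscale a (mat 1) + mscale (p ^ Suc k) y" by (elim spiE)
    then show "x \<in> R" using Rd(6) Rd(12) unfolding R1_def by simp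
  qed
  have R1m: "is_mod Ok R1"
    unfolding is_mod_def R1_def
  proof (intro conjI ballI)
    show "0 \<in> {x \<in> ?X. mscale (p ^ Suc k) x \<in> R}" using Xm Rd(4) unfolding is_mod_def by simp
    show "x + y \<in> {x \<in> ?X. mscale (p ^ Suc k) x \<in> R}" if "x \<in> {x \<in> ?X. mscale (p ^ Suc k) x \<in> R}" "y \<in> {x \<in> ?X. mscale (p ^ Suc k) x \<in> R}" for x y
      using that Xm Rd(6) unfolding is_mod_def by (simp add: mscale_add)
    show "mscale c x \<in> {x \<in> ?X. mscale (p ^ Suc k) x \<in> R}" if "c \<in> Ok" "x \<in> {x \<in> ?X. mscale (p ^ Suc k) x \<in> R}" for c x
    proof -
      have "mscale c (mscale (p ^ Suc k) x) \<in> R" using that Rd(9) by blast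
      then show ?thesis using that Xm unfolding is_mod_def by (simp add: mscale_mscale mult.commute)
    qed
  qed
  have one1: "mat 1 \<in> R1" unfolding R1_def using Xu Rd(12)[of "p ^ Suc k"] by simp
  have sub: "R1 \<subseteq> ?X" unfolding R1_def by blast
  have e: "spi k G = spi (k + 1) R1" using RR1 G(2) by simp
  have GG: "G = spi 1 R1" using spi_strip[OF Gd(1) order_refl Xo sub Gd(4,3) R1m e] .
  have mult1: "x ** y \<in> R1" if "x \<in> R1" "y \<in> R1" for x y
    using that ring Xu unfolding R1_def by blast
  obtain i j k' where ijk: "i \<in> mats K" "j \<in> mats K" "k' \<in> mats K" "tri i j k' \<noteq> 0" "G = latt i j k'"
    using full_order_latt[OF G(1)] by blast
  have ex: "\<exists>a r. r \<in> R1 \<and> x = mscale a (mat 1) + mscale p r" if "x \<in> G" for x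
    using that unfolding GG by (elim spiE) auto
  obtain a1 i1 a2 j1 a3 k1 where 1: "i1 \<in> R1" "i = mscale a1 (mat 1) + mscale p i1" "j1 \<in> R1" "j = mscale a2 (mat 1) + mscale p j1"
      "k1 \<in> R1" "k' = mscale a3 (mat 1) + mscale p k1"
    using ex latt_gens unfolding ijk(5) by metis
  have L: "R1 = latt i1 j1 k1"
  proof
    show "latt i1 j1 k1 \<subseteq> R1" using latt_least[OF R1m one1] 1 by blast
    show "R1 \<subseteq> latt i1 j1 k1"
    proof
      fix x assume x: "x \<in> R1"
      then have "mscale 0 (mat 1) + mscale (p ^ 1) x \<in> G" unfolding GG by (intro spiI) simp_all
      then obtain a b c d where abcd: "a \<in> Ok" "b \<in> Ok" "c \<in> Ok" "d \<in> Ok" "mscale p x = lin i j k' a b c d"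
        unfolding ijk(5) by (elim lattE) simp
      let ?s = "a + b * a1 + c * a2 + d * a3"
      have "mscale p x = mscale ?s (mat 1) + mscale p (lin i1 j1 k1 0 b c d)"
        unfolding abcd(5) 1 lin_def by (simp add: mscale_add mscale_mscale mscale_add_left mult.commute add.assoc add.left_commute)
      then have "mscale p x = mscale p (mscale (?s / p) (mat 1) + lin i1 j1 k1 0 b c d)" by (simp add: mscale_add mscale_mscale)
      then have xe: "x = mscale (?s / p) (mat 1) + lin i1 j1 k1 0 b c d" using mscale_cancel p_nz by blast
      have l: "lin i1 j1 k1 0 b c d \<in> R1" using abcd 1 by (intro lin_in_mod[OF R1m one1]) simp_all
      have "mscale (?s / p) (mat 1) = x - lin i1 j1 k1 0 b c d" using xe by simp
      then have "mscale (?s / p) (mat 1) \<in> ?X" using mod_diff[OF R1m x l] sub by auto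
      moreover then have "mscale (?s / p) (mat 1) \<in> mats K" using Xu by blast
      then have "?s / p \<in> K" by (simp add: mk_one)
      ultimately have "?s / p \<in> Ok" using O.scalar_in_order[OF Xo] by blast
      then show "x \<in> latt i1 j1 k1" using abcd xe lattI[of "?s / p" b c d i1 j1 k1]
        by (simp add: lin_zero_shift[of i1 j1 k1 "?s / p"])
    qed
  qed
  have "tri i j k' = p * (p * (p * tri i1 j1 k1))" unfolding 1 by (simp add: tri_add tri_scale)
  then have "tri i1 j1 k1 \<noteq> 0" using ijk(4) by auto
  moreover have "i1 \<in> mats K" "j1 \<in> mats K" "k1 \<in> mats K" using 1 sub Xu by blast+
  moreover have "x ** y \<in> latt i1 j1 k1" if "x \<in> {i1,j1,k1}" "y \<in> {i1,j1,k1}" for x y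
    using that mult1 1 unfolding L[symmetric] by blast
  ultimately have "full_order K absv (latt i1 j1 k1)" by (intro latt_order)
  then show ?thesis using GG L by blast
qed

lemma ghost_imp_bass:
  assumes R: "full_order K absv R" and ghost: "ghost_intersection K absv R"
  shows "bass_order K absv (gor_closure K absv R)"
proof -
  obtain k G where G: "gorenstein K absv G" "R = spi k G" using exists_gorenstein_closure[OF R] by blast
  have GR: "gor_closure K absv R = G" unfolding G(2) by (rule gor_closure_eq[OF G(1)])
  have Gf: "full_order K absv G" using gorenstein_full[OF G(1)] .
  obtain L Ds where L: "finite_extension K L" and Ds: "\<forall>D\<in>Ds. maximal_order_over (ext_integers K absv L) L D" "R = mats K \<inter> \<Inter>Ds"
    using ghost unfolding ghost_intersection_def by blast
  interpret E: valring "ext_integers K absv L" L using valring_ext[OF L] .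
  have KL: "K \<subseteq> L" using L unfolding finite_extension_def by blast
  have OE: "Ok \<subseteq> ext_integers K absv L" using ext_integers_K[OF L] O.VF by blast
  have mKL: "x \<in> mats K \<Longrightarrow> x \<in> mats L" for x using KL by (auto simp: mats_def)
  have mOE: "x \<in> mats Ok \<Longrightarrow> x \<in> mats (ext_integers K absv L)" for x using OE by (auto simp: mats_def)
  show ?thesis unfolding GR bass_order_def
  proof (intro conjI allI impI Gf)
    fix R' assume R': "is_order Ok K R' \<and> G \<subseteq> R'"
    then have Rf': "full_order K absv R'" using full_order_mono[OF Gf] by blast
    show "gorenstein K absv R'"
    proof (rule ccontr)
      assume "\<not> gorenstein K absv R'"
      then obtain R'' where R'': "full_order K absv R''" "R' = spi 1 R''" using not_gorenstein_spi[OF Rf'] by blast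
      \<comment> \<open>Enlarging \<open>R''\<close> to a maximal order turns
        \<open>G \<subseteq> O + p R''\<close> into an inclusion of \<open>R\<close> in
        \<open>O + p ^ Suc k\<close> times that maximal order.\<close>
      obtain P Q where PQ: "O.inv_pair P Q" "\<forall>x\<in>R''. Q ** x ** P \<in> mats Ok"
        using O.order_in_conj[OF full_orderD(1)[OF R''(1)]] unfolding O.inv_pair_def by blast
      have "R'' \<subseteq> O.cmats P Q" using PQ(2) full_orderD(2)[OF R''(1)] unfolding O.cmats_def by blast
      then have "spi (k + 1) R'' \<subseteq> spi (k + 1) (O.cmats P Q)" unfolding spi_def by blast
      moreover have "R \<subseteq> spi k (spi 1 R'')" unfolding G(2) using R' R''(2) unfolding spi_def by blast
      ultimately have RX: "R \<subseteq> spi (Suc k) (O.cmats P Q)" by (simp add: spi_spi)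
      have PQi: "P \<in> mats K" "Q \<in> mats K" "P ** Q = mat 1" "Q ** P = mat 1" using PQ(1) unfolding O.inv_pair_def by auto
      have "\<exists>R1. full_order K absv R1 \<and> G = spi 1 R1"
      proof (rule cmats_absorb[OF PQ(1) R Gf G(2) RX])
        let ?n = "p ^ Suc k"
        fix x y assume x: "x \<in> O.cmats P Q" and y: "y \<in> O.cmats P Q" and nx: "mscale ?n x \<in> R" and ny: "mscale ?n y \<in> R"
        have xK: "x \<in> mats K" "y \<in> mats K" "Q ** x ** P \<in> mats Ok" "Q ** y ** P \<in> mats Ok" using x y unfolding O.cmats_def by auto
        have "mscale ?n (x ** y) \<in> D" if D: "D \<in> Ds" for D
        proof -
          obtain g g' where g: "E.inv_pair g g'" "D = E.cmats g g'" using E.maximal_is_cmats Ds(1) D by blast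
          have gi: "g \<in> mats L" "g' \<in> mats L" "g ** g' = mat 1" "g' ** g = mat 1" using g(1) unfolding E.inv_pair_def by auto
          \<comment> \<open>In the coordinates in which the maximal order over K is M_2(O), the
            order \<open>D\<close> becomes the conjugate of M_2(O_L) by \<open>h\<close>. Then
            \<open>x\<close> and \<open>y\<close> are integral matrices, as
            \<open>scaled_conj_mult\<close> demands.\<close>
          define h h' where "h = Q ** g" and "h' = g' ** P"
          have "(Q ** g) ** (g' ** P) = Q ** (g ** g') ** P" "(g' ** P) ** (Q ** g) = g' ** (P ** Q) ** g"
            by (simp_all only: matrix_mul_assoc)
          then have "h ** h' = mat 1" "h' ** h = mat 1" unfolding h_def h'_def using gi PQi by simp_all
          then have hp: "E.inv_pair h h'" unfolding E.inv_pair_def h_def h'_def using gi PQi mKL by simp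
          have mem: "mscale ?n z \<in> D \<longleftrightarrow> mscale ?n (h' ** (Q ** z ** P) ** h) \<in> mats (ext_integers K absv L)" if z: "z \<in> mats K" for z
          proof -
            have "h' ** (Q ** z ** P) ** h = g' ** (P ** (Q ** z ** P) ** Q) ** g"
              unfolding h_def h'_def by (simp only: matrix_mul_assoc)
            then have "h' ** (Q ** z ** P) ** h = g' ** z ** g" using conj_cancel[OF PQi(3)] by simp
            moreover have "mscale ?n z \<in> mats L" using z mKL Kpow[OF pK] by simp
            ultimately show ?thesis unfolding g(2) E.cmats_def by (simp add: mat_lin)
          qed
          have "mscale ?n x \<in> D" "mscale ?n y \<in> D" using nx ny Ds(2) D by blast+
          then have "mscale ?n (h' ** ((Q ** x ** P) ** (Q ** y ** P)) ** h) \<in> mats (ext_integers K absv L)"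
            using mem[OF xK(1)] mem[OF xK(2)] OE O.V.Spower[OF pO, of "Suc k"]
            by (intro E.scaled_conj_mult[OF hp mOE[OF xK(3)] mOE[OF xK(4)]]) blast+
          then show ?thesis using mem[of "x ** y"] xK O.conj_mult[OF PQi(3), of x y] by simp
        qed
        moreover have "mscale ?n (x ** y) \<in> mats K" using xK Kpow[OF pK] by simp
        ultimately show "mscale ?n (x ** y) \<in> R" unfolding Ds(2) by blast
      qed
      then show False using spi_1_not_gorenstein G(1) by metis
    qed
  qed
qed

end

section \<open>Orders with Bass Gorenstein closure are ghost intersections\<close>

context local_field
begin

text \<open>For an integral matrix: membership in \<open>O + p\<close> M_2(O).\<close>

definition scalarmod :: "'a^2^2 \<Rightarrow> bool" where
  "scalarmod a \<longleftrightarrow> O.vle (a$1$2) p \<and> O.vle (a$2$1) p \<and> O.vle (a$1$1 - a$2$2) p"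

lemma inv_pair_mult:
  assumes "O.inv_pair P Q" "O.inv_pair U U'"
  shows "O.inv_pair (P ** U) (U' ** Q)"
proof -
  note * = assms[unfolded O.inv_pair_def]
  have "(P ** U) ** (U' ** Q) = P ** (U ** U') ** Q" "(U' ** Q) ** (P ** U) = U' ** (Q ** P) ** U"
    by (simp_all only: matrix_mul_assoc)
  then have "(P ** U) ** (U' ** Q) = mat 1" "(U' ** Q) ** (P ** U) = mat 1" using * by simp_all
  then show ?thesis unfolding O.inv_pair_def using * by simp
qed

lemma bass_not_in_spi:
  assumes G: "bass_order K absv G" and PQ: "O.inv_pair P Q" and sub: "\<And>x. x \<in> G \<Longrightarrow> Q ** x ** P \<in> mats Ok"
  shows "\<exists>x\<in>G. \<not> scalarmod (Q ** x ** P)"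
proof (rule ccontr)
  assume n: "\<not> ?thesis"
  have Gf: "full_order K absv G" using G unfolding bass_order_def by blast
  let ?X = "O.cmats P Q"
  have GX: "G \<subseteq> ?X" using sub full_orderD(2)[OF Gf] unfolding O.cmats_def by blast
  have Xf: "full_order K absv ?X" by (rule full_order_mono[OF Gf O.cmats_order[OF PQ] GX])
  note i = PQ[unfolded O.inv_pair_def]
  have "G \<subseteq> spi 1 ?X"
  proof
    fix x assume x: "x \<in> G"
    obtain a b c d where a: "Q ** x ** P = mk a b c d" by (rule mk_cases)
    have V: "a \<in> Ok" "b \<in> Ok" "c \<in> Ok" "d \<in> Ok" using sub[OF x] unfolding a by simp_all
    have "O.vle b p" "O.vle c p" "O.vle (a - d) p" using n x unfolding scalarmod_def by (metis a mk_nth)+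
    then obtain b' c' d' where e: "b' \<in> Ok" "b = b' * p" "c' \<in> Ok" "c = c' * p" "d' \<in> Ok" "a - d = d' * p"
      unfolding O.vle_def by blast
    have d: "d = a + p * (- d')" using e(6) by (simp add: algebra_simps)
    let ?y = "P ** mk 0 b' c' (- d') ** Q"
    have "Q ** x ** P = mscale a (mat 1) + mscale p (mk 0 b' c' (- d'))"
      unfolding a d e(2,4) by (simp add: mk_one mult.commute)
    then have "P ** (Q ** x ** P) ** Q = P ** (mscale a (mat 1) + mscale p (mk 0 b' c' (- d'))) ** Q" by (rule arg_cong)
    also have "\<dots> = mscale a (P ** Q) + mscale p ?y" by (simp only: mat_lin matrix_mul_rid)
    finally have "P ** (Q ** x ** P) ** Q = mscale a (P ** Q) + mscale p ?y" .
    then have xe: "x = mscale a (mat 1) + mscale (p ^ 1) ?y" using conj_cancel[of P Q x] i by simp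
    have "Q ** ?y ** P = mk 0 b' c' (- d')" using conj_cancel[of Q P] i by simp
    moreover have "mk 0 b' c' (- d') \<in> mats Ok" using e by simp
    moreover then have "?y \<in> mats K" using i O.matsVF by simp
    ultimately have "?y \<in> ?X" unfolding O.cmats_def by simp
    then show "x \<in> spi 1 ?X" using spiI[OF V(1)] xe by metis
  qed
  moreover have "is_order Ok K (spi 1 ?X)" using full_orderD(1)[OF spi_full_order[OF Xf]] .
  ultimately have "gorenstein K absv (spi 1 ?X)" using G unfolding bass_order_def by blast
  then show False using spi_1_not_gorenstein[OF Xf] by blast
qed

text \<open>The new basis consists of \<open>(a - mtrace a) u\<close> and \<open>u\<close> for a
  vector \<open>u = (s, t)\<close>. Its determinant \<open>e\<close> is, up to sign, the binary
  quadratic form with coefficients \<open>z\<close>, \<open>w - x\<close>, \<open>- y\<close>. As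
  \<open>a\<close> is not scalar modulo \<open>p\<close>, these are not all divisible by
  \<open>p\<close>, so \<open>e\<close> is a unit at \<open>(1,0)\<close>, \<open>(0,1)\<close> or
  \<open>(1,1)\<close>.\<close>

lemma companion:
  assumes a: "a \<in> mats Ok" and ns: "\<not> scalarmod a"
  shows "\<exists>U U'. O.inv_pair U U' \<and> U \<in> mats Ok \<and> U' \<in> mats Ok \<and> U' ** a ** U = mk 0 1 (- dt a) (mtrace a)"
proof -
  obtain x y z w where ax: "a = mk x y z w" by (rule mk_cases)
  have V: "x \<in> Ok" "y \<in> Ok" "z \<in> Ok" "w \<in> Ok" using a by (simp_all add: ax)
  have step: "\<exists>U U'. O.inv_pair U U' \<and> U \<in> mats Ok \<and> U' \<in> mats Ok \<and> U' ** a ** U = mk 0 1 (- dt a) (mtrace a)"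
    if st: "s \<in> Ok" "t \<in> Ok" and u: "\<not> O.vle (z * s * s + (w - x) * s * t - y * t * t) p" for s t
  proof -
    define e where "e = - (z * s * s + (w - x) * s * t - y * t * t)"
    have eO: "e \<in> Ok" unfolding e_def using V st by simp
    have ei: "e \<noteq> 0" "inverse e \<in> Ok" using unit_iff[OF eO] u unfolding e_def O.vle_uminus_iff by blast+
    let ?U = "mk (y * t - w * s) s (z * s - x * t) t"
    let ?U' = "mscale (inverse e) (mk t (- s) (x * t - z * s) (y * t - w * s))"
    have "?U' ** ?U = mscale (inverse e) (mk e 0 0 e)" "?U ** ?U' = mscale (inverse e) (mk e 0 0 e)"
      unfolding e_def by (simp_all add: algebra_simps)
    then have inv: "?U' ** ?U = mat 1" "?U ** ?U' = mat 1" using ei by (simp_all add: mk_one)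
    have UO: "?U \<in> mats Ok" "?U' \<in> mats Ok" using V st ei by simp_all
    have "a ** ?U = ?U ** mk 0 1 (- dt a) (mtrace a)" unfolding ax by (simp add: algebra_simps)
    then have "?U' ** (a ** ?U) = (?U' ** ?U) ** mk 0 1 (- dt a) (mtrace a)" by (simp only: matrix_mul_assoc)
    then have "?U' ** a ** ?U = mk 0 1 (- dt a) (mtrace a)" unfolding inv by (simp only: matrix_mul_assoc matrix_mul_lid)
    moreover have "O.inv_pair ?U ?U'" unfolding O.inv_pair_def using inv UO O.matsVF by blast
    ultimately show ?thesis using UO by blast
  qed
  have "\<not> O.vle z p \<or> \<not> O.vle (- y) p \<or> \<not> O.vle (z + (w - x) - y) p"
  proof (rule ccontr)
    assume "\<not> ?thesis"
    then have v: "O.vle z p" "O.vle y p" "O.vle (z + (w - x) - y) p" by (auto simp: O.vle_uminus_iff)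
    have "O.vle (w - x) p" using O.vle_add[OF O.vle_diff[OF v(3) v(1)] v(2)] by simp
    then have "O.vle (x - w) p" using O.vle_uminus_iff[of "w - x" p] by simp
    then show False using ns v unfolding scalarmod_def ax by simp
  qed
  then show ?thesis using step[of 1 0] step[of 0 1] step[of 1 1] by auto
qed

text \<open>The form is the norm of \<open>a + b r\<close> for a root \<open>r\<close> of
  \<open>X^2 - T X + N\<close>. The modulus is \<open>p * p\<close> and not \<open>p\<close>, so
  that Eisenstein polynomials are covered along with those irreducible modulo \<open>p\<close>. The
  condition makes \<open>Ok + Ok r\<close> integrally closed, see
  \<open>integers_anisotropic\<close>.\<close>

definition anisotropic :: "'a \<Rightarrow> 'a \<Rightarrow> bool" where
  "anisotropic T N \<longleftrightarrow> (\<forall>a\<in>Ok. \<forall>b\<in>Ok. O.vle (a * a + a * b * T + b * b * N) (p * p) \<longrightarrow> O.vle a p \<and> O.vle b p)"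

text \<open>\<open>X^2 - T X + N\<close> has two distinct roots in the residue field.\<close>

definition split_mod :: "'a \<Rightarrow> 'a \<Rightarrow> bool" where
  "split_mod T N \<longleftrightarrow> (\<exists>a\<in>Ok. \<exists>b\<in>Ok. \<not> O.vle (a - b) p \<and> O.vle (T - a - b) p \<and> O.vle (N - a * b) p)"

lemma vle_pp: "O.vle x (p * p) \<Longrightarrow> O.vle x p"
  unfolding O.vle_def by (metis O.V.Smult mult.assoc pO)

lemma vle_square: "x \<in> Ok \<Longrightarrow> O.vle (x * x) p \<Longrightarrow> O.vle x p"
  using p_prime by blast

lemma anisotropic_irreducible:
  assumes "T \<in> Ok" "N \<in> Ok" and irr: "\<And>t. t \<in> Ok \<Longrightarrow> \<not> O.vle (t * t - t * T + N) p"
  shows "anisotropic T N"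
  unfolding anisotropic_def
proof (intro ballI impI)
  fix a b assume ab: "a \<in> Ok" "b \<in> Ok" and v: "O.vle (a * a + a * b * T + b * b * N) (p * p)"
  have v': "O.vle (a * a + a * b * T + b * b * N) p" using vle_pp[OF v] .
  have b: "O.vle b p"
  proof (rule ccontr)
    assume "\<not> O.vle b p"
    then have bi: "b \<noteq> 0" "inverse b \<in> Ok" using unit_iff ab by blast+
    define t where "t = - (a * inverse b)"
    have t: "t \<in> Ok" using ab bi by (simp add: t_def)
    have "t * t - t * T + N = inverse b * inverse b * (a * a + a * b * T + b * b * N)"
      using bi(1) by (simp add: t_def field_simps)
    moreover have "O.vle (inverse b * inverse b * (a * a + a * b * T + b * b * N)) p" using v' bi by (intro O.vle_mult) simp_all
    ultimately show False using irr[OF t] by simp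
  qed
  have "O.vle (a * a + a * b * T + b * b * N - b * (a * T + b * N)) p"
    using v' b ab assms by (intro O.vle_diff O.vle_mult') simp_all
  moreover have "a * a + a * b * T + b * b * N - b * (a * T + b * N) = a * a" by (simp add: algebra_simps)
  ultimately show "O.vle a p \<and> O.vle b p" using vle_square[OF ab(1)] b by simp
qed

text \<open>Divisibility of \<open>b\<close> appears only at second order: once \<open>p\<close>
  divides \<open>a\<close>, the norm is \<open>b * b * N\<close> modulo \<open>p * p\<close>, and
  \<open>N\<close> has exactly one factor \<open>p\<close>.\<close>

lemma anisotropic_eisenstein:
  assumes TN: "T \<in> Ok" "N \<in> Ok" and T: "O.vle T p" and N: "O.vle N p" "\<not> O.vle N (p * p)"
  shows "anisotropic T N"
  unfolding anisotropic_def
proof (intro ballI impI)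
  fix a b assume ab: "a \<in> Ok" "b \<in> Ok" and v: "O.vle (a * a + a * b * T + b * b * N) (p * p)"
  obtain n where n: "n \<in> Ok" "N = n * p" using N(1) unfolding O.vle_def by blast
  obtain t where t: "t \<in> Ok" "T = t * p" using T unfolding O.vle_def by blast
  have nu: "\<not> O.vle n p" using N(2) n unfolding O.vle_def by (metis mult.assoc)
  have "O.vle (a * a + a * b * T + b * b * N - a * b * T - b * b * N) p"
    using vle_pp[OF v] ab T N(1) by (intro O.vle_diff O.vle_mult) simp_all
  then have a: "O.vle a p" using vle_square[OF ab(1)] by simp
  then obtain c where c: "c \<in> Ok" "a = c * p" unfolding O.vle_def by blast
  have "O.vle (a * a + a * b * T + b * b * N - (c * c + c * b * t) * (p * p)) (p * p)"
    using v c t ab by (intro O.vle_diff O.vle_self) simp_all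
  moreover have "a * a + a * b * T + b * b * N - (c * c + c * b * t) * (p * p) = (b * b * n) * p"
    by (simp add: c t n algebra_simps)
  ultimately obtain d where "d \<in> Ok" "(b * b * n) * p = d * (p * p)" unfolding O.vle_def by auto
  then have "b * b * n = d * p" by (simp add: mult.assoc)
  then have "O.vle (b * b * n) p" using \<open>d \<in> Ok\<close> unfolding O.vle_def by blast
  then have "O.vle (b * b) p" using p_prime[of "b * b" n] ab n nu by simp
  then show "O.vle a p \<and> O.vle b p" using a vle_square[OF ab(2)] by blast
qed

lemma scalarmod_root:
  assumes a: "a \<in> mats Ok" "scalarmod a"
  shows "O.vle (a$1$1 * a$1$1 - a$1$1 * mtrace a + dt a) p" "O.vle (mtrace a - 2 * a$1$1) p" "O.vle (dt a - a$1$1 * a$1$1) p"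
proof -
  obtain x y z w where ax: "a = mk x y z w" by (rule mk_cases)
  have V: "x \<in> Ok" "y \<in> Ok" "z \<in> Ok" "w \<in> Ok" and v: "O.vle y p" "O.vle z p" "O.vle (x - w) p"
    using a unfolding ax scalarmod_def by simp_all
  have "O.vle (- (y * z)) p" using V v by (simp add: O.vle_uminus_iff O.vle_mult)
  then show "O.vle (a$1$1 * a$1$1 - a$1$1 * mtrace a + dt a) p" unfolding ax by (simp add: algebra_simps)
  have "O.vle (- (x - w)) p" using v O.vle_uminus by blast
  then show "O.vle (mtrace a - 2 * a$1$1) p" unfolding ax by simp
  have "O.vle (x * (- (x - w)) - y * z) p"
    by (rule O.vle_diff[OF O.vle_mult[OF V(1) O.vle_uminus[OF v(3)]] O.vle_mult'[OF V(3) v(1)]])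
  then show "O.vle (dt a - a$1$1 * a$1$1) p" unfolding ax by (simp add: algebra_simps)
qed

text \<open>The discriminant \<open>(c - s)^2\<close> is a combination of the two congruences with
  integer coefficients in \<open>c\<close>, \<open>s\<close>, \<open>t\<close>, so residue
  characteristic 2 is included.\<close>

lemma double_root_disc:
  assumes "c \<in> Ok" "s \<in> Ok" "t \<in> Ok" "O.vle (c + s - 2 * t) p" "O.vle (c * s - t * t) p"
  shows "O.vle (c - s) p"
proof -
  have "O.vle ((c + s + 2 * t) * (c + s - 2 * t) - 4 * (c * s - t * t)) p"
    by (rule O.vle_diff[OF O.vle_mult[OF _ assms(4)] O.vle_mult[OF _ assms(5)]]) (use assms in simp_all)
  moreover have "(c + s + 2 * t) * (c + s - 2 * t) - 4 * (c * s - t * t) = (c - s) * (c - s)" by (simp add: algebra_simps)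
  ultimately show ?thesis using vle_square[of "c - s"] assms by simp
qed

text \<open>If no element of the order has a separable characteristic polynomial modulo \<open>p\<close>, its image modulo \<open>p\<close> is
  spanned by the identity and a nilpotent element; moving to the neighbouring vertex of the tree produces an
  element with Eisenstein characteristic polynomial.\<close>

lemma find_companion:
  assumes G: "bass_order K absv G"
  shows "\<exists>P Q \<alpha> T N. O.inv_pair P Q \<and> (\<forall>x\<in>G. Q ** x ** P \<in> mats Ok) \<and> T \<in> Ok \<and> N \<in> Ok \<and> \<alpha> \<in> G \<and>
     Q ** \<alpha> ** P = mk 0 1 (- N) T \<and> (anisotropic T N \<or> split_mod T N)" (is ?goal)
proof (rule ccontr)
  assume neg: "\<not> ?goal"
  have Gf: "full_order K absv G" using G unfolding bass_order_def by blast
  note Gd = full_orderD[OF Gf]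
  \<comment> \<open>Bringing \<open>x\<close> into companion form at this vertex would give what is
    assumed not to exist.\<close>
  have good: False if PQ: "O.inv_pair P Q" "\<And>x. x \<in> G \<Longrightarrow> Q ** x ** P \<in> mats Ok" and x: "x \<in> G" "\<not> scalarmod (Q ** x ** P)"
    and d: "anisotropic (mtrace x) (dt x) \<or> split_mod (mtrace x) (dt x)" for P Q x
  proof -
    note i = PQ(1)[unfolded O.inv_pair_def]
    obtain U U' where U: "O.inv_pair U U'" "U \<in> mats Ok" "U' \<in> mats Ok"
      "U' ** (Q ** x ** P) ** U = mk 0 1 (- dt (Q ** x ** P)) (mtrace (Q ** x ** P))"
      using companion[OF PQ(2)[OF x(1)] x(2)] by blast
    have "mtrace (Q ** x ** P) = mtrace x" "dt (Q ** x ** P) = dt x" using mtrace_conj dt_conj i by blast+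
    then have "(U' ** Q) ** x ** (P ** U) = mk 0 1 (- dt x) (mtrace x)" using U(4) by (simp add: matrix_mul_assoc)
    moreover have "(U' ** Q) ** y ** (P ** U) \<in> mats Ok" if "y \<in> G" for y
    proof -
      have "U' ** (Q ** y ** P) ** U \<in> mats Ok" using PQ(2)[OF that] U by simp
      then show ?thesis by (simp add: matrix_mul_assoc)
    qed
    ultimately show False using neg inv_pair_mult[OF PQ(1) U(1)] d x(1) Gd(10,11) by blast
  qed
  obtain P0 Q0 where PQ0: "O.inv_pair P0 Q0" "\<forall>x\<in>G. Q0 ** x ** P0 \<in> mats Ok"
    using O.order_in_conj[OF Gd(1)] unfolding O.inv_pair_def by blast
  note i0 = PQ0(1)[unfolded O.inv_pair_def]
  have inv0: "mtrace (Q0 ** x ** P0) = mtrace x" "dt (Q0 ** x ** P0) = dt x" for x using mtrace_conj dt_conj i0 by blast+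
  \<comment> \<open>A characteristic polynomial without root modulo \<open>p\<close> is irreducible
    there and hence anisotropic.\<close>
  have root: "\<exists>t\<in>Ok. O.vle (t * t - t * mtrace x + dt x) p" if x: "x \<in> G" for x
  proof (rule ccontr)
    assume n: "\<not> ?thesis"
    then have "anisotropic (mtrace x) (dt x)" using Gd(10,11) x by (intro anisotropic_irreducible) blast+
    moreover have "\<not> scalarmod (Q0 ** x ** P0)"
    proof
      assume s: "scalarmod (Q0 ** x ** P0)"
      have m: "Q0 ** x ** P0 \<in> mats Ok" using PQ0(2) x by blast
      have "(Q0 ** x ** P0)$1$1 \<in> Ok" using m unfolding mats_def by blast
      then show False using n scalarmod_root(1)[OF m s] unfolding inv0 by blast
    qed
    ultimately show False using good[OF PQ0(1) _ x] PQ0(2) by blast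
  qed
  have nosplit: "\<not> split_mod (mtrace x) (dt x)" if x: "x \<in> G" for x
  proof
    assume s: "split_mod (mtrace x) (dt x)"
    then obtain a b where ab: "a \<in> Ok" "b \<in> Ok" "\<not> O.vle (a - b) p" "O.vle (mtrace x - a - b) p" "O.vle (dt x - a * b) p"
      unfolding split_mod_def by blast
    have "\<not> scalarmod (Q0 ** x ** P0)"
    proof
      assume sm: "scalarmod (Q0 ** x ** P0)"
      have m: "Q0 ** x ** P0 \<in> mats Ok" using PQ0(2) x by blast
      define u where "u = (Q0 ** x ** P0)$1$1"
      have u: "u \<in> Ok" using m unfolding mats_def u_def by blast
      have r: "O.vle (mtrace x - 2 * u) p" "O.vle (dt x - u * u) p" using scalarmod_root(2,3)[OF m sm] unfolding inv0 u_def by blast+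
      have "O.vle ((mtrace x - 2 * u) - (mtrace x - a - b)) p" "O.vle ((dt x - u * u) - (dt x - a * b)) p"
        using r ab by (blast intro: O.vle_diff)+
      then have "O.vle (a - b) p" by (intro double_root_disc[OF ab(1,2) u]) (simp_all add: algebra_simps)
      then show False using ab(3) by blast
    qed
    then show False using good[OF PQ0(1) _ x] PQ0(2) s by blast
  qed
  \<comment> \<open>There is a root modulo \<open>p\<close>, but there are no two distinct ones:
    only a double root is left.\<close>
  have dbl: "\<exists>t\<in>Ok. O.vle (mtrace x - 2 * t) p \<and> O.vle (dt x - t * t) p" if x: "x \<in> G" for x
  proof -
    obtain t where t: "t \<in> Ok" "O.vle (t * t - t * mtrace x + dt x) p" using root[OF x] by blast
    have T: "mtrace x \<in> Ok" using Gd(10) x by blast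
    let ?b = "mtrace x - t"
    have e: "dt x - t * ?b = t * t - t * mtrace x + dt x" by (simp add: algebra_simps)
    have "O.vle (t - ?b) p"
    proof (rule ccontr)
      assume "\<not> O.vle (t - ?b) p"
      moreover have "O.vle (mtrace x - t - ?b) p" by simp
      moreover have "O.vle (dt x - t * ?b) p" unfolding e by (rule t(2))
      ultimately have "split_mod (mtrace x) (dt x)" unfolding split_mod_def using t(1) T by (meson O.V.Sdiff)
      then show False using nosplit[OF x] by blast
    qed
    then have 1: "O.vle (- (t - ?b)) p" by (rule O.vle_uminus)
    have "O.vle ((dt x - t * ?b) + t * (- (t - ?b))) p"
      by (rule O.vle_add[OF t(2)[folded e] O.vle_mult[OF t(1) 1]])
    moreover have "(dt x - t * ?b) + t * (- (t - ?b)) = dt x - t * t" by (simp add: algebra_simps)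
    moreover have "- (t - ?b) = mtrace x - 2 * t" by simp
    ultimately show ?thesis using 1 t(1) by metis
  qed
  obtain x0 where x0: "x0 \<in> G" "\<not> scalarmod (Q0 ** x0 ** P0)" using bass_not_in_spi[OF G PQ0(1)] PQ0(2) by blast
  obtain t where t: "t \<in> Ok" "O.vle (mtrace x0 - 2 * t) p" "O.vle (dt x0 - t * t) p" using dbl[OF x0(1)] by blast
  \<comment> \<open>Subtracting the double root makes \<open>\<beta>\<close> nilpotent modulo
    \<open>p\<close>; trace and determinant are divisible by \<open>p\<close>. The determinant is
    even divisible by \<open>p * p\<close>, as otherwise \<open>\<beta>\<close> would already be
    Eisenstein.\<close>
  define \<beta> where "\<beta> = x0 - mscale t (mat 1)"
  have bG: "\<beta> \<in> G" unfolding \<beta>_def using Gd(7)[OF x0(1) Gd(12)[OF t(1)]] .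
  define T where "T = mtrace \<beta>"
  define N where "N = dt \<beta>"
  have TO: "T \<in> Ok" "N \<in> Ok" unfolding T_def N_def using Gd(10,11) bG by blast+
  have Te: "T = mtrace x0 - 2 * t" unfolding T_def \<beta>_def by (simp add: mtrace_diff mtrace_scale mk_one)
  have Ne: "N = (dt x0 - t * t) - t * (mtrace x0 - 2 * t)" unfolding N_def \<beta>_def
    by (cases x0 rule: mk_cases) (simp add: mk_one algebra_simps)
  have T: "O.vle T p" unfolding Te by (rule t(2))
  have Np: "O.vle N p" unfolding Ne by (rule O.vle_diff[OF t(3) O.vle_mult[OF t(1,2)]])
  have nb: "\<not> scalarmod (Q0 ** \<beta> ** P0)"
  proof -
    have "Q0 ** \<beta> ** P0 = Q0 ** x0 ** P0 - mscale t (mat 1)" unfolding \<beta>_def using i0 by (simp add: mat_lin)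
    then show ?thesis using x0(2) unfolding scalarmod_def by (cases "Q0 ** x0 ** P0" rule: mk_cases) (simp add: mk_one)
  qed
  have NN: "O.vle N (p * p)"
    using good[OF PQ0(1) _ bG nb] PQ0(2) anisotropic_eisenstein[OF TO T Np] unfolding T_def N_def by blast
  obtain U U' where U: "O.inv_pair U U'" "U \<in> mats Ok" "U' \<in> mats Ok"
      "U' ** (Q0 ** \<beta> ** P0) ** U = mk 0 1 (- dt (Q0 ** \<beta> ** P0)) (mtrace (Q0 ** \<beta> ** P0))"
    using companion[OF _ nb] PQ0(2) bG by blast
  define P Q where "P = P0 ** U" and "Q = U' ** Q0"
  have PQ: "O.inv_pair P Q" unfolding P_def Q_def by (rule inv_pair_mult[OF PQ0(1) U(1)])
  note i = PQ[unfolded O.inv_pair_def]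
  have PQO: "Q ** x ** P \<in> mats Ok" if "x \<in> G" for x
  proof -
    have "U' ** (Q0 ** x ** P0) ** U \<in> mats Ok" using PQ0(2) that U by simp
    then show ?thesis by (simp add: matrix_mul_assoc P_def Q_def)
  qed
  have b: "Q ** \<beta> ** P = mk 0 1 (- N) T" using U(4) unfolding inv0 T_def N_def P_def Q_def by (simp add: matrix_mul_assoc)
  have inv: "mtrace (Q ** x ** P) = mtrace x" "dt (Q ** x ** P) = dt x" for x using mtrace_conj dt_conj i by blast+
  \<comment> \<open>The determinant of \<open>x ** \<beta>\<close> is divisible by \<open>p\<close>,
    so its double root is 0 and its trace is divisible by \<open>p\<close>. That trace is the lower
    left entry \<open>r\<close> modulo \<open>p\<close>. Hence \<open>G\<close> is upper triangular
    modulo \<open>p\<close> and is contained in the order of a neighbouring vertex.\<close>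
  have shape: "O.vle r p \<and> O.vle (c - s) p" if x: "x \<in> G" "Q ** x ** P = mk c q r s" for x c q r s
  proof -
    have V: "c \<in> Ok" "q \<in> Ok" "r \<in> Ok" "s \<in> Ok" using PQO[OF x(1)] unfolding x(2) by simp_all
    have xb: "x ** \<beta> \<in> G" using Gd(8) x bG by blast
    have xbm: "Q ** (x ** \<beta>) ** P = mk (- (q * N)) (c + q * T) (- (s * N)) (r + s * T)"
      using O.conj_mult[of P Q x \<beta>] i unfolding x(2) b by simp
    obtain t where t: "t \<in> Ok" "O.vle (mtrace (x ** \<beta>) - 2 * t) p" "O.vle (dt (x ** \<beta>) - t * t) p" using dbl[OF xb] by blast
    have tr: "mtrace (x ** \<beta>) = r + (s * T - q * N)" using inv(1)[of "x ** \<beta>"] unfolding xbm by (simp add: algebra_simps)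
    have "O.vle (dt x * N - (dt (x ** \<beta>) - t * t)) p" by (rule O.vle_diff[OF O.vle_mult[OF Gd(11)[OF x(1)] Np] t(3)])
    then have "O.vle (t * t) p" by (simp add: dt_mult N_def)
    then have "O.vle t p" using vle_square t(1) by blast
    then have "O.vle ((mtrace (x ** \<beta>) - 2 * t) + 2 * t - (s * T - q * N)) p"
      by (intro O.vle_diff[OF O.vle_add[OF t(2) O.vle_mult] O.vle_diff[OF O.vle_mult[OF V(4) T] O.vle_mult[OF V(2) Np]]]) simp_all
    then have r: "O.vle r p" unfolding tr by simp
    obtain t' where t': "t' \<in> Ok" "O.vle (mtrace x - 2 * t') p" "O.vle (dt x - t' * t') p" using dbl[OF x(1)] by blast
    have e: "mtrace x = c + s" "dt x = c * s - q * r" using inv[of x] unfolding x(2) by simp_all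
    have "O.vle ((dt x - t' * t') + q * r) p" by (rule O.vle_add[OF t'(3) O.vle_mult[OF V(2) r]])
    then have "O.vle (c - s) p" using t' e by (intro double_root_disc[OF V(1,4) t'(1)]) simp_all
    then show ?thesis using r by blast
  qed
  \<comment> \<open>The neighbouring vertex: conjugation by diag(1, p) divides the lower left entry
    by \<open>p\<close> and multiplies the upper right one by \<open>p\<close>.\<close>
  define P1 Q1 where "P1 = P ** mk 1 0 0 p" and "Q1 = mk 1 0 0 (inverse p) ** Q"
  have "O.inv_pair (mk 1 0 0 p) (mk 1 0 0 (inverse p))" unfolding O.inv_pair_def using pK Kinv[OF pK] by (simp add: mk_one)
  then have PQ1: "O.inv_pair P1 Q1" unfolding P1_def Q1_def by (rule inv_pair_mult[OF PQ])
  have c1: "Q1 ** x ** P1 = mk c (q * p) (inverse p * r) s" if "Q ** x ** P = mk c q r s" for x c q r s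
  proof -
    have "Q1 ** x ** P1 = mk 1 0 0 (inverse p) ** (Q ** x ** P) ** mk 1 0 0 p"
      unfolding P1_def Q1_def by (simp only: matrix_mul_assoc)
    then show ?thesis unfolding that by simp
  qed
  have PQ1O: "Q1 ** x ** P1 \<in> mats Ok" if x: "x \<in> G" for x
  proof -
    obtain c q r s where m: "Q ** x ** P = mk c q r s" by (rule mk_cases)
    have "O.vle r p" using shape[OF x m] by blast
    then have "inverse p * r \<in> Ok" by (simp add: O.vle_div divide_inverse mult.commute)
    then show ?thesis using PQO[OF x] unfolding c1[OF m] m by simp
  qed
  obtain x where x: "x \<in> G" "\<not> scalarmod (Q1 ** x ** P1)" using bass_not_in_spi[OF G PQ1 PQ1O] by blast
  obtain c q r s where m: "Q ** x ** P = mk c q r s" by (rule mk_cases)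
  have V: "c \<in> Ok" "q \<in> Ok" "r \<in> Ok" "s \<in> Ok" using PQO[OF x(1)] unfolding m by simp_all
  have rcs: "O.vle r p" "O.vle (c - s) p" using shape[OF x(1) m] by blast+
  have qp: "O.vle (q * p) p" by (rule O.vle_self(2)[OF V(2)])
  \<comment> \<open>The other non-scalar entries vanish modulo \<open>p\<close> by construction, so
    \<open>r\<close> has exactly one factor \<open>p\<close>.\<close>
  have ru: "\<not> O.vle (inverse p * r) p" using x(2) qp rcs(2) unfolding c1[OF m] scalarmod_def by simp
  \<comment> \<open>Adding 0 or 1 times \<open>\<beta>\<close>, whose upper right entry is 1, makes
    the upper right entry of \<open>\<gamma>\<close> a unit.\<close>
  obtain \<epsilon> where eps: "\<epsilon> \<in> Ok" "\<not> O.vle (q + \<epsilon>) p"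
  proof (cases "O.vle q p")
    case True
    have "\<not> O.vle (q + 1) p"
    proof
      assume "O.vle (q + 1) p"
      then have "O.vle (q + 1 - q) p" using True by (rule O.vle_diff)
      then show False using one_not_vle_p by simp
    qed
    then show ?thesis using that[of 1] by simp
  next
    case False
    then show ?thesis using that[of 0] by simp
  qed
  define \<gamma> where "\<gamma> = x - mscale c (mat 1) + mscale \<epsilon> \<beta>"
  have gG: "\<gamma> \<in> G" unfolding \<gamma>_def
    by (rule Gd(6)[OF Gd(7)[OF x(1) Gd(12)[OF V(1)]] Gd(9)[OF eps(1) bG]])
  have gm: "Q ** \<gamma> ** P = mk 0 (q + \<epsilon>) (r - \<epsilon> * N) (s - c + \<epsilon> * T)"
  proof -
    have "Q ** \<gamma> ** P = Q ** x ** P - mscale c (mat 1) + mscale \<epsilon> (Q ** \<beta> ** P)"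
      unfolding \<gamma>_def using i by (simp add: mat_lin)
    then show ?thesis unfolding m b by (simp add: mk_one)
  qed
  have ng: "\<not> scalarmod (Q ** \<gamma> ** P)" unfolding gm scalarmod_def using eps by simp
  have tg: "mtrace \<gamma> = \<epsilon> * T - (c - s)" "dt \<gamma> = - ((q + \<epsilon>) * (r - \<epsilon> * N))" using inv[of \<gamma>] unfolding gm by (simp_all add: algebra_simps)
  have v1: "O.vle (mtrace \<gamma>) p" unfolding tg by (rule O.vle_diff[OF O.vle_mult[OF eps(1) T] rcs(2)])
  have v2: "O.vle (dt \<gamma>) p" unfolding tg
    by (rule O.vle_uminus[OF O.vle_mult[OF _ O.vle_diff[OF rcs(1) O.vle_mult[OF eps(1) Np]]]]) (use V eps in simp)
  \<comment> \<open>\<open>dt \<gamma>\<close> is a unit times \<open>r - \<epsilon> * N\<close>,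
    where \<open>r\<close> has one factor \<open>p\<close> and \<open>N\<close> at least two. So the
    polynomial of \<open>\<gamma>\<close> is Eisenstein.\<close>
  have v3: "\<not> O.vle (dt \<gamma>) (p * p)"
  proof
    assume "O.vle (dt \<gamma>) (p * p)"
    then have "O.vle ((q + \<epsilon>) * (r - \<epsilon> * N)) (p * p)" unfolding tg O.vle_uminus_iff .
    moreover have qe: "q + \<epsilon> \<in> Ok" using V eps by simp
    moreover have "q + \<epsilon> \<noteq> 0" "inverse (q + \<epsilon>) \<in> Ok" using unit_iff[OF qe] eps by blast+
    ultimately have "O.vle (inverse (q + \<epsilon>) * ((q + \<epsilon>) * (r - \<epsilon> * N)) + \<epsilon> * N) (p * p)"
      by (intro O.vle_add[OF O.vle_mult O.vle_mult[OF eps(1) NN]])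
    moreover have "inverse (q + \<epsilon>) * ((q + \<epsilon>) * (r - \<epsilon> * N)) + \<epsilon> * N = r" using \<open>q + \<epsilon> \<noteq> 0\<close> by (simp add: mult.assoc[symmetric])
    ultimately have "O.vle r (p * p)" by simp
    then obtain v where "v \<in> Ok" "r = v * (p * p)" unfolding O.vle_def by blast
    then have "inverse p * r = v * p" by (simp add: mult.left_commute)
    then show False using ru O.vle_self(2)[OF \<open>v \<in> Ok\<close>] by simp
  qed
  show False using good[OF PQ PQO gG ng] anisotropic_eisenstein[OF Gd(10)[OF gG] Gd(11)[OF gG] v1 v2 v3] by blast
qed

end

section \<open>Ghost intersections in terms of matrix entries\<close>

context local_field
begin

text \<open>Five vertices are fixed for all cases: the base vertex and one each towards the ends 0,
  infinity, 1 and \<open>e\<close> of the projective line. For an integral matrix \<open>a\<close>,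
  preserving the lattice spanned by \<open>u = (1, f)\<close> and \<open>(0, c)\<close> means that
  \<open>c\<close> divides \<open>det (u, a u)\<close>, which is
  \<open>v + (w - y) * f - z * f * f\<close>.\<close>

lemma ghostI:
  assumes R: "full_order K absv R" and L: "finite_extension K L" and PQ: "O.inv_pair P Q"
    and d: "d1 \<in> ext_integers K absv L" "d2 \<in> ext_integers K absv L" "d3 \<in> ext_integers K absv L" "d4 \<in> ext_integers K absv L"
    and nz: "d1 \<noteq> 0" "d2 \<noteq> 0" "d3 \<noteq> 0" "d4 \<noteq> 0" and e: "e \<in> ext_integers K absv L"
    and mem: "\<And>x y z v w. x \<in> mats K \<Longrightarrow> Q ** x ** P = mk y z v w \<Longrightarrow> x \<in> R \<longleftrightarrow> y \<in> Ok \<and> z \<in> Ok \<and> v \<in> Ok \<and> w \<in> Ok \<and>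
      v / d1 \<in> ext_integers K absv L \<and> z / d2 \<in> ext_integers K absv L \<and> (v + (w - y) - z) / d3 \<in> ext_integers K absv L \<and>
      (v + (w - y) * e - z * e * e) / d4 \<in> ext_integers K absv L"
  shows "ghost_intersection K absv R"
proof -
  let ?O = "ext_integers K absv L"
  interpret E: valring ?O L using valring_ext[OF L] .
  have KL: "K \<subseteq> L" using L unfolding finite_extension_def by blast
  have mKL: "x \<in> mats K \<Longrightarrow> x \<in> mats L" for x using KL by (auto simp: mats_def)
  note i = PQ[unfolded O.inv_pair_def]
  have PQL: "P \<in> mats L" "Q \<in> mats L" using i mKL by blast+
  have Epair: "E.inv_pair (P ** U) (U' ** Q)" if "U \<in> mats L" "U' \<in> mats L" "U ** U' = mat 1" "U' ** U = mat 1" for U U'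
  proof -
    have "(P ** U) ** (U' ** Q) = P ** (U ** U') ** Q" "(U' ** Q) ** (P ** U) = U' ** (Q ** P) ** U"
      by (simp_all only: matrix_mul_assoc)
    then show ?thesis unfolding E.inv_pair_def using that PQL i by simp
  qed
  define D where "D f c = E.cmats (P ** mk 1 0 f c) (mk 1 0 (- (f / c)) (inverse c) ** Q)" for f c
  define D' where "D' = E.cmats (P ** mk d2 0 0 1) (mk (inverse d2) 0 0 1 ** Q)"
  define D0 where "D0 = E.cmats P Q"
  have Dmax: "maximal_order_over ?O L (D f c)" if "f \<in> ?O" "c \<in> ?O" "c \<noteq> 0" for f c
    unfolding D_def using that by (intro E.cmats_maximal Epair) (simp_all add: mk_one divide_inverse mult.commute)
  have D'max: "maximal_order_over ?O L D'"
    unfolding D'_def using d nz by (intro E.cmats_maximal Epair) (simp_all add: mk_one)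
  have D0max: "maximal_order_over ?O L D0"
    unfolding D0_def by (rule E.cmats_maximal) (simp add: E.inv_pair_def PQL i)
  have conj: "(U' ** Q) ** x ** (P ** U) = U' ** (Q ** x ** P) ** U" for U U' x by (simp only: matrix_mul_assoc)
  have Dmem: "x \<in> D f c \<longleftrightarrow> (v + (w - y) * f - z * f * f) / c \<in> ?O"
    if x: "x \<in> mats K" "Q ** x ** P = mk y z v w" and V: "y \<in> ?O" "z \<in> ?O" "v \<in> ?O" "w \<in> ?O"
      and f: "f \<in> ?O" "c \<in> ?O" "c \<noteq> 0" for x y z v w f c
  proof -
    have "mk 1 0 (- (f / c)) (inverse c) ** mk y z v w ** mk 1 0 f c
      = mk (y + z * f) (z * c) ((v + (w - y) * f - z * f * f) / c) (w - f * z)"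
      using f by (simp add: field_simps)
    then have m: "(mk 1 0 (- (f / c)) (inverse c) ** Q) ** x ** (P ** mk 1 0 f c)
      = mk (y + z * f) (z * c) ((v + (w - y) * f - z * f * f) / c) (w - f * z)" unfolding conj x(2) .
    show ?thesis unfolding D_def E.cmats_def mem_Collect_eq m using V f mKL[OF x(1)] by simp
  qed
  have D'mem: "x \<in> D' \<longleftrightarrow> z / d2 \<in> ?O"
    if x: "x \<in> mats K" "Q ** x ** P = mk y z v w" and V: "y \<in> ?O" "z \<in> ?O" "v \<in> ?O" "w \<in> ?O" for x y z v w
  proof -
    have "mk (inverse d2) 0 0 1 ** mk y z v w ** mk d2 0 0 1 = mk y (z / d2) (v * d2) w"
      using nz by (simp add: field_simps)
    then have m: "(mk (inverse d2) 0 0 1 ** Q) ** x ** (P ** mk d2 0 0 1) = mk y (z / d2) (v * d2) w" unfolding conj x(2) .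
    show ?thesis unfolding D'_def E.cmats_def mem_Collect_eq m using V d mKL[OF x(1)] by simp
  qed
  have D0mem: "x \<in> D0 \<longleftrightarrow> y \<in> ?O \<and> z \<in> ?O \<and> v \<in> ?O \<and> w \<in> ?O" if "x \<in> mats K" "Q ** x ** P = mk y z v w" for x y z v w
    unfolding D0_def E.cmats_def using that mKL by simp
  let ?Ds = "{D0, D 0 d1, D', D 1 d3, D e d4}"
  have "R = mats K \<inter> \<Inter>?Ds"
  proof (rule set_eqI)
    fix x
    show "x \<in> R \<longleftrightarrow> x \<in> mats K \<inter> \<Inter>?Ds"
    proof (cases "x \<in> mats K")
      case False
      then show ?thesis using full_orderD(2)[OF R] by blast
    next
      case True
      obtain y z v w where a: "Q ** x ** P = mk y z v w" by (rule mk_cases)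
      have "mk y z v w \<in> mats K" unfolding a[symmetric] using True i by simp
      then have iK: "u \<in> ?O \<longleftrightarrow> u \<in> Ok" if "u \<in> {y,z,v,w}" for u using ext_integers_K[OF L] that by auto
      show ?thesis
      proof (cases "y \<in> ?O \<and> z \<in> ?O \<and> v \<in> ?O \<and> w \<in> ?O")
        case False
        then show ?thesis using mem[OF True a] D0mem[OF True a] iK by auto
      next
        case V: True
        then have V': "y \<in> ?O" "z \<in> ?O" "v \<in> ?O" "w \<in> ?O" by blast+
        have "x \<in> D 0 d1 \<longleftrightarrow> v / d1 \<in> ?O" "x \<in> D 1 d3 \<longleftrightarrow> (v + (w - y) - z) / d3 \<in> ?O"
          "x \<in> D e d4 \<longleftrightarrow> (v + (w - y) * e - z * e * e) / d4 \<in> ?O"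
          using Dmem[OF True a V', of 0 d1] Dmem[OF True a V', of 1 d3] Dmem[OF True a V' e d(4) nz(4)] d nz by simp_all
        then show ?thesis using mem[OF True a] D0mem[OF True a] D'mem[OF True a V'] V iK True by simp
      qed
    qed
  qed
  moreover have "\<forall>M\<in>?Ds. maximal_order_over ?O L M" using Dmax D'max D0max d nz e by simp
  moreover have "finite ?Ds" "?Ds \<noteq> {}" by simp_all
  ultimately show ?thesis unfolding ghost_intersection_def using R L by blast
qed

text \<open>If the quadratic polynomial \<open>v + (w - y) f - z f^2\<close> is divisible by
  \<open>p ^ k\<close> at the ends 0, infinity and 1, so are its coefficients. Hence three vertices
  over K suffice to make a matrix scalar modulo \<open>p ^ k\<close>.\<close>

lemma mod_scalar_split:
  assumes V: "y \<in> Ok" "z \<in> Ok" "v \<in> Ok" "w \<in> Ok" and e: "O.vle z (p ^ k)" "O.vle v (p ^ k)" "O.vle (v + (w - y) - z) (p ^ k)"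
  shows "\<exists>z'\<in>Ok. \<exists>v'\<in>Ok. \<exists>w'\<in>Ok. mk y z v w = mscale y (mat 1) + mscale (p ^ k) (mk 0 z' v' w')"
proof -
  have "O.vle (w - y) (p ^ k)" using O.vle_add[OF O.vle_diff[OF e(3,2)] e(1)] by simp
  then obtain z' v' w' where "z' \<in> Ok" "z = z' * p ^ k" "v' \<in> Ok" "v = v' * p ^ k" "w' \<in> Ok" "w - y = w' * p ^ k"
    using e unfolding O.vle_def by blast
  then show ?thesis by (intro bexI[of _ z'] bexI[of _ v'] bexI[of _ w']) (simp_all add: mk_one algebra_simps)
qed

text \<open>The component in \<open>G\<close> is normalized to have upper left entry 0, which is
  possible because \<open>G\<close> contains the integral scalars; then \<open>z'\<close>,
  \<open>v'\<close>, \<open>w'\<close> are determined by \<open>x\<close>.\<close>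

lemma spi_conj_iff:
  assumes PQ: "O.inv_pair P Q" and G: "full_order K absv G" "\<And>x. x \<in> G \<Longrightarrow> Q ** x ** P \<in> mats Ok"
    and x: "x \<in> mats K" "Q ** x ** P = mk y z v w"
  shows "x \<in> spi k G \<longleftrightarrow> y \<in> Ok \<and> z \<in> Ok \<and> v \<in> Ok \<and> w \<in> Ok \<and>
    (\<exists>z'\<in>Ok. \<exists>v'\<in>Ok. \<exists>w'\<in>Ok. z = p ^ k * z' \<and> v = p ^ k * v' \<and> w - y = p ^ k * w' \<and> P ** mk 0 z' v' w' ** Q \<in> G)"
    (is "?l \<longleftrightarrow> ?r")
proof
  note i = PQ[unfolded O.inv_pair_def]
  assume ?l
  then obtain a g where g: "a \<in> Ok" "g \<in> G" "x = mscale a (mat 1) + mscale (p ^ k) g" by (elim spiE)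
  obtain y' z' v' w' where b: "Q ** g ** P = mk y' z' v' w'" by (rule mk_cases)
  have V: "y' \<in> Ok" "z' \<in> Ok" "v' \<in> Ok" "w' \<in> Ok" using G(2)[OF g(2)] unfolding b by simp_all
  have "mk y z v w = mscale a (mat 1) + mscale (p ^ k) (mk y' z' v' w')"
    unfolding x(2)[symmetric] b[symmetric] g(3) using i by (simp add: mat_lin)
  then have e: "y = a + p ^ k * y'" "z = p ^ k * z'" "v = p ^ k * v'" "w = a + p ^ k * w'" by (simp_all add: mk_one)
  have "g - mscale y' (mat 1) \<in> G" using full_orderD(7,12)[OF G(1)] g V by blast
  moreover have "g - mscale y' (mat 1) = P ** mk 0 z' v' (w' - y') ** Q"
  proof -
    have "Q ** (g - mscale y' (mat 1)) ** P = mk y' z' v' w' - mscale y' (mat 1)"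
      unfolding b[symmetric] using i by (simp add: mat_lin)
    also have "\<dots> = mk 0 z' v' (w' - y')" by (simp add: mk_one)
    finally show ?thesis using conj_cancel[of P Q "g - mscale y' (mat 1)"] i by simp
  qed
  ultimately have "P ** mk 0 z' v' (w' - y') ** Q \<in> G" by simp
  moreover have "w - y = p ^ k * (w' - y')" using e by (simp add: algebra_simps)
  ultimately show ?r using V e g(1) by (intro conjI bexI[of _ z'] bexI[of _ v'] bexI[of _ "w' - y'"]) simp_all
next
  note i = PQ[unfolded O.inv_pair_def]
  assume ?r
  then obtain z' v' w' where *: "y \<in> Ok" "z = p ^ k * z'" "v = p ^ k * v'" "w - y = p ^ k * w'" "P ** mk 0 z' v' w' ** Q \<in> G" by blast
  have w: "w = y + p ^ k * w'" using *(4) by (simp add: algebra_simps)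
  have "Q ** x ** P = mscale y (mat 1) + mscale (p ^ k) (mk 0 z' v' w')" unfolding x(2) w *(2,3) by (simp add: mk_one)
  then have "P ** (Q ** x ** P) ** Q = P ** (mscale y (mat 1) + mscale (p ^ k) (mk 0 z' v' w')) ** Q" by (rule arg_cong)
  also have "\<dots> = mscale y (P ** Q) + mscale (p ^ k) (P ** mk 0 z' v' w' ** Q)" by (simp only: mat_lin matrix_mul_rid)
  finally have "x = mscale y (mat 1) + mscale (p ^ k) (P ** mk 0 z' v' w' ** Q)" using conj_cancel[of P Q x] i by simp
  then show ?l using spiI[OF *(1,5)] by metis
qed

end

section \<open>The quadratic extension generated by an eigenvalue\<close>

locale quadratic_ext = local_field +
  fixes T N r
  assumes TO: "T \<in> Ok" and NO: "N \<in> Ok" and rr: "r * r = T * r - N" and rK: "r \<notin> K"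
begin

definition "L = {a + b * r | a b. a \<in> K \<and> b \<in> K}"

definition "s = T - r"

lemma rs: "r * s = N" "r + s = T" "s * s = T * s - N"
  using rr by (simp_all add: s_def algebra_simps)

lemma LI: "a \<in> K \<Longrightarrow> b \<in> K \<Longrightarrow> a + b * r \<in> L"
  unfolding L_def by blast

lemma TK: "T \<in> K" "N \<in> K" using TO NO by simp_all

lemma indep:
  assumes "a \<in> K" "b \<in> K" "a + b * r = 0"
  shows "a = 0 \<and> b = 0"
proof -
  have "b = 0"
  proof (rule ccontr)
    assume b: "b \<noteq> 0"
    then have "r = - a / b" using assms(3) by (simp add: field_simps add_eq_0_iff)
    moreover have "- a / b \<in> K" using assms by (intro O.Fdiv O.F.Suminus)
    ultimately show False using rK by simp
  qed
  then show ?thesis using assms(3) by simp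
qed

lemma norm_nz:
  assumes "a \<in> K" "b \<in> K" "a + b * r \<noteq> 0"
  shows "a * a + a * b * T + b * b * N \<noteq> 0"
proof
  assume n: "a * a + a * b * T + b * b * N = 0"
  have "(a + b * r) * ((a + b * T) + (- b) * r) = a * a + a * b * T + b * b * (T * r - r * r)" by (simp add: algebra_simps)
  also have "\<dots> = 0" unfolding rr using n by simp
  finally have z: "(a + b * T) + (- b) * r = 0" using assms(3) mult_eq_0_iff by blast
  have "a + b * T = 0 \<and> - b = 0" by (rule indep[OF _ _ z]) (use assms TK in simp_all)
  then have "b = 0" "a = 0" by auto
  then show False using assms(3) by simp
qed

lemma mult_L: "(a + b * r) * (c + d * r) = (a * c - b * d * N) + (a * d + b * c + b * d * T) * r"
proof -
  have "(a + b * r) * (c + d * r) = a * c + (a * d + b * c) * r + b * d * (r * r)" by (simp add: algebra_simps)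
  then show ?thesis unfolding rr by (simp add: algebra_simps)
qed

lemma mult_Ls: "(a + b * s) * (c + d * s) = (a * c - b * d * N) + (a * d + b * c + b * d * T) * s"
proof -
  have "(a + b * s) * (c + d * s) = a * c + (a * d + b * c) * s + b * d * (s * s)" by (simp add: algebra_simps)
  then show ?thesis unfolding rs(3) by (simp add: algebra_simps)
qed

lemma L_ext: "finite_extension K L"
  unfolding finite_extension_def
proof (intro conjI)
  show "K \<subseteq> L" using LI[of _ 0] by auto
  show "subfield L" unfolding subfield_def
  proof (intro conjI ballI)
    show "0 \<in> L" "1 \<in> L" using LI[of 0 0] LI[of 1 0] by simp_all
    fix x assume "x \<in> L"
    then obtain a b where x: "a \<in> K" "b \<in> K" "x = a + b * r" unfolding L_def by blast
    show "inverse x \<in> L"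
    proof (cases "x = 0")
      case True then show ?thesis using LI[of 0 0] by simp
    next
      case False
      let ?n = "a * a + a * b * T + b * b * N"
      have n: "?n \<noteq> 0" using norm_nz x False by simp
      have "x * ((a + b * T) + (- b) * r) = ?n" unfolding x mult_L by (simp add: algebra_simps)
      then have "x * (((a + b * T) + (- b) * r) / ?n) = 1" using n by simp
      moreover have "((a + b * T) + (- b) * r) / ?n = ((a + b * T) / ?n) + (- b / ?n) * r"
        by (simp add: add_divide_distrib diff_divide_distrib)
      ultimately have "x * (((a + b * T) / ?n) + (- b / ?n) * r) = 1" by (simp only:)
      then have "inverse x = ((a + b * T) / ?n) + (- b / ?n) * r" by (rule inverse_unique)
      also have "\<dots> \<in> L" using x TK by (intro LI O.Fdiv) simp_all
      finally show ?thesis .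
    qed
    fix y assume "y \<in> L"
    then obtain c d where y: "c \<in> K" "d \<in> K" "y = c + d * r" unfolding L_def by blast
    have e: "x + y = (a + c) + (b + d) * r" "x - y = (a - c) + (b - d) * r" unfolding x y by (simp_all add: algebra_simps)
    show "x + y \<in> L" "x - y \<in> L" unfolding e using x y by (simp_all add: LI)
    show "x * y \<in> L" unfolding x(3) y(3) mult_L using x y TK by (intro LI) simp_all
  qed
  have r1: "r \<noteq> 1" using rK by auto
  have "L = {(\<Sum>b\<in>{1, r}. c b * b) | c. \<forall>b\<in>{1, r}. c b \<in> K}"
  proof (intro equalityI subsetI)
    fix x assume "x \<in> L"
    then obtain a b where x: "a \<in> K" "b \<in> K" "x = a + b * r" unfolding L_def by blast
    let ?c = "\<lambda>u. if u = 1 then a else b"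
    have "x = (\<Sum>b\<in>{1, r}. ?c b * b)" using r1 x by simp
    then show "x \<in> {(\<Sum>b\<in>{1, r}. c b * b) | c. \<forall>b\<in>{1, r}. c b \<in> K}" using x by (intro CollectI exI[of _ ?c]) simp
  next
    fix x assume "x \<in> {(\<Sum>b\<in>{1, r}. c b * b) | c. \<forall>b\<in>{1, r}. c b \<in> K}"
    then obtain c where "x = (\<Sum>b\<in>{1, r}. c b * b)" "c 1 \<in> K" "c r \<in> K" by auto
    then show "x \<in> L" using r1 LI by simp
  qed
  moreover have "{1, r} \<subseteq> L" using LI[of 1 0] LI[of 0 1] by simp
  ultimately show "\<exists>B. finite B \<and> B \<subseteq> L \<and> L = {(\<Sum>b\<in>B. c b * b) | c. \<forall>b\<in>B. c b \<in> K}"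
    by (intro exI[of _ "{1, r}"]) simp
qed

lemma isint_r: "isint r"
proof -
  have "poly [:N, - T, 1:] r = 0" using rr by (simp add: algebra_simps)
  moreover have "\<forall>i. coeff [:N, - T, 1:] i \<in> Ok" using TO NO by (simp add: coeff_pCons split: nat.splits)
  moreover have "lead_coeff [:N, - T, 1:] = 1" by simp
  ultimately show ?thesis unfolding O.V.integral_def by blast
qed

text \<open>Conjugation without an automorphism: \<open>r\<close> and \<open>s\<close> satisfy the
  same quadratic equation, so polynomial values at \<open>a + b * r\<close> and
  \<open>a + b * s\<close> have the same coordinates. This includes the case
  \<open>s = r\<close>.\<close>

lemma poly_conj:
  assumes "a \<in> K" "b \<in> K" "\<And>i. coeff f i \<in> K"
  shows "\<exists>c\<in>K. \<exists>d\<in>K. poly f (a + b * r) = c + d * r \<and> poly f (a + b * s) = c + d * s"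
  using assms(3)
proof (induction f)
  case 0
  show ?case by (intro bexI[of _ 0]) simp_all
next
  case (pCons u f)
  have "coeff f i \<in> K" for i using pCons.prems[of "Suc i"] by simp
  then obtain c d where cd: "c \<in> K" "d \<in> K" "poly f (a + b * r) = c + d * r" "poly f (a + b * s) = c + d * s"
    using pCons.IH by blast
  have u: "u \<in> K" using pCons.prems[of 0] by simp
  have "poly (pCons u f) (a + b * r) = (u + (a * c - b * d * N)) + (a * d + b * c + b * d * T) * r"
    "poly (pCons u f) (a + b * s) = (u + (a * c - b * d * N)) + (a * d + b * c + b * d * T) * s"
    by (simp_all add: cd mult_L mult_Ls)
  moreover have "u + (a * c - b * d * N) \<in> K" "a * d + b * c + b * d * T \<in> K" using u cd assms TK by simp_all
  ultimately show ?case by blast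
qed

lemma isint_conj:
  assumes "a \<in> K" "b \<in> K" "isint (a + b * r)"
  shows "isint (a + b * s)"
proof -
  obtain f where f: "lead_coeff f = 1" "\<forall>i. coeff f i \<in> Ok" "poly f (a + b * r) = 0"
    using assms(3) unfolding O.V.integral_def by blast
  then have "coeff f i \<in> K" for i by simp
  then obtain c d where cd: "c \<in> K" "d \<in> K" "poly f (a + b * r) = c + d * r" "poly f (a + b * s) = c + d * s"
    using poly_conj[OF assms(1,2)] by blast
  then have "c + d * r = 0" using f(3) by simp
  then have "poly f (a + b * s) = 0" using indep[OF cd(1,2)] cd(4) by simp
  then show ?thesis using f(1,2) unfolding O.V.integral_def by blast
qed

text \<open>The norm of an integral element is integral. If a denominator \<open>p ^ m\<close> with
  \<open>m > 0\<close> were minimal for \<open>a\<close> and \<open>b\<close>, the norm form at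
  \<open>p ^ m * a\<close>, \<open>p ^ m * b\<close> would be divisible by \<open>p * p\<close>, and
  anisotropy would allow a smaller \<open>m\<close>.\<close>

lemma integers_anisotropic:
  assumes an: "anisotropic T N" and ab: "a \<in> K" "b \<in> K" and i: "isint (a + b * r)"
  shows "a \<in> Ok \<and> b \<in> Ok"
proof -
  have n: "(a + b * r) * (a + b * s) = a * a + a * b * T + b * b * N"
  proof -
    have "(a + b * r) * (a + b * s) = a * a + a * b * (r + s) + b * b * (r * s)" by (simp add: algebra_simps)
    then show ?thesis unfolding rs .
  qed
  have nO: "a * a + a * b * T + b * b * N \<in> Ok"
  proof (rule isint_K)
    show "isint (a * a + a * b * T + b * b * N)" unfolding n[symmetric] by (rule isint_ring(3)[OF i isint_conj[OF ab i]])
    show "a * a + a * b * T + b * b * N \<in> K" using ab TK by simp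
  qed
  let ?P = "\<lambda>m. p ^ m * a \<in> Ok \<and> p ^ m * b \<in> Ok"
  obtain m1 m2 where m12: "p ^ m1 * a \<in> Ok" "p ^ m2 * b \<in> Ok" using decomp_K ab by blast
  have "p ^ m2 * (p ^ m1 * a) \<in> Ok" "p ^ m1 * (p ^ m2 * b) \<in> Ok" by (rule O.V.Smult[OF _ m12(1)], simp, rule O.V.Smult[OF _ m12(2)], simp)
  then have "?P (m1 + m2)" by (simp add: power_add mult.assoc mult.left_commute)
  then have "?P (LEAST m. ?P m)" by (rule LeastI)
  define m where "m = (LEAST m. ?P m)"
  have Pm: "p ^ m * a \<in> Ok" "p ^ m * b \<in> Ok" using \<open>?P (LEAST m. ?P m)\<close> unfolding m_def by blast+
  have "m = 0"
  proof (rule ccontr)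
    assume "m \<noteq> 0"
    then obtain l where l: "m = Suc l" by (cases m) auto
    let ?a = "p ^ m * a" and ?b = "p ^ m * b"
    have "?a * ?a + ?a * ?b * T + ?b * ?b * N = (p ^ l * p ^ l * (a * a + a * b * T + b * b * N)) * (p * p)"
      unfolding l by (simp add: algebra_simps)
    then have "O.vle (?a * ?a + ?a * ?b * T + ?b * ?b * N) (p * p)" using nO by (simp add: O.vle_self)
    then have v: "O.vle ?a p" "O.vle ?b p" using an Pm unfolding anisotropic_def by blast+
    have "p ^ l * a = ?a / p" "p ^ l * b = ?b / p" unfolding l by simp_all
    then have "?P l" using v by (simp add: O.vle_div)
    then have "m \<le> l" unfolding m_def by (rule Least_le)
    then show False using l by simp
  qed
  then show ?thesis using Pm by simp
qed

text \<open>Hensel's lemma for the polynomial with roots \<open>r\<close> and \<open>s\<close>: if it split modulo \<open>p\<close> with distinct roots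
  \<open>a\<close>, \<open>b\<close>, then of \<open>r - a\<close> and \<open>r - b\<close>, whose product is divisible by \<open>p\<close>, one is a unit of the valuation
  ring of \<open>L\<close>, and conjugation gives a contradiction.\<close>

lemma not_split_mod: "\<not> split_mod T N"
proof
  assume "split_mod T N"
  then obtain a b where ab: "a \<in> Ok" "b \<in> Ok" "\<not> O.vle (a - b) p" "O.vle (T - a - b) p" "O.vle (N - a * b) p"
    unfolding split_mod_def by blast
  let ?O = "ext_integers K absv L"
  interpret E: valring ?O L using valring_ext[OF L_ext] .
  have OE: "x \<in> Ok \<Longrightarrow> x \<in> ?O" for x using ext_integers_K[OF L_ext] by simp
  have rO: "r \<in> ?O" using isint_r LI[of 0 1] unfolding ext_integers_eq by simp
  have step: False if ab: "a \<in> Ok" "b \<in> Ok" "\<not> O.vle (a - b) p" "O.vle (T - a - b) p" "O.vle (N - a * b) p"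
    and v: "E.vle (r - b) (r - a)" for a b
  proof -
    obtain q where q: "q \<in> ?O" "r - b = q * (r - a)" using v unfolding E.vle_def by blast
    have d: "a - b \<noteq> 0" "inverse (a - b) \<in> Ok" using unit_iff[of "a - b"] ab by simp_all
    \<comment> \<open>Since \<open>a - b\<close> is a unit, so is the larger factor
      \<open>r - a\<close>; therefore \<open>p\<close> divides \<open>r - b\<close>.\<close>
    have "(r - a) * (q - 1) = a - b" using q(2) by (simp add: algebra_simps)
    then have u: "(r - a) * ((q - 1) * inverse (a - b)) = 1" using d(1) by (simp add: mult.assoc[symmetric])
    obtain t n where t: "t \<in> Ok" "T - a - b = t * p" "n \<in> Ok" "N - a * b = n * p" using ab unfolding O.vle_def by blast
    have "(r - b) * (r - a) = (T - a - b) * r - (N - a * b)" using rr by (simp add: algebra_simps)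
    also have "\<dots> = p * (t * r - n)" unfolding t by (simp add: algebra_simps)
    finally have "(r - b) * ((r - a) * ((q - 1) * inverse (a - b))) = p * ((t * r - n) * ((q - 1) * inverse (a - b)))"
      by (simp add: mult.assoc[symmetric])
    then have rb: "r - b = p * ((t * r - n) * ((q - 1) * inverse (a - b)))" unfolding u by simp
    have "(t * r - n) * ((q - 1) * inverse (a - b)) \<in> ?O" using t(1,3) q(1) d(2) rO OE by simp
    then have "isint ((r - b) / p)" unfolding rb ext_integers_eq by simp
    moreover have e: "(r - b) / p = (- b / p) + inverse p * r" "(s - b) / p = (- b / p) + inverse p * s"
      by (simp_all add: field_simps)
    moreover have bp: "- b / p \<in> K" "inverse p \<in> K" using ab(2) pK by simp_all
    ultimately have i2: "isint ((r - b) / p)" "isint ((s - b) / p)" using isint_conj[OF bp] by simp_all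
    \<comment> \<open>The sum with the conjugate descends to K: \<open>p\<close> divides
      \<open>T - 2 * b\<close>. Since \<open>T = a + b\<close> modulo \<open>p\<close>, this
      contradicts \<open>a\<close> and \<open>b\<close> being distinct modulo
      \<open>p\<close>.\<close>
    have "isint ((r - b) / p + (s - b) / p)" by (rule isint_ring(1)[OF i2])
    moreover have "(r - b) / p + (s - b) / p = ((r + s) - 2 * b) / p" by (simp add: field_simps)
    then have "(r - b) / p + (s - b) / p = (T - 2 * b) / p" unfolding rs(2) .
    moreover have "(T - 2 * b) / p \<in> K" using TK ab(2) pK by simp
    ultimately have "(T - 2 * b) / p \<in> Ok" using isint_K by simp
    then have "O.vle (T - 2 * b) p" by (simp add: O.vle_div)
    then have "O.vle ((T - 2 * b) - (T - a - b)) p" using ab(4) by (rule O.vle_diff)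
    then show False using ab(3) by simp
  qed
  have "r - a \<in> L" "r - b \<in> L" using rO OE[OF ab(1)] OE[OF ab(2)] by simp_all
  then consider "E.vle (r - b) (r - a)" | "E.vle (r - a) (r - b)" using E.vle_total by blast
  then show False
  proof cases
    case 1
    then show ?thesis using step[OF ab] by blast
  next
    case 2
    have "\<not> O.vle (b - a) p" using ab(3) O.vle_uminus_iff[of "a - b" p] by simp
    moreover have "O.vle (T - b - a) p" "O.vle (N - b * a) p" using ab by (simp_all add: algebra_simps)
    ultimately show ?thesis using step[OF ab(2,1) _ _ _ 2] by blast
  qed
qed

end

lemma ghost_power_cancel: "q \<noteq> 0 \<Longrightarrow> (q * v + q * w * r - q * z * r * r) / (c * q) = (v + w * r - z * r * r) / (c::'a::field)"
proof -
  assume "q \<noteq> 0"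
  have "q * v + q * w * r - q * z * r * r = (v + w * r - z * r * r) * q" by (simp add: algebra_simps)
  then show ?thesis using \<open>q \<noteq> 0\<close> by simp
qed

context quadratic_ext
begin

text \<open>\<open>phi m\<close> is \<open>det (e, m e)\<close> for \<open>e = (1, r)\<close>, the
  eigenvector with eigenvalue \<open>r\<close> of the companion matrix.\<close>

definition phi :: "'a^2^2 \<Rightarrow> 'a" where
  "phi m = m$2$1 + (m$2$2 - m$1$1) * r - m$1$2 * r * r"

lemma phi_mk: "phi (mk y z v w) = v + (w - y) * r - z * r * r"
  by (simp add: phi_def)

lemma phi_mk': "phi (mk y z v w) = (v + N * z) + (w - y - T * z) * r"
proof -
  have "phi (mk y z v w) = v + (w - y) * r - z * (r * r)" by (simp add: phi_mk mult.assoc)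
  then show ?thesis unfolding rr by (simp add: algebra_simps)
qed

lemma phi_add: "phi (a + b) = phi a + phi b"
  by (cases a rule: mk_cases; cases b rule: mk_cases) (simp add: phi_mk algebra_simps)

lemma phi_diff: "phi (a - b) = phi a - phi b"
  by (cases a rule: mk_cases; cases b rule: mk_cases) (simp add: phi_mk algebra_simps)

lemma phi_scale: "phi (mscale c a) = c * phi a"
  by (cases a rule: mk_cases) (simp add: phi_mk algebra_simps)

text \<open>With \<open>A\<close> the companion matrix,
  \<open>det (A e, A m e) = N * det (e, m e)\<close> and \<open>A e = r e\<close>, where
  \<open>N = r * s\<close>; this explains the factor \<open>s\<close>. Since
  \<open>s = T - r\<close>, the values of \<open>phi\<close> on \<open>G\<close> form a module over
  \<open>Ok + Ok r\<close>.\<close>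

lemma phi_companion: "phi (mk 0 1 (- N) T ** a) = s * phi a"
proof -
  obtain y z v w where a: "a = mk y z v w" by (rule mk_cases)
  have "s * phi a = s * (v + N * z) + (w - y - T * z) * (r * s)" unfolding a phi_mk' by (simp add: algebra_simps)
  also have "\<dots> = s * (v + N * z) + (w - y - T * z) * N" unfolding rs ..
  finally show ?thesis unfolding a by (simp add: phi_mk' s_def algebra_simps)
qed

text \<open>The functional \<open>phi\<close> measures the distance to the end fixed by \<open>\<alpha>\<close>. Its image on \<open>G\<close> is an ideal \<open>c O\<^sub>L\<close>
  and it determines \<open>G\<close>, so \<open>G\<close> is cut out by a single vertex defined over \<open>L\<close>.\<close>

lemma anisotropic_ghost:
  assumes G: "full_order K absv G" and PQ: "O.inv_pair P Q" and GO: "\<And>x. x \<in> G \<Longrightarrow> Q ** x ** P \<in> mats Ok"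
    and \<alpha>: "\<alpha> \<in> G" "Q ** \<alpha> ** P = mk 0 1 (- N) T" and an: "anisotropic T N"
  shows "ghost_intersection K absv (spi k G)"
proof -
  let ?O = "ext_integers K absv L"
  interpret E: valring ?O L using valring_ext[OF L_ext] .
  note i = PQ[unfolded O.inv_pair_def] and Gd = full_orderD[OF G]
  have OE: "x \<in> Ok \<Longrightarrow> x \<in> ?O" for x using ext_integers_K[OF L_ext] by simp
  have rO: "r \<in> ?O" using isint_r LI[of 0 1] unfolding ext_integers_eq by simp
  define f where "f x = phi (Q ** x ** P)" for x
  have f_add: "f (x + y) = f x + f y" and f_diff: "f (x - y) = f x - f y" and f_scale: "f (mscale c x) = c * f x" for x y c
    unfolding f_def by (simp_all add: mat_lin phi_add phi_diff phi_scale)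
  have f0: "f 0 = 0" using f_scale[of 0 0] by simp
  have fO: "f x \<in> ?O" if "x \<in> G" for x
    using GO[OF that] OE rO unfolding f_def by (cases "Q ** x ** P" rule: mk_cases) (simp add: phi_mk)
  obtain H where H: "finite H" "H \<subseteq> G" "G = lspan Ok H" using Gd(1) unfolding is_order_def fin_gen_def by blast
  have "H \<noteq> {}"
  proof
    assume "H = {}"
    then have "G \<subseteq> {0}" using lspan_least[of Ok "{0}" H] H by (simp add: is_mod_def)
    then show False using Gd(3) by (auto simp: mk_one mk_zero)
  qed
  moreover have "f ` H \<subseteq> L" using fO H(2) E.VF by blast
  \<comment> \<open>Finitely many generators suffice to find an element of \<open>G\<close> whose
    value \<open>c\<close> divides all others.\<close>
  ultimately obtain \<gamma> where \<gamma>: "\<gamma> \<in> H" "\<forall>x\<in>H. E.vle (f x) (f \<gamma>)"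
    using E.ex_max[of "f ` H"] H(1) by blast
  define c where "c = f \<gamma>"
  have \<gamma>G: "\<gamma> \<in> G" using \<gamma>(1) H(2) by blast
  have cO: "c \<in> ?O" unfolding c_def by (rule fO[OF \<gamma>G])
  have M: "is_mod Ok {x. E.vle (f x) c}"
    unfolding is_mod_def by (simp add: f_add f_scale f0 E.vle_add E.vle_mult OE)
  have fc: "E.vle (f x) c" if "x \<in> G" for x
    using lspan_least[OF M, of H] \<gamma>(2) H(3) that unfolding c_def by blast
  have c0: "c \<noteq> 0"
  proof
    assume "c = 0"
    then have "G \<subseteq> {x. f x = 0}" using fc unfolding E.vle_def by auto
    moreover have "is_mod K {x. f x = 0}" unfolding is_mod_def by (simp add: f_add f_scale f0)
    ultimately have "mats K \<subseteq> {x. f x = 0}" using lspan_least[of K "{x. f x = 0}" G] Gd(5) by simp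
    moreover have "P ** mk 0 0 1 0 ** Q \<in> mats K" using i by simp
    ultimately have "f (P ** mk 0 0 1 0 ** Q) = 0" by blast
    then show False unfolding f_def using conj_cancel[of Q P] i by (simp add: phi_mk)
  qed
  \<comment> \<open>Conversely, an integral \<open>a\<close> with \<open>phi a\<close> divisible by
    \<open>c\<close> is matched by an element \<open>y\<close> of
    \<open>Ok[\<alpha>] \<gamma>\<close> with the same \<open>phi\<close>. The difference lies in
    the kernel of \<open>phi\<close> on integral matrices, spanned by \<open>mat 1\<close> and the
    companion matrix, and both come from \<open>G\<close>.\<close>
  have core: "P ** a ** Q \<in> G" if a: "a \<in> mats Ok" "phi a / c \<in> ?O" for a
  proof -
    have "phi a / c \<in> L" "isint (phi a / c)" using a(2) unfolding ext_integers_eq by simp_all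
    then obtain g h where gh: "g \<in> K" "h \<in> K" "phi a / c = g + h * r" "isint (g + h * r)" unfolding L_def by auto
    \<comment> \<open>Here it matters that \<open>Ok + Ok r\<close> is the whole ring of integers of
      \<open>L\<close>.\<close>
    have ghO: "g \<in> Ok" "h \<in> Ok" using integers_anisotropic[OF an gh(1,2,4)] by simp_all
    \<comment> \<open>Multiplying \<open>\<gamma>\<close> by \<open>\<alpha>\<close> multiplies
      \<open>phi\<close> by \<open>s\<close>, so \<open>(g + h * T) - h \<alpha>\<close> multiplies
      it by \<open>g + h * T - h * s = g + h * r\<close>.\<close>
    define y where "y = mscale (g + h * T) \<gamma> - mscale h (\<alpha> ** \<gamma>)"
    have "g + h * T \<in> Ok" using ghO TO by simp
    then have yG: "y \<in> G" unfolding y_def by (rule Gd(7)[OF Gd(9)[OF _ \<gamma>G] Gd(9)[OF ghO(2) Gd(8)[OF \<alpha>(1) \<gamma>G]]])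
    have "f (\<alpha> ** \<gamma>) = s * c" unfolding f_def c_def using O.conj_mult[of P Q \<alpha> \<gamma>] i \<alpha>(2) phi_companion by simp
    then have "f y = (g + h * T - h * s) * c" unfolding y_def f_diff f_scale by (simp add: c_def[symmetric] algebra_simps)
    also have "g + h * T - h * s = g + h * r" by (simp add: s_def algebra_simps)
    also have "(g + h * r) * c = phi a" using gh(3)[symmetric] c0 by simp
    finally have fy: "f y = phi a" .
    obtain d1 d2 d3 d4 where d: "a - Q ** y ** P = mk d1 d2 d3 d4" by (rule mk_cases)
    have "a - Q ** y ** P \<in> mats Ok" using a(1) GO[OF yG] by simp
    then have dO: "d1 \<in> Ok" "d2 \<in> Ok" "d3 \<in> Ok" "d4 \<in> Ok" unfolding d by simp_all
    have "phi (a - Q ** y ** P) = 0" using fy unfolding phi_diff f_def by simp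
    then have z: "(d3 + N * d2) + (d4 - d1 - T * d2) * r = 0" unfolding d phi_mk' .
    have "d3 + N * d2 = 0 \<and> d4 - d1 - T * d2 = 0" by (rule indep[OF _ _ z]) (use dO TK in simp_all)
    then have d34: "d3 = - (N * d2)" "d4 = d1 + T * d2" by (simp_all add: eq_neg_iff_add_eq_0 algebra_simps)
    define x where "x = y + (mscale d1 (mat 1) + mscale d2 \<alpha>)"
    have xG: "x \<in> G" unfolding x_def by (rule Gd(6)[OF yG Gd(6)[OF Gd(12)[OF dO(1)] Gd(9)[OF dO(2) \<alpha>(1)]]])
    have "Q ** x ** P = Q ** y ** P + (mscale d1 (mat 1) + mscale d2 (Q ** \<alpha> ** P))"
      unfolding x_def using i by (simp add: mat_lin)
    also have "\<dots> = Q ** y ** P + mk d1 d2 d3 d4" unfolding \<alpha>(2) d34 by (simp add: mk_one mult.commute)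
    also have "\<dots> = a" unfolding d[symmetric] by simp
    finally have "P ** a ** Q = x" using conj_cancel[of P Q x] i by simp
    then show ?thesis using xG by simp
  qed
  have pk: "p ^ k \<in> ?O" "p ^ k \<noteq> 0" using OE by simp_all
  have inK: "O.vle u (p ^ k)" if "u \<in> K" "u / p ^ k \<in> ?O" for u
    using ext_integers_K[OF L_ext, of "u / p ^ k"] that pK by (simp add: O.vle_div)
  show ?thesis
  proof (rule ghostI[OF spi_full_order[OF G] L_ext PQ pk(1) pk(1) pk(1) _ pk(2) pk(2) pk(2) _ rO])
    show "c * p ^ k \<in> ?O" "c * p ^ k \<noteq> 0" using cO pk c0 by simp_all
    fix x y z v w assume x: "x \<in> mats K" "Q ** x ** P = mk y z v w"
    note si = spi_conj_iff[OF PQ G GO x, of k]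
    show "x \<in> spi k G \<longleftrightarrow> y \<in> Ok \<and> z \<in> Ok \<and> v \<in> Ok \<and> w \<in> Ok \<and>
      v / p ^ k \<in> ?O \<and> z / p ^ k \<in> ?O \<and> (v + (w - y) - z) / p ^ k \<in> ?O \<and>
      (v + (w - y) * r - z * r * r) / (c * p ^ k) \<in> ?O" (is "_ \<longleftrightarrow> ?rhs")
    proof
      assume "x \<in> spi k G"
      then obtain z' v' w' where *: "y \<in> Ok" "z \<in> Ok" "v \<in> Ok" "w \<in> Ok" "z' \<in> Ok" "v' \<in> Ok" "w' \<in> Ok"
        "z = p ^ k * z'" "v = p ^ k * v'" "w - y = p ^ k * w'" "P ** mk 0 z' v' w' ** Q \<in> G" using si by blast
      have "f (P ** mk 0 z' v' w' ** Q) = v' + w' * r - z' * r * r"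
        unfolding f_def using conj_cancel[of Q P] i by (simp add: phi_mk)
      then have "(v' + w' * r - z' * r * r) / c \<in> ?O" using fc[OF *(11)] c0 by (simp add: E.vle_div)
      then have "(v + (w - y) * r - z * r * r) / (c * p ^ k) \<in> ?O" unfolding *(8-10) ghost_power_cancel[OF pk(2)] .
      moreover have "v / p ^ k = v'" "z / p ^ k = z'" unfolding *(8,9) using pk by simp_all
      moreover have "(v + (w - y) - z) / p ^ k = v' + w' - z'" unfolding *(8-10) using pk by (simp add: field_simps)
      ultimately show ?rhs using *(1-7) OE by simp
    next
      assume r: ?rhs
      then have V: "y \<in> Ok" "z \<in> Ok" "v \<in> Ok" "w \<in> Ok" by blast+
      then have vle: "O.vle z (p ^ k)" "O.vle v (p ^ k)" "O.vle (v + (w - y) - z) (p ^ k)" using r by (intro inK; simp)+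
      obtain z' v' w' where s: "z' \<in> Ok" "v' \<in> Ok" "w' \<in> Ok" "mk y z v w = mscale y (mat 1) + mscale (p ^ k) (mk 0 z' v' w')"
        using mod_scalar_split[OF V vle] by blast
      then have e: "z = p ^ k * z'" "v = p ^ k * v'" "w - y = p ^ k * w'" by (simp_all add: mk_one)
      have "(v + (w - y) * r - z * r * r) / (c * p ^ k) \<in> ?O" using r by blast
      then have "(v' + w' * r - z' * r * r) / c \<in> ?O" unfolding e ghost_power_cancel[OF pk(2)] .
      then have "P ** mk 0 z' v' w' ** Q \<in> G" using s(1-3) by (intro core) (simp_all add: phi_mk)
      then show "x \<in> spi k G" using si V s(1-3) e by blast
    qed
  qed
qed

end

section \<open>The split case\<close>

context local_field
begin

lemma trivial_ext: "finite_extension K K"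
  unfolding finite_extension_def
proof (intro conjI subK order_refl exI[of _ "{1}"])
  show "K = {(\<Sum>b\<in>{1}. c b * b) | c. \<forall>b\<in>{1}. c b \<in> K}"
  proof (intro equalityI subsetI)
    fix x assume "x \<in> K"
    then show "x \<in> {(\<Sum>b\<in>{1}. c b * b) | c. \<forall>b\<in>{1}. c b \<in> K}" by (intro CollectI exI[of _ "\<lambda>_. x"]) simp
  qed auto
qed simp_all

lemma ext_trivial: "ext_integers K absv K = Ok"
  using ext_integers_K[OF trivial_ext] O.VF unfolding ext_integers_eq by blast

text \<open>An order containing the diagonal idempotents is determined by the ideals of its off-diagonal entries.\<close>

lemma diagonal_ghost:
  assumes G: "full_order K absv G" and PQ: "O.inv_pair P Q" and GO: "\<And>x. x \<in> G \<Longrightarrow> Q ** x ** P \<in> mats Ok"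
    and e: "\<epsilon> \<in> G" "Q ** \<epsilon> ** P = mk 1 0 0 0"
  shows "ghost_intersection K absv (spi k G)"
proof -
  note i = PQ[unfolded O.inv_pair_def] and Gd = full_orderD[OF G]
  obtain H where H: "finite H" "H \<subseteq> G" "G = lspan Ok H" using Gd(1) unfolding is_order_def fin_gen_def by blast
  have Hne: "H \<noteq> {}"
  proof
    assume "H = {}"
    then have "G \<subseteq> {0}" using lspan_least[of Ok "{0}" H] H by (simp add: is_mod_def)
    then show False using Gd(3) by (auto simp: mk_one mk_zero)
  qed
  \<comment> \<open>Used for the two off-diagonal entries: the values of such a functional on
    \<open>G\<close> form a nonzero ideal generated by one of them.\<close>
  have gen: "\<exists>\<gamma>\<in>G. f \<gamma> \<noteq> 0 \<and> (\<forall>x\<in>G. O.vle (f x) (f \<gamma>))"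
    if f: "\<And>x y. f (x + y) = f x + f y" "\<And>c x. f (mscale c x) = c * f x" "\<And>x. x \<in> G \<Longrightarrow> f x \<in> Ok"
      and nz: "\<exists>x\<in>mats K. f x \<noteq> 0" for f :: "'a^2^2 \<Rightarrow> 'a"
  proof -
    have f0: "f 0 = 0" using f(2)[of 0 0] by simp
    have "f ` H \<subseteq> K" using f(3) H(2) by auto
    then obtain \<gamma> where \<gamma>: "\<gamma> \<in> H" "\<forall>x\<in>H. O.vle (f x) (f \<gamma>)" using O.ex_max[of "f ` H"] H(1) Hne by blast
    have M: "is_mod Ok {x. O.vle (f x) (f \<gamma>)}" unfolding is_mod_def by (simp add: f(1,2) f0 O.vle_add O.vle_mult)
    have all: "\<forall>x\<in>G. O.vle (f x) (f \<gamma>)" using lspan_least[OF M, of H] \<gamma>(2) H(3) by blast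
    have "f \<gamma> \<noteq> 0"
    proof
      assume "f \<gamma> = 0"
      then have "G \<subseteq> {x. f x = 0}" using all unfolding O.vle_def by auto
      moreover have "is_mod K {x. f x = 0}" unfolding is_mod_def by (simp add: f(1,2) f0)
      ultimately have "mats K \<subseteq> {x. f x = 0}" using lspan_least[of K "{x. f x = 0}" G] Gd(5) by simp
      then show False using nz by blast
    qed
    then show ?thesis using \<gamma>(1) H(2) all by blast
  qed
  define a where "a x = Q ** x ** P" for x
  have aO: "a x \<in> mats Ok" if "x \<in> G" for x unfolding a_def by (rule GO[OF that])
  have a_lin: "a (x + y) = a x + a y" "a (mscale c x) = mscale c (a x)" "a (x - y) = a x - a y" for x y c
    unfolding a_def by (simp_all add: mat_lin)
  have a_mult: "a (x ** y) = a x ** a y" for x y unfolding a_def using O.conj_mult i by blast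
  have a_one: "a (mat 1) = mat 1" unfolding a_def using i by simp
  have aP: "a (P ** m ** Q) = m" for m unfolding a_def using conj_cancel[of Q P] i by simp
  have Pa: "P ** a x ** Q = x" for x unfolding a_def using conj_cancel[of P Q] i by simp
  have PmK: "P ** m ** Q \<in> mats K" if "m \<in> mats K" for m using that i by simp
  have nth: "(x + y)$b$d = x$b$d + y$b$d" "(mscale c x)$b$d = c * x$b$d" for x y :: "'a^2^2" and b d c by (simp_all add: mscale_def)
  have aO': "(a x)$b$d \<in> Ok" if "x \<in> G" for x b d using aO[OF that] unfolding mats_def by blast
  have "\<exists>\<gamma>\<in>G. (a \<gamma>)$1$2 \<noteq> 0 \<and> (\<forall>x\<in>G. O.vle ((a x)$1$2) ((a \<gamma>)$1$2))"
  proof (rule gen[of "\<lambda>x. (a x)$1$2"])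
    have "P ** mk 0 1 0 0 ** Q \<in> mats K" by (rule PmK) simp
    moreover have "(a (P ** mk 0 1 0 0 ** Q))$1$2 \<noteq> 0" unfolding aP by simp
    ultimately show "\<exists>x\<in>mats K. (a x)$1$2 \<noteq> 0" by blast
  qed (simp_all add: a_lin nth aO')
  then obtain g1 where g1: "g1 \<in> G" "(a g1)$1$2 \<noteq> 0" "\<forall>x\<in>G. O.vle ((a x)$1$2) ((a g1)$1$2)" by blast
  have "\<exists>\<gamma>\<in>G. (a \<gamma>)$2$1 \<noteq> 0 \<and> (\<forall>x\<in>G. O.vle ((a x)$2$1) ((a \<gamma>)$2$1))"
  proof (rule gen[of "\<lambda>x. (a x)$2$1"])
    have "P ** mk 0 0 1 0 ** Q \<in> mats K" by (rule PmK) simp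
    moreover have "(a (P ** mk 0 0 1 0 ** Q))$2$1 \<noteq> 0" unfolding aP by simp
    ultimately show "\<exists>x\<in>mats K. (a x)$2$1 \<noteq> 0" by blast
  qed (simp_all add: a_lin nth aO')
  then obtain g2 where g2: "g2 \<in> G" "(a g2)$2$1 \<noteq> 0" "\<forall>x\<in>G. O.vle ((a x)$2$1) ((a g2)$2$1)" by blast
  define c1 c2 where "c1 = (a g1)$1$2" and "c2 = (a g2)$2$1"
  have cO: "c1 \<in> Ok" "c2 \<in> Ok" unfolding c1_def c2_def using aO' g1(1) g2(1) by blast+
  have c0: "c1 \<noteq> 0" "c2 \<noteq> 0" unfolding c1_def c2_def using g1 g2 by blast+
  define \<epsilon>' where "\<epsilon>' = mat 1 - \<epsilon>"
  have e': "\<epsilon>' \<in> G" unfolding \<epsilon>'_def by (rule Gd(7)[OF Gd(3) e(1)])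
  have ae: "a \<epsilon> = mk 1 0 0 0" "a \<epsilon>' = mk 0 0 0 1" unfolding \<epsilon>'_def a_lin a_one using e(2) by (simp_all add: a_def mk_one)
  have core: "P ** mk y z v w ** Q \<in> G" if V: "y \<in> Ok" "w \<in> Ok" "z / c1 \<in> Ok" "v / c2 \<in> Ok" for y z v w
  proof -
    \<comment> \<open>Multiplying by complementary idempotents on both sides isolates the
      off-diagonal entries \<open>c1\<close> of \<open>g1\<close> and \<open>c2\<close> of
      \<open>g2\<close>.\<close>
    define x where "x = (mscale y \<epsilon> + mscale w \<epsilon>') + (mscale (z / c1) (\<epsilon> ** g1 ** \<epsilon>') + mscale (v / c2) (\<epsilon>' ** g2 ** \<epsilon>))"
    have "x \<in> G" unfolding x_def
      by (rule Gd(6)[OF Gd(6)[OF Gd(9)[OF V(1) e(1)] Gd(9)[OF V(2) e']]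
         Gd(6)[OF Gd(9)[OF V(3) Gd(8)[OF Gd(8)[OF e(1) g1(1)] e']] Gd(9)[OF V(4) Gd(8)[OF Gd(8)[OF e' g2(1)] e(1)]]]])
    moreover have "a (\<epsilon> ** g1 ** \<epsilon>') = mk 0 c1 0 0"
      unfolding a_mult ae c1_def by (cases "a g1" rule: mk_cases) simp
    moreover have "a (\<epsilon>' ** g2 ** \<epsilon>) = mk 0 0 c2 0"
      unfolding a_mult ae c2_def by (cases "a g2" rule: mk_cases) simp
    ultimately show ?thesis using c0 Pa[of x] unfolding x_def a_lin ae by simp
  qed
  have pk: "p ^ k \<in> Ok" "p ^ k \<noteq> 0" by simp_all
  show ?thesis
  \<comment> \<open>The end \<open>e = 0\<close> with \<open>d4 = 1\<close> makes the fourth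
    condition of \<open>ghostI\<close> repeat the integrality of \<open>v\<close>; all vertices are
    defined over K.\<close>
  proof (rule ghostI[OF spi_full_order[OF G] trivial_ext PQ, of "c2 * p ^ k" "c1 * p ^ k" "p ^ k" 1 0, unfolded ext_trivial])
    fix x y z v w assume x: "x \<in> mats K" "Q ** x ** P = mk y z v w"
    note si = spi_conj_iff[OF PQ G GO x, of k]
    show "x \<in> spi k G \<longleftrightarrow> y \<in> Ok \<and> z \<in> Ok \<and> v \<in> Ok \<and> w \<in> Ok \<and>
      v / (c2 * p ^ k) \<in> Ok \<and> z / (c1 * p ^ k) \<in> Ok \<and> (v + (w - y) - z) / p ^ k \<in> Ok \<and>
      (v + (w - y) * 0 - z * 0 * 0) / 1 \<in> Ok" (is "_ \<longleftrightarrow> ?rhs")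
    proof
      assume "x \<in> spi k G"
      then obtain z' v' w' where *: "y \<in> Ok" "z \<in> Ok" "v \<in> Ok" "w \<in> Ok" "z' \<in> Ok" "v' \<in> Ok" "w' \<in> Ok"
        "z = p ^ k * z'" "v = p ^ k * v'" "w - y = p ^ k * w'" "P ** mk 0 z' v' w' ** Q \<in> G" using si by blast
      have "O.vle z' c1" "O.vle v' c2" using g1(3) g2(3) *(11) aP[of "mk 0 z' v' w'"] unfolding c1_def c2_def by (metis mk_nth(2,3))+
      then have "z' / c1 \<in> Ok" "v' / c2 \<in> Ok" using c0 by (simp_all add: O.vle_div)
      moreover have "v / (c2 * p ^ k) = v' / c2" "z / (c1 * p ^ k) = z' / c1" unfolding *(8,9) using pk by simp_all
      moreover have "(v + (w - y) - z) / p ^ k = v' + w' - z'" unfolding *(8-10) using pk by (simp add: field_simps)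
      ultimately show ?rhs using *(1-7) by simp
    next
      assume r: ?rhs
      then have V: "y \<in> Ok" "z \<in> Ok" "v \<in> Ok" "w \<in> Ok" by blast+
      have "c2 * (v / (c2 * p ^ k)) \<in> Ok" "c1 * (z / (c1 * p ^ k)) \<in> Ok"
        using r by (simp_all only: O.V.Smult cO)
      then have "v / p ^ k \<in> Ok" "z / p ^ k \<in> Ok" using c0 by simp_all
      then have vle: "O.vle z (p ^ k)" "O.vle v (p ^ k)" "O.vle (v + (w - y) - z) (p ^ k)" using r by (simp_all add: O.vle_div)
      obtain z' v' w' where s: "z' \<in> Ok" "v' \<in> Ok" "w' \<in> Ok" "mk y z v w = mscale y (mat 1) + mscale (p ^ k) (mk 0 z' v' w')"
        using mod_scalar_split[OF V vle] by blast
      then have e: "z = p ^ k * z'" "v = p ^ k * v'" "w - y = p ^ k * w'" by (simp_all add: mk_one)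
      have "v / (c2 * p ^ k) = v' / c2" "z / (c1 * p ^ k) = z' / c1" unfolding e using pk by simp_all
      then have "z' / c1 \<in> Ok" "v' / c2 \<in> Ok" using r by simp_all
      then have "P ** mk 0 z' v' w' ** Q \<in> G" using s(3) by (intro core) simp_all
      then show "x \<in> spi k G" using si V s(1-3) e by blast
    qed
  qed (use cO c0 in simp_all)
qed

lemma split_ghost:
  assumes G: "full_order K absv G" and PQ: "O.inv_pair P Q" and GO: "\<And>x. x \<in> G \<Longrightarrow> Q ** x ** P \<in> mats Ok"
    and \<alpha>: "\<alpha> \<in> G" "Q ** \<alpha> ** P = mk 0 1 (- N) T" and TN: "T \<in> Ok" "N \<in> Ok"
    and r: "r \<in> K" "r * r = T * r - N" and sp: "split_mod T N"
  shows "ghost_intersection K absv (spi k G)"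
proof -
  note i = PQ[unfolded O.inv_pair_def] and Gd = full_orderD[OF G]
  have "isint r"
  proof -
    have "poly [:N, - T, 1:] r = 0" using r(2) by (simp add: algebra_simps)
    moreover have "\<forall>i. coeff [:N, - T, 1:] i \<in> Ok" using TN by (simp add: coeff_pCons split: nat.splits)
    moreover have "lead_coeff [:N, - T, 1:] = 1" by simp
    ultimately show ?thesis unfolding O.V.integral_def by blast
  qed
  then have rO: "r \<in> Ok" using isint_K r(1) by blast
  define s where "s = T - r"
  have sO: "s \<in> Ok" unfolding s_def using TN rO by simp
  have rs: "r * s = N" "s * s = T * s - N" "T = r + s" using r(2) by (simp_all add: s_def algebra_simps)
  define d where "d = s - r"
  have dO: "d \<in> Ok" unfolding d_def using sO rO by simp
  have "\<not> O.vle d p"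
  proof
    assume v: "O.vle d p"
    obtain a b where ab: "a \<in> Ok" "b \<in> Ok" "\<not> O.vle (a - b) p" "O.vle (T - a - b) p" "O.vle (N - a * b) p"
      using sp unfolding split_mod_def by blast
    have "T + a + b \<in> Ok" using TN ab by simp
    \<comment> \<open>\<open>d * d\<close> is the discriminant \<open>T * T - 4 * N\<close>, which
      modulo \<open>p\<close> equals \<open>(a - b) * (a - b)\<close>. So the roots \<open>r\<close>
      and \<open>s\<close> remain distinct modulo \<open>p\<close>, and the eigenvectors
      \<open>(1, r)\<close>, \<open>(1, s)\<close> form a basis over \<open>Ok\<close>.\<close>
    then have "O.vle (d * d - (T + a + b) * (T - a - b) + 4 * (N - a * b)) p"
      by (rule O.vle_add[OF O.vle_diff[OF O.vle_mult[OF dO v] O.vle_mult[OF _ ab(4)]] O.vle_mult[OF O.V.Snumeral ab(5)]])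
    moreover have "d * d - (T + a + b) * (T - a - b) + 4 * (N - a * b) = (a - b) * (a - b)"
      unfolding d_def rs(3) rs(1)[symmetric] by (simp add: algebra_simps)
    ultimately have "O.vle ((a - b) * (a - b)) p" by simp
    then show False using vle_square[of "a - b"] ab by simp
  qed
  then have d: "d \<noteq> 0" "inverse d \<in> Ok" using unit_iff[OF dO] by blast+
  let ?U = "mk 1 1 r s" and ?U' = "mscale (inverse d) (mk s (- 1) (- r) 1)"
  have "?U ** ?U' = mscale (inverse d) (mk d 0 0 d)" "?U' ** ?U = mscale (inverse d) (mk d 0 0 d)"
    unfolding d_def by (simp_all add: algebra_simps)
  then have inv: "?U ** ?U' = mat 1" "?U' ** ?U = mat 1" using d by (simp_all add: mk_one)
  have UO: "?U \<in> mats Ok" "?U' \<in> mats Ok" using rO sO d by simp_all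
  have UU: "O.inv_pair ?U ?U'" unfolding O.inv_pair_def using inv UO O.matsVF by blast
  define P2 Q2 where "P2 = P ** ?U" and "Q2 = ?U' ** Q"
  have PQ2: "O.inv_pair P2 Q2" unfolding P2_def Q2_def by (rule inv_pair_mult[OF PQ UU])
  have conj: "Q2 ** x ** P2 = ?U' ** (Q ** x ** P) ** ?U" for x unfolding P2_def Q2_def by (simp only: matrix_mul_assoc)
  have GO2: "Q2 ** x ** P2 \<in> mats Ok" if "x \<in> G" for x unfolding conj
    by (rule O.V.mats_mult[OF O.V.mats_mult[OF UO(2) GO[OF that]] UO(1)])
  have "mk 0 1 (- N) T ** ?U = ?U ** mk r 0 0 s" using r(2) rs(2) by simp
  then have "?U' ** (mk 0 1 (- N) T ** ?U) = (?U' ** ?U) ** mk r 0 0 s" by (simp only: matrix_mul_assoc)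
  then have a2: "Q2 ** \<alpha> ** P2 = mk r 0 0 s" unfolding conj \<alpha>(2) inv by (simp only: matrix_mul_assoc matrix_mul_lid)
  \<comment> \<open>The projection onto the \<open>r\<close>-eigenspace along the
    \<open>s\<close>-eigenspace; it lies in \<open>G\<close> because \<open>d = s - r\<close> is a
    unit.\<close>
  define \<epsilon> where "\<epsilon> = mscale (- inverse d) (\<alpha> - mscale s (mat 1))"
  have "- inverse d \<in> Ok" using d(2) by (rule O.V.Suminus)
  then have eG: "\<epsilon> \<in> G" unfolding \<epsilon>_def by (rule Gd(9)[OF _ Gd(7)[OF \<alpha>(1) Gd(12)[OF sO]]])
  note i2 = PQ2[unfolded O.inv_pair_def]
  have "Q2 ** \<epsilon> ** P2 = mscale (- inverse d) (mk r 0 0 s - mscale s (mat 1))"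
    unfolding \<epsilon>_def a2[symmetric] using i2 by (simp add: mat_lin)
  also have "\<dots> = mk (inverse d * d) 0 0 0" unfolding d_def by (simp add: mk_one algebra_simps)
  finally have "Q2 ** \<epsilon> ** P2 = mk 1 0 0 0" using d by simp
  then show ?thesis using diagonal_ghost[OF G PQ2 GO2 eG] by blast
qed

lemma bass_imp_ghost:
  assumes alg: "\<forall>q::'a poly. degree q > 0 \<longrightarrow> (\<exists>x. poly q x = 0)"
    and R: "full_order K absv R" and B: "bass_order K absv (gor_closure K absv R)"
  shows "ghost_intersection K absv R"
proof -
  obtain k G where G: "gorenstein K absv G" "R = spi k G" using exists_gorenstein_closure[OF R] by blast
  have GB: "bass_order K absv G" using B unfolding G(2) gor_closure_eq[OF G(1)] .
  have Gf: "full_order K absv G" using gorenstein_full[OF G(1)] .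
  obtain P Q \<alpha> T N where *: "O.inv_pair P Q" "\<And>x. x \<in> G \<Longrightarrow> Q ** x ** P \<in> mats Ok" "T \<in> Ok" "N \<in> Ok" "\<alpha> \<in> G"
    "Q ** \<alpha> ** P = mk 0 1 (- N) T" "anisotropic T N \<or> split_mod T N" using find_companion[OF GB] by blast
  have "degree [:N, - T, 1:] > 0" by simp
  \<comment> \<open>The quadratic extension is found inside the ambient field, whose polynomials
    have roots by \<open>alg\<close>.\<close>
  then obtain r where "poly [:N, - T, 1:] r = 0" using alg by blast
  then have r: "r * r = T * r - N" by (simp add: algebra_simps eq_neg_iff_add_eq_0)
  show ?thesis
  proof (cases "r \<in> K")
    case False
    then interpret quadratic_ext K absv p T N r using * r by unfold_locales
    show ?thesis unfolding G(2) using anisotropic_ghost[OF Gf *(1,2,5,6)] *(7) not_split_mod by blast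
  next
    case True
    \<comment> \<open>With a root \<open>r\<close> in K the norm form vanishes at
      \<open>(r, - 1)\<close>, which excludes the anisotropic alternative.\<close>
    have "split_mod T N"
    proof (rule ccontr)
      assume "\<not> ?thesis"
      then have an: "anisotropic T N" using *(7) by blast
      have "poly [:N, - T, 1:] r = 0" using r by (simp add: algebra_simps)
      moreover have "\<forall>i. coeff [:N, - T, 1:] i \<in> Ok" using * by (simp add: coeff_pCons split: nat.splits)
      moreover have "lead_coeff [:N, - T, 1:] = 1" by simp
      ultimately have "isint r" unfolding O.V.integral_def by blast
      then have rO: "r \<in> Ok" using isint_K True by blast
      have "r * r + r * (- 1) * T + (- 1) * (- 1) * N = 0" using r by simp
      moreover have "- 1 \<in> Ok" by simp
      ultimately have "O.vle (- 1) p" using an rO O.vle_0 unfolding anisotropic_def by metis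
      then show False using one_not_vle_p by (simp add: O.vle_uminus_iff)
    qed
    then show ?thesis unfolding G(2) using split_ghost[OF Gf *(1,2,5,6,3,4) True r] by blast
  qed
qed

end

theorem theorem1p1:
  fixes K :: "'a::field set" and absv :: "'a \<Rightarrow> real" and R :: "('a^2^2) set"
  assumes "nonarch_local_field K absv"
    and "\<forall>p::'a poly. degree p > 0 \<longrightarrow> (\<exists>x. poly p x = 0)"
    and "full_order K absv R"
  shows "ghost_intersection K absv R \<longleftrightarrow> bass_order K absv (gor_closure K absv R)"
proof -
  have "\<exists>pi\<in>K. 0 < absv pi \<and> absv pi < 1 \<and> (\<forall>x\<in>K. x \<noteq> 0 \<longrightarrow> (\<exists>n::int. absv x = absv pi powi n))"
    using assms(1) unfolding nonarch_local_field_def by (elim conjE)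
  then obtain pi where "local_field K absv pi" using assms(1) unfolding local_field_def by blast
  then interpret local_field K absv pi .
  show ?thesis using ghost_imp_bass bass_imp_ghost assms(2,3) by blast
qed

end
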